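(* Let $H$ be a Hilbert space with a countable spectral resolution $(e_j)_{j\in\mathbb{Z}}$, let $a\in(1,\infty)\setminus\{2\}$ and let $r\in[1,\infty)$ be such that $\frac1r>\left|\frac1a-\frac12\right|$. Then there is a constant $C_{a,r}\ge0$ such that the following holds. Let $m:\mathbb{Z}\to\mathbb{C}$, $j\mapsto m_j$, be such that $C_m:=\sup_{j\in\mathbb{Z}}(1+|j|^{1/r})|m_j|<\infty$, let $f:\mathbb{Z}\to\mathbb{Z}$ and write $m^f_{j,k}:=m_{f(j)-f(k)}$. Then the Schur multiplier operator $M^e_{m,f}$ on $\mathscr{C}^a$, given by $$M^e_{m,f}v:=\sum_{j,k\in\mathbb{Z}}m^f_{j,k}\,e_jve_k=\lim_{n\to\infty}\sum_{|j|,|k|\le n}m^f_{j,k}\,e_jve_k\qquad(v\in\mathscr{C}^a),$$ with the limit taken in $\mathscr{C}^a$, is well-defined and satisfies $\|M^e_{m,f}\|_{\mathcal{L}(\mathscr{C}^a)}\le C_{a,r}C_m$. (The constant $C_{a,r}$ is independent of $m$.)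
   Context: $\mathscr{C}^a$ denotes the Schatten $a$-class of operators on the complex Hilbert space $H$. A countable spectral resolution of $H$ is a family $(e_j)_{j\in\mathbb{Z}}$ such that each $e_j$ is an orthogonal projection in $H$, $e_je_k=0$ for $j\ne k$, and $\sum_{j\in\mathbb{Z}}e_jh=h$ for all $h\in H$. *)

theory Defs
  imports "HOL-Analysis.Analysis"
begin

section \<open>Complex Hilbert spaces\<close>

text \<open>
  HOL-Analysis only has real inner product spaces. A complex Hilbert space is a complete one
  that carries in addition a complex scalar multiplication extending the real one and a
  Hermitian form, linear in the first argument, whose real part is the given real inner product
  (so that the norm is the one induced by the Hermitian form).
\<close>

class chilbert_space = real_inner + complete_space +
  fixes cscale :: "complex \<Rightarrow> 'a \<Rightarrow> 'a"
    and cinner :: "'a \<Rightarrow> 'a \<Rightarrow> complex"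
  assumes cscale_add_right: "cscale c (x + y) = cscale c x + cscale c y"
    and cscale_add_left: "cscale (c + d) x = cscale c x + cscale d x"
    and cscale_cscale: "cscale c (cscale d x) = cscale (c * d) x"
    and cscale_of_real: "cscale (complex_of_real t) x = scaleR t x"
    and cinner_commute: "cinner x y = cnj (cinner y x)"
    and cinner_add_left: "cinner (x + y) z = cinner x z + cinner y z"
    and cinner_cscale_left: "cinner (cscale c x) y = c * cinner x y"
    and Re_cinner: "Re (cinner x y) = inner x y"

global_interpretation complex_vs: vector_space "cscale :: complex \<Rightarrow> 'h \<Rightarrow> 'h::chilbert_space"
proof
  fix x :: 'h
  show "cscale 1 x = x"
    using cscale_of_real[of 1 x] by simp
qed (simp_all add: cscale_add_right cscale_add_left cscale_cscale)

definition bounded_clinear :: "('h::chilbert_space \<Rightarrow> 'h) \<Rightarrow> bool" where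
  "bounded_clinear T \<longleftrightarrow> bounded_linear T \<and> (\<forall>c x. T (cscale c x) = cscale c (T x))"

definition cadjoint :: "('h::chilbert_space \<Rightarrow> 'h) \<Rightarrow> 'h \<Rightarrow> 'h" where
  "cadjoint T = (THE S. \<forall>x y. cinner (T x) y = cinner x (S y))"

definition orthogonal_projection :: "('h::chilbert_space \<Rightarrow> 'h) \<Rightarrow> bool" where
  "orthogonal_projection P \<longleftrightarrow>
     bounded_clinear P \<and> P \<circ> P = P \<and> (\<forall>x y. cinner (P x) y = cinner x (P y))"

definition countable_spectral_resolution :: "(int \<Rightarrow> 'h::chilbert_space \<Rightarrow> 'h) \<Rightarrow> bool" where
  "countable_spectral_resolution e \<longleftrightarrow>
     (\<forall>j. orthogonal_projection (e j)) \<and>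
     (\<forall>j k. j \<noteq> k \<longrightarrow> e j \<circ> e k = (\<lambda>_. 0)) \<and>
     (\<forall>h. ((\<lambda>j. e j h) has_sum h) UNIV)"

section \<open>Schatten classes\<close>

definition compact_operator :: "('h::chilbert_space \<Rightarrow> 'h) \<Rightarrow> bool" where
  "compact_operator T \<longleftrightarrow> bounded_clinear T \<and> compact (closure (T ` cball 0 1))"

text \<open>
  The singular values of a compact operator \<open>T\<close> are the eigenvalues of \<open>(T\<^sup>* T)\<^sup>1\<^sup>/\<^sup>2\<close>,
  counted with multiplicity. The number \<open>s > 0\<close> occurs among them as often as the complex
  dimension of the eigenspace of \<open>T\<^sup>* T\<close> for the eigenvalue \<open>s\<^sup>2\<close> says (a finite
  number, as \<open>T\<close> is compact). Sums over the singular values are therefore sums over all \<open>s > 0\<close>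
  weighted with this multiplicity, which is \<open>0\<close> if \<open>s\<close> is not a singular value.
\<close>

definition singular_value_mult :: "('h::chilbert_space \<Rightarrow> 'h) \<Rightarrow> real \<Rightarrow> nat" where
  "singular_value_mult T s =
     complex_vs.dim {x. cadjoint T (T x) = cscale (complex_of_real (s\<^sup>2)) x}"

definition schatten_class :: "real \<Rightarrow> ('h::chilbert_space \<Rightarrow> 'h) set" where
  "schatten_class a =
     {T. compact_operator T \<and> (\<lambda>s. real (singular_value_mult T s) * s powr a) summable_on {0<..}}"

definition schatten_norm :: "real \<Rightarrow> ('h::chilbert_space \<Rightarrow> 'h) \<Rightarrow> real" where
  "schatten_norm a T =
     (\<Sum>\<^sub>\<infinity>s\<in>{0<..}. real (singular_value_mult T s) * s powr a) powr (1 / a)"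

definition schatten_limit ::
  "real \<Rightarrow> (nat \<Rightarrow> 'h::chilbert_space \<Rightarrow> 'h) \<Rightarrow> ('h \<Rightarrow> 'h) \<Rightarrow> bool" where
  "schatten_limit a V w \<longleftrightarrow>
     (\<forall>n. V n \<in> schatten_class a) \<and> w \<in> schatten_class a \<and>
     (\<lambda>n. schatten_norm a (\<lambda>x. V n x - w x)) \<longlonglongrightarrow> 0"

definition bounded_schatten_operator ::
  "real \<Rightarrow> (('h::chilbert_space \<Rightarrow> 'h) \<Rightarrow> ('h \<Rightarrow> 'h)) \<Rightarrow> bool" where
  "bounded_schatten_operator a M \<longleftrightarrow>
     (\<forall>v\<in>schatten_class a. M v \<in> schatten_class a) \<and>
     (\<forall>u\<in>schatten_class a. \<forall>v\<in>schatten_class a.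
        M (\<lambda>x. u x + v x) = (\<lambda>x. M u x + M v x)) \<and>
     (\<forall>c. \<forall>v\<in>schatten_class a. M (\<lambda>x. cscale c (v x)) = (\<lambda>x. cscale c (M v x))) \<and>
     (\<exists>K. \<forall>v\<in>schatten_class a. schatten_norm a (M v) \<le> K * schatten_norm a v)"

text \<open>The set below is bounded above whenever \<open>bounded_schatten_operator a M\<close> holds; otherwise the
  real supremum is meaningless.\<close>

definition schatten_operator_norm ::
  "real \<Rightarrow> (('h::chilbert_space \<Rightarrow> 'h) \<Rightarrow> ('h \<Rightarrow> 'h)) \<Rightarrow> real" where
  "schatten_operator_norm a M =
     (SUP v\<in>{v \<in> schatten_class a. schatten_norm a v \<le> 1}. schatten_norm a (M v))"

section \<open>Schur multipliers\<close>

definition schur_partial_sum ::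
  "(int \<Rightarrow> 'h::chilbert_space \<Rightarrow> 'h) \<Rightarrow> (int \<Rightarrow> int \<Rightarrow> complex) \<Rightarrow> ('h \<Rightarrow> 'h) \<Rightarrow> nat \<Rightarrow> 'h \<Rightarrow> 'h" where
  "schur_partial_sum e \<mu> v n =
     (\<lambda>x. \<Sum>j\<in>{- int n..int n}. \<Sum>k\<in>{- int n..int n}. cscale (\<mu> j k) (e j (v (e k x))))"

definition schur_multiplier ::
  "real \<Rightarrow> (int \<Rightarrow> 'h::chilbert_space \<Rightarrow> 'h) \<Rightarrow> (int \<Rightarrow> int \<Rightarrow> complex) \<Rightarrow> ('h \<Rightarrow> 'h) \<Rightarrow> ('h \<Rightarrow> 'h)" where
  "schur_multiplier a e \<mu> v = (THE w. schatten_limit a (schur_partial_sum e \<mu> v) w)"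

end

theory Submission
  imports Defs "HOL-Complex_Analysis.Conformal_Mappings"
begin

text \<open>For finitely many orthogonal projections, pairing the multiplier with a finite rank operator gives
  a form that is trilinear in the symbol, the singular values of \<open>v\<close> and those of the test operator. On the
  Hilbert--Schmidt class this form is controlled by the supremum of the symbol. After merging the
  projections with equal \<open>f\<close>-value, the symbol is \<open>m (l - k)\<close>, its columns have square sum at most
  \<open>\<parallel>m\<parallel>\<^sub>2\<^sup>2\<close>, and the Cauchy--Schwarz inequality controls the form on the trace class and on
  bounded operators by \<open>\<parallel>m\<parallel>\<^sub>2\<close>. Stein interpolation of the two bounds yields a bound on the
  Schatten \<open>a\<close>-class by the \<open>\<ell>\<^sup>p\<close> norm of \<open>m\<close>, where \<open>1 / p = \<bar>1 / a - 1 / 2\<bar>\<close>, and this norm is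
  at most a constant times \<open>C\<^sub>m\<close> because \<open>p > r\<close>. Since \<open>v\<close> is approximated in the Schatten norm by its compressions to
  finitely many \<open>e\<^sub>j\<close>, the uniform bound makes the partial sums a Cauchy sequence.\<close>

section \<open>Hermitian forms and orthonormal families\<close>

text \<open>The Schatten class is given by multiplicities of singular values, from which not even
  the triangle inequality can be read off. Estimates therefore go through \<open>dual_bound\<close>:
  a pairing is linear in the operator and evaluates it at finitely many vectors, so bounds on
  pairings survive sums, compressions and pointwise limits, and for a compact operator that has such
  a bound the least one is the Schatten norm. Finiteness also keeps the interpolation elementary,
  since the form becomes a finite sum of exponentials. The symbol is interpolated through the power
  \<open>w / \<theta>\<close> of its modulus with \<open>\<theta> = \<bar>2 / a - 1\<bar>\<close>;
  the square sums of columns at real part 1 then become sums of powers \<open>2 / \<theta>\<close>,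
  which is the origin of p. Since \<open>f\<close> is arbitrary, a column of the original symbol may
  repeat one value of \<open>m\<close> without limit (constant \<open>f\<close> is the extreme case)
  and has no uniform \<open>\<ell>\<^sup>p\<close> bound; the merging of projections removes exactly
  these repetitions. For a > 2 the two operators in the pairing exchange roles. This does not
  transpose the symbol, so one condition on columns serves both ranges of a.\<close>

lemma cinner_add_right: "cinner x (y + z) = cinner x y + cinner x (z::'h::chilbert_space)"
  by (metis cinner_add_left cinner_commute complex_cnj_add)

lemma cinner_cscale_right: "cinner x (cscale c y) = cnj c * cinner x (y::'h::chilbert_space)"
  by (metis cinner_cscale_left cinner_commute complex_cnj_mult)

lemma cinner_zero_left [simp]: "cinner 0 (x::'h::chilbert_space) = 0"
  using cinner_add_left[of 0 0 x] by simp

lemma cinner_zero_right [simp]: "cinner (x::'h::chilbert_space) 0 = 0"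
  using cinner_add_right[of x 0 0] by simp

lemma cinner_diff_left: "cinner (x - y) z = cinner x z - cinner y (z::'h::chilbert_space)"
  using cinner_add_left[of "x - y" y z] by simp

lemma cinner_diff_right: "cinner x (y - z) = cinner x y - cinner x (z::'h::chilbert_space)"
  using cinner_add_right[of x "y - z" z] by simp

lemma cinner_sum_left: "cinner (\<Sum>i\<in>I. f i) z = (\<Sum>i\<in>I. cinner (f i) (z::'h::chilbert_space))"
  by (induction I rule: infinite_finite_induct) (auto simp: cinner_add_left)

lemma cinner_sum_right: "cinner z (\<Sum>i\<in>I. f i) = (\<Sum>i\<in>I. cinner (z::'h::chilbert_space) (f i))"
  by (induction I rule: infinite_finite_induct) (auto simp: cinner_add_right)

lemma cinner_self: "cinner x x = complex_of_real ((norm (x::'h::chilbert_space))\<^sup>2)"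
proof -
  have "Im (cinner x x) = 0"
    using arg_cong[OF cinner_commute[of x x], of Im] by simp
  thus ?thesis
    by (simp add: complex_eq_iff Re_cinner power2_norm_eq_inner)
qed

lemmas cinner_simps = cinner_add_left cinner_add_right cinner_diff_left cinner_diff_right
  cinner_cscale_left cinner_cscale_right cinner_sum_left cinner_sum_right

lemma cscale_zero_left [simp]: "cscale 0 (x::'h::chilbert_space) = 0"
  by (rule complex_vs.scale_zero_left)

lemma cscale_zero_right [simp]: "cscale c (0::'h::chilbert_space) = 0"
  by (rule complex_vs.scale_zero_right)

lemma cscale_one [simp]: "cscale 1 (x::'h::chilbert_space) = x"
  by (rule complex_vs.scale_one)

lemma norm_cscale [simp]: "norm (cscale c (x::'h::chilbert_space)) = cmod c * norm x"
proof -
  have "complex_of_real ((norm (cscale c x))\<^sup>2) = cinner (cscale c x) (cscale c x)"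
    by (simp only: cinner_self)
  also have "\<dots> = (c * cnj c) * cinner x x"
    by (simp add: cinner_cscale_left cinner_cscale_right)
  also have "(c * cnj c) * cinner x x = complex_of_real ((cmod c * norm x)\<^sup>2)"
    by (simp only: cinner_self complex_norm_square[symmetric] of_real_mult power_mult_distrib
        of_real_power)
  finally have "(norm (cscale c x))\<^sup>2 = (cmod c * norm x)\<^sup>2"
    by (simp only: of_real_eq_iff)
  thus ?thesis
    by simp
qed

lemma cmod_cinner_le: "cmod (cinner x y) \<le> norm x * norm (y::'h::chilbert_space)"
proof (cases "cinner x y = 0")
  case False
  \<comment> \<open>A unimodular rotation makes the form real and nonnegative, where the real
    Cauchy-Schwarz inequality applies.\<close>
  define c where "c = cnj (sgn (cinner x y))"
  have "complex_of_real (cmod (cinner x y)) = cinner (cscale c x) y"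
    using False
    by (simp add: cinner_simps c_def sgn_eq complex_norm_square[symmetric] field_simps power2_eq_square
        mult.commute[of "cnj _"])
  hence "cmod (cinner x y) = inner (cscale c x) y"
    by (metis Re_cinner Re_complex_of_real)
  also have "\<dots> \<le> norm (cscale c x) * norm y"
    by (rule norm_cauchy_schwarz)
  also have "norm (cscale c x) = norm x"
    using False by (simp add: c_def norm_sgn)
  finally show ?thesis .
qed simp

lemma cinner_eqI:
  assumes "\<And>y. cinner x y = cinner z (y::'h::chilbert_space)"
  shows "x = z"
proof -
  have "cinner (x - z) (x - z) = 0"
    using assms[of "x - z"] by (simp add: cinner_simps(3))
  thus ?thesis
    by (simp add: cinner_self)
qed

lemma cinner_eqI_right:
  assumes "\<And>y. cinner y x = cinner y (z::'h::chilbert_space)"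
  shows "x = z"
  by (rule cinner_eqI) (metis assms cinner_commute)

lemma bounded_linear_cinner_left: "bounded_linear (\<lambda>x. cinner x (y::'h::chilbert_space))"
proof (rule bounded_linear_intro[where K = "norm y"])
  show "cinner (r *\<^sub>R x) y = r *\<^sub>R cinner x y" for r x
    by (simp flip: cscale_of_real add: cinner_simps scaleR_conv_of_real)
qed (auto simp: cinner_simps cmod_cinner_le)

lemma norm_Pythagoras:
  fixes w :: "'i \<Rightarrow> 'h::chilbert_space"
  assumes "finite I" "\<And>i j. i \<in> I \<Longrightarrow> j \<in> I \<Longrightarrow> i \<noteq> j \<Longrightarrow> cinner (w i) (w j) = 0"
  shows "(norm (\<Sum>i\<in>I. w i))\<^sup>2 = (\<Sum>i\<in>I. (norm (w i))\<^sup>2)"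
proof -
  have "pairwise (\<lambda>i j. orthogonal (w i) (w j)) I"
    unfolding pairwise_def orthogonal_def by (metis assms(2) Re_cinner zero_complex.sel(1))
  thus ?thesis
    by (rule norm_sum_Pythagorean[OF assms(1)])
qed

text \<open>Indexed families let two systems such as \<open>u\<close> and \<open>z\<close> share the
  index of their weights; a set \<open>B\<close> of vectors enters as
  \<open>orthonormal_on B id\<close>.\<close>

definition orthonormal_on :: "'i set \<Rightarrow> ('i \<Rightarrow> 'h::chilbert_space) \<Rightarrow> bool" where
  "orthonormal_on I u \<longleftrightarrow> (\<forall>i\<in>I. \<forall>j\<in>I. cinner (u i) (u j) = (if i = j then 1 else 0))"

lemma orthonormal_onD:
  "orthonormal_on I u \<Longrightarrow> i \<in> I \<Longrightarrow> j \<in> I \<Longrightarrow> cinner (u i) (u j) = (if i = j then 1 else 0)"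
  by (auto simp: orthonormal_on_def)

lemma orthonormal_on_subset: "orthonormal_on I u \<Longrightarrow> J \<subseteq> I \<Longrightarrow> orthonormal_on J u"
  unfolding orthonormal_on_def by (meson subsetD)

lemma orthonormal_on_norm:
  assumes "orthonormal_on I u" "i \<in> I"
  shows "norm (u i) = 1"
proof -
  have "complex_of_real ((norm (u i))\<^sup>2) = complex_of_real 1"
    unfolding cinner_self[symmetric] using orthonormal_onD[OF assms assms(2)] by simp
  hence "(norm (u i))\<^sup>2 = 1"
    by (simp only: of_real_eq_iff)
  thus ?thesis
    using norm_ge_zero[of "u i"] power2_eq_1_iff[of "norm (u i)"] by linarith
qed

lemma orthonormal_on_insert:
  assumes "orthonormal_on I id" "norm x = 1" "\<And>y. y \<in> I \<Longrightarrow> cinner x y = 0"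
  shows "orthonormal_on (insert x I) id"
proof -
  have "x \<notin> I"
    using assms(2) assms(3)[of x] by (auto simp: cinner_self)
  moreover have "cinner y x = 0" if "y \<in> I" for y
    using assms(3)[OF that] cinner_commute[of y x] by simp
  ultimately show ?thesis
    using assms by (auto simp: orthonormal_on_def cinner_self)
qed

lemma orthonormal_on_norm_sum:
  assumes "finite I" "orthonormal_on I u"
  shows "(norm (\<Sum>i\<in>I. cscale (c i) (u i)))\<^sup>2 = (\<Sum>i\<in>I. (cmod (c i))\<^sup>2)"
proof -
  have "(norm (\<Sum>i\<in>I. cscale (c i) (u i)))\<^sup>2 = (\<Sum>i\<in>I. (norm (cscale (c i) (u i)))\<^sup>2)"
    by (rule norm_Pythagoras) (use assms in \<open>auto simp: cinner_simps orthonormal_onD\<close>)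
  also have "\<dots> = (\<Sum>i\<in>I. (cmod (c i))\<^sup>2)"
    by (rule sum.cong) (use assms in \<open>auto simp: power_mult_distrib orthonormal_on_norm[of I u]\<close>)
  finally show ?thesis .
qed

lemma orthonormal_on_residual:
  assumes "finite I" "orthonormal_on I u" "i \<in> I"
  shows "cinner (x - (\<Sum>j\<in>I. cscale (cinner x (u j)) (u j))) (u i) = 0"
proof -
  have "(\<Sum>j\<in>I. cinner x (u j) * cinner (u j) (u i)) = (\<Sum>j\<in>I. if j = i then cinner x (u i) else 0)"
    by (rule sum.cong) (use assms in \<open>auto simp: orthonormal_onD\<close>)
  thus ?thesis
    using assms by (simp add: cinner_simps)
qed

lemma orthonormal_on_decompose:
  assumes "finite I" "orthonormal_on I u"
  shows "(norm x)\<^sup>2 = (\<Sum>i\<in>I. (cmod (cinner x (u i)))\<^sup>2)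
           + (norm (x - (\<Sum>i\<in>I. cscale (cinner x (u i)) (u i))))\<^sup>2"
proof -
  define p where "p = (\<Sum>i\<in>I. cscale (cinner x (u i)) (u i))"
  have "cinner (x - p) p = 0"
    unfolding p_def
    by (subst cinner_sum_right) (simp add: cinner_cscale_right orthonormal_on_residual[OF assms])
  hence "inner (x - p) p = 0"
    by (metis Re_cinner zero_complex.sel(1))
  hence "(norm (p + (x - p)))\<^sup>2 = (norm p)\<^sup>2 + (norm (x - p))\<^sup>2"
    by (simp add: power2_norm_eq_inner inner_simps inner_commute)
  thus ?thesis
    unfolding p_def by (simp add: orthonormal_on_norm_sum[OF assms])
qed

lemma Bessel:
  assumes "finite I" "orthonormal_on I u"
  shows "(\<Sum>i\<in>I. (cmod (cinner x (u i)))\<^sup>2) \<le> (norm x)\<^sup>2"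
  using orthonormal_on_decompose[OF assms, of x] by simp

lemma cmod_cinner_commute: "cmod (cinner x y) = cmod (cinner y (x::'h::chilbert_space))"
  by (metis cinner_commute complex_mod_cnj)

lemma Bessel_left:
  assumes "finite I" "orthonormal_on I u"
  shows "(\<Sum>i\<in>I. (cmod (cinner (u i) x))\<^sup>2) \<le> (norm x)\<^sup>2"
  using Bessel[OF assms, of x] by (simp add: cmod_cinner_commute)

lemma product_le_half_squares: "x * y \<le> (x\<^sup>2 + y\<^sup>2) / (2::real)"
  using sum_squares_bound[of x y] by simp

lemma orthonormal_on_independent:
  assumes "orthonormal_on B id"
  shows "complex_vs.independent B"
  unfolding complex_vs.independent_explicit_module
proof (intro allI impI)
  fix t u and v :: 'a
  assume t: "finite t" "t \<subseteq> B" and eq: "(\<Sum>w\<in>t. cscale (u w) w) = 0" and v: "v \<in> t"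
  have "orthonormal_on t id"
    using assms t orthonormal_on_subset by blast
  from orthonormal_on_norm_sum[OF t(1) this, of u] eq have "(\<Sum>i\<in>t. (cmod (u i))\<^sup>2) = 0"
    by simp
  thus "u v = 0"
    using t v by (simp add: sum_nonneg_eq_0_iff)
qed

section \<open>Bounded operators\<close>

lemma bounded_clinearD:
  assumes "bounded_clinear T"
  shows "T (x + y) = T x + T y" "T (x - y) = T x - T y" "T 0 = 0" "T (cscale c x) = cscale c (T x)"
    "T (\<Sum>i\<in>I. g i) = (\<Sum>i\<in>I. T (g i))"
proof -
  interpret bounded_linear T
    using assms by (simp add: bounded_clinear_def)
  show "T (x + y) = T x + T y" "T (x - y) = T x - T y" "T 0 = 0" "T (cscale c x) = cscale c (T x)"
    "T (\<Sum>i\<in>I. g i) = (\<Sum>i\<in>I. T (g i))"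
    using assms by (auto simp: bounded_clinear_def add diff zero sum)
qed

lemma bounded_clinear_bound:
  assumes "bounded_clinear T"
  obtains K where "K > 0" "\<And>x. norm (T x) \<le> K * norm x"
  using bounded_linear.pos_bounded[of T] assms by (auto simp: bounded_clinear_def mult.commute)

lemma bounded_clinear_intro:
  assumes "\<And>x y. T (x + y) = T x + T y" "\<And>c x. T (cscale c x) = cscale c (T x)"
    "\<And>x. norm (T x) \<le> K * norm x"
  shows "bounded_clinear T"
  unfolding bounded_clinear_def
proof (intro conjI bounded_linear_intro[where K = K])
  show "T (r *\<^sub>R x) = r *\<^sub>R T x" for r x
    by (metis assms(2) cscale_of_real)
qed (use assms in \<open>auto simp: mult.commute\<close>)

lemma bounded_clinear_zero: "bounded_clinear (\<lambda>_. 0)"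
  by (rule bounded_clinear_intro[where K = 0]) auto

lemma bounded_clinear_add:
  assumes "bounded_clinear S" "bounded_clinear T"
  shows "bounded_clinear (\<lambda>x. S x + T x)"
  using assms bounded_linear_add by (auto simp: bounded_clinear_def cscale_add_right)

lemma bounded_clinear_cscale:
  assumes "bounded_clinear T"
  shows "bounded_clinear (\<lambda>x. cscale c (T x))"
proof -
  obtain K where K: "\<And>x. norm (T x) \<le> K * norm x"
    using bounded_clinear_bound[OF assms] by metis
  show ?thesis
    by (rule bounded_clinear_intro[where K = "cmod c * K"])
       (use mult_left_mono[OF K norm_ge_zero[of c]] in \<open>auto simp: bounded_clinearD[OF assms]
          cscale_add_right cscale_cscale mult_ac\<close>)
qed

lemma bounded_clinear_sum:
  assumes "\<And>i. i \<in> I \<Longrightarrow> bounded_clinear (T i)"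
  shows "bounded_clinear (\<lambda>x. \<Sum>i\<in>I. T i x)"
  using assms
  by (induction I rule: infinite_finite_induct) (auto intro: bounded_clinear_zero bounded_clinear_add)

lemma bounded_clinear_compose:
  assumes "bounded_clinear S" "bounded_clinear T"
  shows "bounded_clinear (\<lambda>x. S (T x))"
  using assms bounded_linear_compose by (auto simp: bounded_clinear_def)

lemma bounded_clinear_id: "bounded_clinear (\<lambda>x. x)"
  by (rule bounded_clinear_intro[where K = 1]) auto

lemma bounded_clinear_rank_one: "bounded_clinear (\<lambda>x. cscale (cinner x u) w)"
proof (rule bounded_clinear_intro[where K = "norm u * norm w"])
  show "norm (cscale (cinner x u) w) \<le> norm u * norm w * norm x" for x
    using mult_right_mono[OF cmod_cinner_le[of x u], of "norm w"] by (simp add: mult_ac)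
qed (auto simp: cinner_simps cscale_add_left cscale_cscale)

lemma cscale_minus_one: "cscale (-1) x = - (x::'h::chilbert_space)"
  by (metis cscale_of_real of_real_1 of_real_minus scaleR_minus1_left)

lemma bounded_clinear_diff:
  assumes "bounded_clinear S" "bounded_clinear T"
  shows "bounded_clinear (\<lambda>x. S x - T x)"
  using bounded_clinear_add[OF assms(1) bounded_clinear_cscale[OF assms(2), of "-1"]]
  by (simp add: cscale_minus_one)

section \<open>The Riesz representation theorem and adjoints\<close>

text \<open>First-order condition at an extremum: for small \<open>t\<close> of sign opposite to
  \<open>p\<close> the linear term would win. It serves both the minimiser in the Riesz theorem and
  the maximiser that yields a singular vector.\<close>

lemma quadratic_nonneg_imp_zero:
  fixes p q :: real
  assumes "\<And>t. 0 \<le> 2 * t * p + t\<^sup>2 * q"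
  shows "p = 0"
proof (rule ccontr)
  assume p: "p \<noteq> 0"
  define c where "c = \<bar>q\<bar> + 1"
  have c: "c > 0" "q < c"
    by (auto simp: c_def)
  have "0 \<le> 2 * (- p / c) * p + (- p / c)\<^sup>2 * q"
    by (rule assms)
  also have "\<dots> \<le> 2 * (- p / c) * p + (- p / c)\<^sup>2 * c"
    using c by (intro add_left_mono mult_left_mono) auto
  also have "\<dots> = - (p\<^sup>2 / c)"
    using c by (simp add: field_simps power2_eq_square)
  also have "\<dots> < 0"
    using p c by simp
  finally show False
    by simp
qed

text \<open>The representing vector minimises \<open>\<parallel>z\<parallel>\<^sup>2 - 2 \<phi> z\<close>.\<close>

lemma Riesz_representation:
  fixes \<phi> :: "'h::{real_inner,complete_space} \<Rightarrow> real"
  assumes "bounded_linear \<phi>"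
  obtains z where "\<And>x. \<phi> x = inner x z"
proof -
  interpret \<phi>: bounded_linear \<phi>
    by fact
  obtain K where K: "\<And>x. norm (\<phi> x) \<le> norm x * K"
    using \<phi>.bounded by blast
  define J where "J z = (norm z)\<^sup>2 - 2 * \<phi> z" for z
  have lower: "- K\<^sup>2 \<le> J z" for z
  proof -
    have "0 \<le> (norm z - K)\<^sup>2"
      by simp
    thus ?thesis
      using K[of z] unfolding J_def power2_diff by (simp add: mult_ac)
  qed
  define d where "d = Inf (range J)"
  have bdd: "bdd_below (range J)"
    using lower by (auto simp: bdd_below_def)
  have dJ: "d \<le> J z" for z
    unfolding d_def using bdd by (simp add: cInf_lower)
  have "\<exists>z. J z < d + 1 / real (Suc n)" for n
    using cInf_lessD[of "range J" "d + 1 / real (Suc n)"] by (auto simp: d_def)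
  then obtain s where s: "\<And>n. J (s n) < d + 1 / real (Suc n)"
    by metis
  \<comment> \<open>\<open>J\<close> is at least \<open>d\<close> at the midpoint, so the
    parallelogram law turns near-minimality of both points into closeness.\<close>
  have par: "(norm (x - y))\<^sup>2 \<le> 2 * (J x - d) + 2 * (J y - d)" for x y
  proof -
    define h where "h = (1/2) *\<^sub>R (x + y)"
    have "J x + J y - 2 * J h = (norm (x - y))\<^sup>2 / 2"
      unfolding h_def
      unfolding J_def by (simp add: \<phi>.add \<phi>.scaleR power2_norm_eq_inner inner_simps inner_commute field_simps)
    thus ?thesis
      using dJ[of h] by simp
  qed
  have "Cauchy s"
  proof (rule metric_CauchyI)
    fix e :: real assume e: "e > 0"
    obtain N where N: "1 / real (Suc N) < e\<^sup>2 / 4"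
      using nat_approx_posE[of "e\<^sup>2/4"] e by (auto simp: zero_less_power)
    define \<delta> where "\<delta> n = 1 / real (Suc n)" for n
    have "dist (s m) (s n) < e" if "m \<ge> N" "n \<ge> N" for m n
    proof -
      have "\<delta> m \<le> \<delta> N" "\<delta> n \<le> \<delta> N"
        using that by (auto simp: field_simps \<delta>_def)
      hence "J (s m) - d < e\<^sup>2 / 4" "J (s n) - d < e\<^sup>2 / 4"
        using s[of m] s[of n] N unfolding \<delta>_def[symmetric] by linarith+
      hence "2 * (J (s m) - d) + 2 * (J (s n) - d) < e\<^sup>2"
        by argo
      hence "(norm (s m - s n))\<^sup>2 < e\<^sup>2"
        using par[of "s m" "s n"] by simp
      thus ?thesis
        unfolding dist_norm using e by (simp add: power_less_imp_less_base)
    qed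
    thus "\<exists>M. \<forall>m\<ge>M. \<forall>n\<ge>M. dist (s m) (s n) < e"
      by blast
  qed
  then obtain z where z: "s \<longlonglongrightarrow> z"
    using Cauchy_convergent convergent_def by blast
  have "(\<lambda>n. J (s n)) \<longlonglongrightarrow> J z"
    unfolding J_def by (intro tendsto_intros \<phi>.tendsto z)
  moreover have "(\<lambda>n. d + 1 / real (Suc n)) \<longlonglongrightarrow> d + 0"
    using LIMSEQ_inverse_real_of_nat by (intro tendsto_intros) (simp add: inverse_eq_divide)
  ultimately have "J z \<le> d + 0"
    by (rule LIMSEQ_le) (use s less_imp_le in blast)
  hence min: "J z \<le> J x" for x
    using dJ[of x] by simp
  have "\<phi> x = inner x z" for x
  proof -
    have "0 \<le> 2 * t * (inner x z - \<phi> x) + t\<^sup>2 * inner x x" for t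
    proof -
      have "(norm (z + t *\<^sub>R x))\<^sup>2 = (norm z)\<^sup>2 + 2 * t * inner x z + t\<^sup>2 * inner x x"
        unfolding power2_norm_eq_inner
        by (simp add: inner_simps inner_commute algebra_simps power2_eq_square)
      hence "J (z + t *\<^sub>R x) - J z = 2 * t * (inner x z - \<phi> x) + t\<^sup>2 * inner x x"
        unfolding J_def by (simp add: \<phi>.add \<phi>.scaleR algebra_simps)
      thus ?thesis
        using min[of "z + t *\<^sub>R x"] by linarith
    qed
    from quadratic_nonneg_imp_zero[OF this] show ?thesis
      by simp
  qed
  thus ?thesis
    using that by blast
qed

lemma cinner_cadjoint:
  assumes "bounded_clinear T"
  shows "cinner (T x) y = cinner x (cadjoint T y)"
proof -
  have "\<exists>z. \<forall>x. cinner (T x) y = cinner x z" for y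
  proof -
    have "bounded_linear (\<lambda>x. inner (T x) y)"
      using assms unfolding bounded_clinear_def
      by (auto intro: bounded_linear_compose[OF bounded_linear_inner_left])
    then obtain z where z: "\<And>x. inner (T x) y = inner x z"
      using Riesz_representation by blast
    have "cinner (T x) y = cinner x z" for x
    proof -
      have "Re (cinner (T x) y) = Re (cinner x z)"
        using z by (simp add: Re_cinner)
      \<comment> \<open>The real theorem controls real parts only; the imaginary part is a real part
        at \<open>cscale \<i> x\<close>.\<close>
      moreover have "Re (cinner (T (cscale \<i> x)) y) = Re (cinner (cscale \<i> x) z)"
        using z by (simp add: Re_cinner)
      hence "Im (cinner (T x) y) = Im (cinner x z)"
        by (simp add: bounded_clinearD[OF assms] cinner_simps)
      ultimately show ?thesis
        by (simp add: complex_eq_iff)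
    qed
    thus ?thesis
      by blast
  qed
  then obtain S where S: "\<And>x y. cinner (T x) y = cinner x (S y)"
    by metis
  have "cadjoint T = S"
    unfolding cadjoint_def
  proof (rule the_equality)
    fix S' assume "\<forall>x y. cinner (T x) y = cinner x (S' y)"
    thus "S' = S"
      using S by (intro ext cinner_eqI_right) metis
  qed (use S in auto)
  thus ?thesis
    using S by simp
qed

text \<open>The weak form of the eigenvalue equation involves only \<open>T\<close>, so singular
  vectors can be handled without the adjoint.\<close>

lemma cadjoint_self_eq_iff:
  assumes "bounded_clinear T"
  shows "cadjoint T (T x) = cscale (complex_of_real c) x
           \<longleftrightarrow> (\<forall>y. cinner (T x) (T y) = complex_of_real c * cinner x y)"
proof -
  have *: "cinner (cadjoint T (T x)) y = cinner (T x) (T y)" for y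
    by (metis assms cinner_cadjoint cinner_commute)
  show ?thesis
    using cinner_eqI[of "cadjoint T (T x)" "cscale (complex_of_real c) x"] *
    by (auto simp: cinner_simps)
qed

section \<open>Compact operators\<close>

lemma compact_operatorI:
  assumes "bounded_clinear T" "compact K" "T ` cball 0 1 \<subseteq> K"
  shows "compact_operator T"
proof -
  have "closure (T ` cball 0 1) \<subseteq> K"
    using assms by (intro closure_minimal compact_imp_closed)
  hence "K \<inter> closure (T ` cball 0 1) = closure (T ` cball 0 1)"
    by blast
  with compact_Int_closed[OF assms(2) closed_closure, of "T ` cball 0 1"]
  have "compact (closure (T ` cball 0 1))"
    by (simp only:)
  thus ?thesis
    using assms(1) by (simp only: compact_operator_def)
qed

lemma compact_operatorE:
  assumes "compact_operator T"
  obtains K where "compact K" "T ` cball 0 1 \<subseteq> K"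
  using assms that[OF _ closure_subset] by (auto simp: compact_operator_def)

lemma compact_operator_bounded_clinear: "compact_operator T \<Longrightarrow> bounded_clinear T"
  by (simp add: compact_operator_def)

lemma compact_operator_zero: "compact_operator (\<lambda>_. 0)"
  by (rule compact_operatorI[where K = "{0}"]) (auto intro: bounded_clinear_zero)

lemma compact_operator_add:
  assumes "compact_operator S" "compact_operator T"
  shows "compact_operator (\<lambda>x. S x + T x)"
proof -
  obtain K L where "compact K" "S ` cball 0 1 \<subseteq> K" "compact L" "T ` cball 0 1 \<subseteq> L"
    using assms compact_operatorE by metis
  thus ?thesis
    using assms[THEN compact_operator_bounded_clinear]
    by (intro compact_operatorI[OF _ compact_sums[of K L]] bounded_clinear_add) fastforce+
qed

lemma compact_operator_compose_left:
  assumes "bounded_clinear S" "compact_operator T"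
  shows "compact_operator (\<lambda>x. S (T x))"
proof -
  obtain K where K: "compact K" "T ` cball 0 1 \<subseteq> K"
    using assms(2) compact_operatorE by metis
  have "bounded_linear S"
    using assms(1) by (simp add: bounded_clinear_def)
  hence "continuous_on K S"
    by (rule linear_continuous_on)
  hence "compact (S ` K)"
    using K(1) by (rule compact_continuous_image)
  moreover have "(\<lambda>x. S (T x)) ` cball 0 1 \<subseteq> S ` K"
    using K(2) by blast
  ultimately show ?thesis
    using bounded_clinear_compose[OF assms(1) compact_operator_bounded_clinear[OF assms(2)]]
    by (intro compact_operatorI)
qed

lemma compact_operator_compose_right:
  assumes "compact_operator S" "bounded_clinear T"
  shows "compact_operator (\<lambda>x. S (T x))"
proof -
  obtain K where K: "compact K" "S ` cball 0 1 \<subseteq> K"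
    using assms(1) compact_operatorE by metis
  obtain k where k: "k > 0" "\<And>x. norm (T x) \<le> k * norm x"
    using bounded_clinear_bound[OF assms(2)] by metis
  have S: "bounded_clinear S"
    using assms(1) by (rule compact_operator_bounded_clinear)
  have "S (T x) \<in> (\<lambda>y. k *\<^sub>R y) ` K" if "norm x \<le> 1" for x
  proof -
    define y where "y = cscale (complex_of_real (inverse k)) (T x)"
    have "norm (T x) \<le> k"
      using k(2)[of x] mult_left_mono[OF that, of k] k(1) by linarith
    hence "norm y \<le> 1"
      using k(1) unfolding y_def norm_cscale norm_of_real by (simp add: field_simps)
    hence "S y \<in> K"
      using K(2) by auto
    moreover have "k *\<^sub>R S y = S (T x)"
      using k(1) by (simp add: y_def bounded_clinearD[OF S] cscale_cscale flip: cscale_of_real of_real_mult)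
    ultimately show ?thesis
      by force
  qed
  thus ?thesis
    using K(1) by (intro compact_operatorI[OF bounded_clinear_compose[OF S assms(2)]
          compact_scaling[OF K(1), of k]]) auto
qed

lemma compact_operator_cscale:
  "compact_operator T \<Longrightarrow> compact_operator (\<lambda>x. cscale c (T x))"
  by (rule compact_operator_compose_left[OF bounded_clinear_cscale[OF bounded_clinear_id]])

lemma compact_operator_diff:
  assumes "compact_operator S" "compact_operator T"
  shows "compact_operator (\<lambda>x. S x - T x)"
  using compact_operator_add[OF assms(1) compact_operator_cscale[OF assms(2), of "-1"]]
  by (simp add: cscale_minus_one)

lemma compact_operator_sum:
  assumes "\<And>i. i \<in> I \<Longrightarrow> compact_operator (T i)"
  shows "compact_operator (\<lambda>x. \<Sum>i\<in>I. T i x)"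
  using assms
  by (induction I rule: infinite_finite_induct) (auto intro: compact_operator_zero compact_operator_add)

lemma compact_operator_limit:
  assumes T: "bounded_clinear T"
    and approx: "\<And>\<epsilon>. \<epsilon> > 0 \<Longrightarrow> \<exists>S. compact_operator S \<and> (\<forall>x. norm (S x - T x) \<le> \<epsilon> * norm x)"
  shows "compact_operator T"
proof -
  have "\<exists>k. finite k \<and> closure (T ` cball 0 1) \<subseteq> (\<Union>x\<in>k. ball x e)" if e: "e > 0" for e
  proof -
    obtain S where S: "compact_operator S" "\<And>x. norm (S x - T x) \<le> (e/4) * norm x"
      using approx[of "e/4"] e by auto
    have "compact (closure (S ` cball 0 1))"
      using S(1) by (simp add: compact_operator_def)
    then obtain k where k: "finite k" "closure (S ` cball 0 1) \<subseteq> (\<Union>x\<in>k. ball x (e/4))"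
      using e unfolding compact_eq_totally_bounded by (metis divide_pos_pos zero_less_numeral)
    \<comment> \<open>Closed balls of radius \<open>e / 2\<close> still cover the closure of the
      image; open balls of radius \<open>e\<close> then absorb them.\<close>
    have "T ` cball 0 1 \<subseteq> (\<Union>x\<in>k. cball x (e/2))"
    proof (intro image_subsetI)
      fix x :: 'a assume x: "x \<in> cball 0 1"
      hence "S x \<in> closure (S ` cball 0 1)"
        by (intro subsetD[OF closure_subset] imageI)
      then obtain c where c: "c \<in> k" "dist c (S x) < e/4"
        using k(2) by auto
      have "dist (S x) (T x) \<le> (e/4) * norm x"
        using S(2) by (simp add: dist_norm)
      also have "\<dots> \<le> (e/4) * 1"
        using x e by (intro mult_left_mono) auto
      finally have "dist c (T x) \<le> e/2"
        using c(2) dist_triangle[of c "T x" "S x"] by linarith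
      thus "T x \<in> (\<Union>x\<in>k. cball x (e/2))"
        using c(1) by auto
    qed
    hence "closure (T ` cball 0 1) \<subseteq> (\<Union>x\<in>k. cball x (e/2))"
      using k(1) by (intro closure_minimal closed_UN closed_cball ballI)
    also have "\<dots> \<subseteq> (\<Union>x\<in>k. ball x e)"
      using e by force
    finally show ?thesis
      using k(1) by blast
  qed
  hence "compact (closure (T ` cball 0 1))"
    unfolding compact_eq_totally_bounded by (auto simp: complete_eq_closed)
  thus ?thesis
    using T by (simp add: compact_operator_def)
qed

section \<open>Singular vectors\<close>

text \<open>Orthonormal sets of eigenvectors of \<open>T\<^sup>* T\<close>; the eigenvalue of a unit eigenvector \<open>x\<close> is
  necessarily \<open>\<parallel>T x\<parallel>\<^sup>2\<close>.\<close>

definition singular_family :: "('h::chilbert_space \<Rightarrow> 'h) \<Rightarrow> real \<Rightarrow> 'h set \<Rightarrow> bool" where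
  "singular_family T \<epsilon> B \<longleftrightarrow> orthonormal_on B id \<and>
     (\<forall>x\<in>B. \<epsilon> < norm (T x) \<and>
        (\<forall>y. cinner (T x) (T y) = complex_of_real ((norm (T x))\<^sup>2) * cinner x y))"

lemma singular_familyD:
  assumes "singular_family T \<epsilon> B"
  shows "orthonormal_on B id"
    "x \<in> B \<Longrightarrow> \<epsilon> < norm (T x)"
    "x \<in> B \<Longrightarrow> cinner (T x) (T y) = complex_of_real ((norm (T x))\<^sup>2) * cinner x y"
    "x \<in> B \<Longrightarrow> cinner (T y) (T x) = complex_of_real ((norm (T x))\<^sup>2) * cinner y x"
proof -
  show *: "cinner (T x) (T y) = complex_of_real ((norm (T x))\<^sup>2) * cinner x y" if "x \<in> B" for x y
    using assms that by (auto simp: singular_family_def)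
  show "cinner (T y) (T x) = complex_of_real ((norm (T x))\<^sup>2) * cinner y x" if "x \<in> B"
    using *[OF that, of y] cinner_commute[of y x] cinner_commute[of "T y" "T x"] by simp
qed (use assms in \<open>auto simp: singular_family_def\<close>)

text \<open>Images of distinct members are orthogonal and longer than \<epsilon>, so no ball of
  radius \<open>\<epsilon> / 2\<close> holds two of them. The bound \<open>N\<close> is uniform over
  all families, which is what allows one of largest cardinality to be chosen.\<close>

lemma singular_family_finite:
  assumes "compact_operator T" "\<epsilon> > 0"
  obtains N where "\<And>B. singular_family T \<epsilon> B \<Longrightarrow> finite B \<and> card B \<le> N"
proof -
  have "compact (closure (T ` cball 0 1))"
    using assms(1) by (simp add: compact_operator_def)
  then obtain k where k: "finite k" "closure (T ` cball 0 1) \<subseteq> (\<Union>x\<in>k. ball x (\<epsilon>/2))"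
    using assms(2) unfolding compact_eq_totally_bounded by (metis half_gt_zero)
  have "finite B \<and> card B \<le> card k" if B: "singular_family T \<epsilon> B" for B
  proof -
    note on = singular_familyD(1)[OF B]
    have "\<exists>c\<in>k. dist c (T x) < \<epsilon>/2" if "x \<in> B" for x
    proof -
      have "T x \<in> closure (T ` cball 0 1)"
        using orthonormal_on_norm[OF on that] by (intro subsetD[OF closure_subset] imageI) simp
      from subsetD[OF k(2) this] show ?thesis
        by auto
    qed
    then obtain c where c: "\<And>x. x \<in> B \<Longrightarrow> c x \<in> k" "\<And>x. x \<in> B \<Longrightarrow> dist (c x) (T x) < \<epsilon>/2"
      by metis
    have "inj_on c B"
    proof (rule inj_onI, rule ccontr)
      fix x y assume xy: "x \<in> B" "y \<in> B" "c x = c y" "x \<noteq> y"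
      have "cinner (T x) (T y) = 0"
        using singular_familyD(3)[OF B xy(1)] orthonormal_onD[OF on xy(1,2)] xy(4) by simp
      hence "inner (T x) (T y) = 0"
        by (metis Re_cinner zero_complex.sel(1))
      hence "(norm (T x - T y))\<^sup>2 = (norm (T x))\<^sup>2 + (norm (T y))\<^sup>2"
        by (simp add: power2_norm_eq_inner inner_simps inner_commute)
      also have "\<dots> \<ge> (norm (T x))\<^sup>2"
        by simp
      finally have "norm (T x) \<le> norm (T x - T y)"
        by (rule power2_le_imp_le) simp
      moreover have "dist (T x) (T y) < \<epsilon>"
        using dist_triangle2[of "T x" "T y" "c x"] c(2)[OF xy(1)] c(2)[OF xy(2)] xy(3)
        by (simp add: dist_commute)
      ultimately show False
        using singular_familyD(2)[OF B xy(1)] by (simp add: dist_norm)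
    qed
    moreover have "c ` B \<subseteq> k"
      using c(1) by blast
    ultimately show ?thesis
      using k(1) card_inj_on_le inj_on_finite by blast
  qed
  thus ?thesis
    using that by blast
qed

text \<open>\<open>T\<close> attains its norm on the orthogonal complement of \<open>B\<close>: a maximising sequence whose image
  converges is Cauchy by the parallelogram law.\<close>

lemma singular_vector_exists:
  assumes T: "compact_operator T" and fin: "finite B" and B: "singular_family T \<epsilon> B"
    and \<epsilon>: "\<epsilon> \<ge> 0" and y0: "\<And>b. b \<in> B \<Longrightarrow> cinner y0 b = 0" "\<epsilon> * norm y0 < norm (T y0)"
  obtains x where "norm x = 1" "\<And>b. b \<in> B \<Longrightarrow> cinner x b = 0" "\<epsilon> < norm (T x)"
    "\<And>y. cinner (T x) (T y) = complex_of_real ((norm (T x))\<^sup>2) * cinner x y"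
proof -
  have lin: "bounded_clinear T"
    using T by (rule compact_operator_bounded_clinear)
  note Tlin = bounded_clinearD[OF lin]
  have Tscale: "T (t *\<^sub>R y) = t *\<^sub>R T y" for t y
    using Tlin(4)[of "complex_of_real t" y] by (simp add: cscale_of_real)
  have Tcont: "isCont T y" for y
    using lin linear_continuous_at unfolding bounded_clinear_def by blast
  obtain K where K: "\<And>x. norm (T x) \<le> K * norm x" "K > 0"
    using bounded_clinear_bound[OF lin] by metis
  define X where "X = {y. \<forall>b\<in>B. cinner y b = 0}"
  have X_add: "y + z \<in> X" if "y \<in> X" "z \<in> X" for y z
    using that by (auto simp: X_def cinner_simps)
  have X_cscale: "cscale c y \<in> X" if "y \<in> X" for y c
    using that by (auto simp: X_def cinner_simps)
  have X_scale: "t *\<^sub>R y \<in> X" if "y \<in> X" for y t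
    using X_cscale[OF that, of "complex_of_real t"] by (simp add: cscale_of_real)
  define A where "A = (\<lambda>y. norm (T y)) ` (X \<inter> cball 0 1)"
  define \<sigma> where "\<sigma> = Sup A"
  have "a \<le> K" if "a \<in> A" for a
    using that K unfolding A_def
    by (auto simp: intro!: order_trans[OF K(1)] mult_left_le)
  hence bdd: "bdd_above A"
    by (auto simp: bdd_above_def)
  have A0: "A \<noteq> {}"
    unfolding A_def X_def by (auto simp: ex_in_conv[symmetric] intro!: exI[of _ 0])
  have le: "norm (T y) \<le> \<sigma> * norm y" if "y \<in> X" for y
  proof (cases "y = 0")
    case False
    have "norm (T ((1 / norm y) *\<^sub>R y)) \<in> A"
      unfolding A_def using X_scale[OF that] False by (intro imageI) auto
    hence "norm (T ((1 / norm y) *\<^sub>R y)) \<le> \<sigma>"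
      unfolding \<sigma>_def using bdd by (rule cSup_upper)
    thus ?thesis
      using False by (simp add: Tscale field_simps)
  qed (simp add: Tlin)
  have "y0 \<in> X"
    using y0(1) by (simp add: X_def)
  have "y0 \<noteq> 0"
    using y0(2) by (auto simp: Tlin)
  have "\<epsilon> * norm y0 < \<sigma> * norm y0"
    using le[OF \<open>y0 \<in> X\<close>] y0(2) by linarith
  hence \<sigma>\<epsilon>: "\<epsilon> < \<sigma>"
    using \<open>y0 \<noteq> 0\<close> by simp
  hence \<sigma>: "\<sigma> > 0"
    using \<epsilon> by linarith
  have "\<exists>y. y \<in> X \<and> norm y \<le> 1 \<and> \<sigma> - 1 / real (Suc n) < norm (T y)" for n
    using less_cSupD[OF A0, of "\<sigma> - 1 / real (Suc n)"] unfolding \<sigma>_def[symmetric]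
    by (auto simp: A_def)
  then obtain s where s: "\<And>n. s n \<in> X" "\<And>n. norm (s n) \<le> 1"
    "\<And>n. \<sigma> - 1 / real (Suc n) < norm (T (s n))"
    by metis
  obtain C where C: "compact C" "T ` cball 0 1 \<subseteq> C"
    using T compact_operatorE by metis
  have "T (s n) \<in> C" for n
    using C(2) s(2)[of n] by auto
  then obtain w r where r: "strict_mono r" "(\<lambda>n. T (s (r n))) \<longlonglongrightarrow> w"
    using C(1)[unfolded compact_def, rule_format, of "\<lambda>n. T (s n)"] unfolding o_def by metis
  define p where "p n = s (r n)" for n
  have w: "(\<lambda>n. T (p n)) \<longlonglongrightarrow> w"
    using r(2) by (simp add: p_def)
  have p: "p n \<in> X" "norm (p n) \<le> 1" for n
    using s by (auto simp: p_def)
  have w_ge: "\<sigma> \<le> norm w"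
  proof (rule LIMSEQ_le)
    have "(\<lambda>n. \<sigma> - 1 / real (Suc n)) \<longlonglongrightarrow> \<sigma> - 0"
      using LIMSEQ_inverse_real_of_nat by (intro tendsto_intros) (simp add: inverse_eq_divide)
    thus "(\<lambda>n. \<sigma> - 1 / real (Suc (r n))) \<longlonglongrightarrow> \<sigma>"
      using LIMSEQ_subseq_LIMSEQ[OF _ r(1)] by (fastforce simp: o_def)
    show "(\<lambda>n. norm (T (p n))) \<longlonglongrightarrow> norm w"
      by (rule tendsto_norm[OF w])
    show "\<exists>N. \<forall>n\<ge>N. \<sigma> - 1 / real (Suc (r n)) \<le> norm (T (p n))"
      using s(3) less_imp_le unfolding p_def by blast
  qed
  have "Cauchy p"
  proof (rule metric_CauchyI)
    fix e :: real assume e: "e > 0"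
    \<comment> \<open>Near-maximality will give \<open>\<sigma>\<^sup>2 * (norm (p m - p n))\<^sup>2
      < 8 * \<sigma> * \<delta>\<close>. The second entry of the minimum makes this at most
      \<open>\<sigma>\<^sup>2 * e\<^sup>2\<close>; the first keeps
      \<open>\<sigma> - \<delta>\<close> nonnegative for squaring.\<close>
    define \<delta> where "\<delta> = min \<sigma> (e\<^sup>2 * \<sigma> / 8)"
    have \<delta>: "\<delta> > 0" "\<delta> \<le> \<sigma>" "8 * \<delta> \<le> e\<^sup>2 * \<sigma>"
      using \<sigma> e by (auto simp: \<delta>_def min_def)
    obtain N where N: "\<And>n. n \<ge> N \<Longrightarrow> norm (T (p n) - w) < \<delta>"
      using LIMSEQ_D[OF w \<delta>(1)] by metis
    have "dist (p m) (p n) < e" if mn: "m \<ge> N" "n \<ge> N" for m n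
    proof -
      have "2 * norm w \<le> norm (T (p m + p n)) + norm (T (p m) - w) + norm (T (p n) - w)"
      proof -
        have "2 *\<^sub>R w = T (p m + p n) - (T (p m) - w) - (T (p n) - w)"
          by (simp add: Tlin scaleR_2)
        hence "2 * norm w = norm (T (p m + p n) - (T (p m) - w) - (T (p n) - w))"
          by (metis norm_scaleR abs_numeral)
        also have "\<dots> \<le> norm (T (p m + p n)) + norm (T (p m) - w) + norm (T (p n) - w)"
          by (meson add_right_mono norm_triangle_ineq4 order_trans)
        finally show ?thesis .
      qed
      moreover have "norm (T (p m + p n)) \<le> \<sigma> * norm (p m + p n)"
        by (rule le[OF X_add[OF p(1) p(1)]])
      ultimately have "2 * (\<sigma> - \<delta>) < \<sigma> * norm (p m + p n)"
        using N[OF mn(1)] N[OF mn(2)] w_ge by argo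
      hence "(2 * (\<sigma> - \<delta>))\<^sup>2 < (\<sigma> * norm (p m + p n))\<^sup>2"
        using \<delta>(2) by (intro power_strict_mono) auto
      moreover have sq: "(2 * (\<sigma> - \<delta>))\<^sup>2 = 4 * \<sigma>\<^sup>2 - 8 * \<sigma> * \<delta> + 4 * \<delta>\<^sup>2"
        by (simp add: power2_eq_square algebra_simps)
      ultimately have "4 * \<sigma>\<^sup>2 - 8 * \<sigma> * \<delta> < \<sigma>\<^sup>2 * (norm (p m + p n))\<^sup>2"
        using zero_le_power2[of \<delta>] unfolding sq power_mult_distrib[of \<sigma>] by argo
      moreover have "(norm (p m - p n))\<^sup>2 \<le> 4 - (norm (p m + p n))\<^sup>2"
      proof -
        have "(norm (p m - p n))\<^sup>2 + (norm (p m + p n))\<^sup>2 = 2 * (norm (p m))\<^sup>2 + 2 * (norm (p n))\<^sup>2"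
          by (simp add: power2_norm_eq_inner inner_simps inner_commute)
        moreover have "(norm (p m))\<^sup>2 \<le> 1" "(norm (p n))\<^sup>2 \<le> 1"
          using p(2) by (simp_all add: power_le_one)
        ultimately show ?thesis
          by linarith
      qed
      hence "\<sigma>\<^sup>2 * (norm (p m - p n))\<^sup>2 \<le> \<sigma>\<^sup>2 * (4 - (norm (p m + p n))\<^sup>2)"
        by (rule mult_left_mono) simp
      ultimately have "\<sigma>\<^sup>2 * (norm (p m - p n))\<^sup>2 < \<sigma> * (8 * \<delta>)"
        by (simp add: algebra_simps)
      also have "\<dots> \<le> \<sigma> * (e\<^sup>2 * \<sigma>)"
        using \<delta>(3) \<sigma> by (intro mult_left_mono) auto
      finally have "\<sigma>\<^sup>2 * (norm (p m - p n))\<^sup>2 < \<sigma>\<^sup>2 * e\<^sup>2"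
        by (simp add: power2_eq_square mult_ac)
      hence "(norm (p m - p n))\<^sup>2 < e\<^sup>2"
        using \<sigma> by simp
      thus ?thesis
        unfolding dist_norm using e by (simp add: power_less_imp_less_base)
    qed
    thus "\<exists>M. \<forall>m\<ge>M. \<forall>n\<ge>M. dist (p m) (p n) < e"
      by blast
  qed
  then obtain x where x: "p \<longlonglongrightarrow> x"
    using Cauchy_convergent convergent_def by blast
  have "T x = w"
    using isCont_tendsto_compose[OF Tcont x] w LIMSEQ_unique by blast
  have "x \<in> X"
    unfolding X_def
  proof (intro CollectI ballI)
    fix b assume "b \<in> B"
    hence "(\<lambda>n. 0) \<longlonglongrightarrow> cinner x b"
      using bounded_linear.tendsto[OF bounded_linear_cinner_left x, of b] p(1) by (simp add: X_def)
    thus "cinner x b = 0"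
      using LIMSEQ_const_iff by metis
  qed
  have "norm x \<le> 1"
    using tendsto_norm[OF x] p(2) by (intro LIMSEQ_le_const2) auto
  moreover have "\<sigma> \<le> \<sigma> * norm x"
    using le[OF \<open>x \<in> X\<close>] w_ge unfolding \<open>T x = w\<close> by linarith
  ultimately have nx: "norm x = 1"
    using \<sigma> by simp
  have nTx: "norm (T x) = \<sigma>"
    using le[OF \<open>x \<in> X\<close>] w_ge \<open>T x = w\<close> nx by simp
  have Re_eq: "inner (T x) (T y) = \<sigma>\<^sup>2 * inner x y" if y: "y \<in> X" for y
  proof -
    \<comment> \<open>The quadratic is \<open>(\<sigma> * norm (x + t *\<^sub>R y))\<^sup>2 - (norm
      (T (x + t *\<^sub>R y)))\<^sup>2\<close>, which is nonnegative and vanishes at t = 0.\<close>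
    have "0 \<le> 2 * t * (\<sigma>\<^sup>2 * inner x y - inner (T x) (T y)) + t\<^sup>2 * (\<sigma>\<^sup>2 * inner y y - inner (T y) (T y))"
      for t
    proof -
      have "(norm (T (x + t *\<^sub>R y)))\<^sup>2 \<le> (\<sigma> * norm (x + t *\<^sub>R y))\<^sup>2"
        using le[OF X_add[OF \<open>x \<in> X\<close> X_scale[OF y]]] by (intro power_mono) auto
      moreover have "(norm (T (x + t *\<^sub>R y)))\<^sup>2
          = \<sigma>\<^sup>2 + 2 * t * inner (T x) (T y) + t\<^sup>2 * inner (T y) (T y)"
        unfolding nTx[symmetric] power2_norm_eq_inner
        by (simp add: Tlin Tscale inner_simps inner_commute algebra_simps power2_eq_square)
      moreover have "(\<sigma> * norm (x + t *\<^sub>R y))\<^sup>2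
          = \<sigma>\<^sup>2 * (1 + 2 * t * inner x y + t\<^sup>2 * inner y y)"
      proof -
        have "inner x x = 1"
          using nx by (simp flip: power2_norm_eq_inner)
        thus ?thesis
          unfolding power_mult_distrib power2_norm_eq_inner
          by (simp add: inner_simps inner_commute algebra_simps power2_eq_square)
      qed
      ultimately show ?thesis
        by (simp add: algebra_simps)
    qed
    from quadratic_nonneg_imp_zero[OF this] show ?thesis
      by simp
  qed
  have eq_X: "cinner (T x) (T y) = complex_of_real (\<sigma>\<^sup>2) * cinner x y" if y: "y \<in> X" for y
  proof -
    have "Re (cinner (T x) (T y)) = \<sigma>\<^sup>2 * Re (cinner x y)"
      using Re_eq[OF y] by (simp add: Re_cinner)
    moreover have "Re (cinner (T x) (T (cscale \<i> y))) = \<sigma>\<^sup>2 * Re (cinner x (cscale \<i> y))"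
      using Re_eq[OF X_cscale[OF y]] by (simp add: Re_cinner)
    hence "Im (cinner (T x) (T y)) = \<sigma>\<^sup>2 * Im (cinner x y)"
      by (simp add: Tlin cinner_simps)
    ultimately show ?thesis
      by (simp add: complex_eq_iff)
  qed
  have xB: "cinner x b = 0" if "b \<in> B" for b
    using \<open>x \<in> X\<close> that by (simp add: X_def)
  have "cinner (T x) (T y) = complex_of_real ((norm (T x))\<^sup>2) * cinner x y" for y
  proof -
    \<comment> \<open>Splitting off the part of \<open>y\<close> in the span of \<open>B\<close>,
      where both sides vanish, extends the identity from \<open>X\<close> to the whole
      space.\<close>
    define q where "q = (\<Sum>b\<in>B. cscale (cinner y b) b)"
    have "y - q \<in> X"
      unfolding X_def q_def
      using orthonormal_on_residual[OF fin singular_familyD(1)[OF B], of _ y] by simp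
    note eq_X[OF this]
    moreover have "cinner (T x) (T q) = 0" "cinner x q = 0"
      unfolding q_def using singular_familyD(4)[OF B] xB
      by (simp_all add: Tlin cinner_sum_right cinner_cscale_right)
    ultimately show ?thesis
      by (simp add: Tlin cinner_diff_right nTx)
  qed
  thus ?thesis
    using that nx xB nTx \<sigma>\<epsilon> by metis
qed

text \<open>A singular family of maximal cardinality leaves nothing above the threshold \<open>\<epsilon>\<close>.\<close>

lemma singular_family_extend:
  assumes T: "compact_operator T" and \<epsilon>: "\<epsilon> > 0" and B: "singular_family T \<epsilon> B"
  obtains B' where "B \<subseteq> B'" "finite B'" "singular_family T \<epsilon> B'"
    "\<And>y. (\<And>b. b \<in> B' \<Longrightarrow> cinner y b = 0) \<Longrightarrow> norm (T y) \<le> \<epsilon> * norm y"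
proof -
  obtain N where N: "\<And>B. singular_family T \<epsilon> B \<Longrightarrow> finite B \<and> card B \<le> N"
    using singular_family_finite[OF T \<epsilon>] by metis
  have "\<exists>B'. (B \<subseteq> B' \<and> singular_family T \<epsilon> B')
      \<and> (\<forall>B''. B \<subseteq> B'' \<and> singular_family T \<epsilon> B'' \<longrightarrow> card B'' \<le> card B')"
    by (rule ex_has_greatest_nat[where k = B and b = "Suc N"]) (use B N in \<open>auto simp: less_Suc_eq_le\<close>)
  then obtain B' where B': "B \<subseteq> B'" "singular_family T \<epsilon> B'"
    "\<And>B''. B \<subseteq> B'' \<Longrightarrow> singular_family T \<epsilon> B'' \<Longrightarrow> card B'' \<le> card B'"
    by blast
  have fin: "finite B'"
    using N B' by blast
  have "norm (T y) \<le> \<epsilon> * norm y" if y: "\<And>b. b \<in> B' \<Longrightarrow> cinner y b = 0" for y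
  proof (rule ccontr)
    assume "\<not> norm (T y) \<le> \<epsilon> * norm y"
    then obtain x where x: "norm x = 1" "\<And>b. b \<in> B' \<Longrightarrow> cinner x b = 0" "\<epsilon> < norm (T x)"
      "\<And>y. cinner (T x) (T y) = complex_of_real ((norm (T x))\<^sup>2) * cinner x y"
      using singular_vector_exists[OF T fin B'(2), of y] y \<epsilon> by (metis less_imp_le not_le)
    have "singular_family T \<epsilon> (insert x B')"
      using B'(2) x orthonormal_on_insert[of B' x] unfolding singular_family_def by blast
    hence "card (insert x B') \<le> card B'"
      using B'(1,3) by blast
    moreover have "x \<notin> B'"
      using x(1) x(2)[of x] by (auto simp: cinner_self)
    ultimately show False
      using fin by simp
  qed
  thus ?thesis
    using that B' fin by blast
qed

text \<open>An eigenvector for \<open>s\<close> is orthogonal to the members of \<open>B\<close>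
  with other eigenvalues. Once its components along the members with \<open>norm (T x) = s\<close>
  are removed, the rest is orthogonal to all of \<open>B\<close>; \<open>T\<close> stretches it by
  exactly \<open>s\<close> and by at most \<open>\<epsilon> < s\<close>, so it vanishes.\<close>

lemma singular_value_mult_eq_card:
  assumes T: "compact_operator T" and \<epsilon>: "\<epsilon> > 0" "\<epsilon> < s"
    and B: "finite B" "singular_family T \<epsilon> B"
    and compl: "\<And>y. (\<And>b. b \<in> B \<Longrightarrow> cinner y b = 0) \<Longrightarrow> norm (T y) \<le> \<epsilon> * norm y"
  shows "singular_value_mult T s = card {x \<in> B. norm (T x) = s}"
proof -
  have lin: "bounded_clinear T"
    using T by (rule compact_operator_bounded_clinear)
  define C where "C = {x \<in> B. norm (T x) = s}"
  define V where "V = {x. \<forall>y. cinner (T x) (T y) = complex_of_real (s\<^sup>2) * cinner x y}"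
  have V: "{x. cadjoint T (T x) = cscale (complex_of_real (s\<^sup>2)) x} = V"
    unfolding V_def cadjoint_self_eq_iff[OF lin] ..
  have C: "finite C" "orthonormal_on C id" "C \<subseteq> V"
    using B singular_familyD(3)[OF B(2)] orthonormal_on_subset[OF singular_familyD(1)[OF B(2)], of C]
    by (auto simp: C_def V_def)
  have "v \<in> complex_vs.span C" if v: "v \<in> V" for v
  proof -
    define q where "q = (\<Sum>c\<in>C. cscale (cinner v c) c)"
    have q: "q \<in> complex_vs.span C"
      unfolding q_def by (intro complex_vs.span_sum complex_vs.span_scale complex_vs.span_base)
    have qV: "cinner (T q) (T y) = complex_of_real (s\<^sup>2) * cinner q y" for y
      using C(3) unfolding q_def
      by (auto simp: bounded_clinearD[OF lin] cinner_sum_left cinner_cscale_left V_def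
          sum_distrib_left mult_ac subset_iff intro!: sum.cong)
    have vV: "cinner (T (v - q)) (T y) = complex_of_real (s\<^sup>2) * cinner (v - q) y" for y
      using qV v by (simp add: bounded_clinearD[OF lin] cinner_diff_left V_def algebra_simps)
    have "cinner (v - q) b = 0" if b: "b \<in> B" for b
    proof (cases "b \<in> C")
      case True
      thus ?thesis
        unfolding q_def using orthonormal_on_residual[OF C(1,2), of b v] by simp
    next
      case False
      hence "norm (T b) \<noteq> s"
        using b by (simp add: C_def)
      hence "(norm (T b))\<^sup>2 \<noteq> s\<^sup>2"
        using \<epsilon> by (simp add: power2_eq_iff_nonneg)
      hence "complex_of_real (s\<^sup>2) \<noteq> complex_of_real ((norm (T b))\<^sup>2)"
        by (simp only: of_real_eq_iff not_sym)
      moreover have "complex_of_real (s\<^sup>2) * cinner (v - q) b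
          = complex_of_real ((norm (T b))\<^sup>2) * cinner (v - q) b"
        by (rule trans[OF vV[of b, symmetric] singular_familyD(4)[OF B(2) b]])
      ultimately show ?thesis
        using mult_cancel_right by blast
    qed
    hence "norm (T (v - q)) \<le> \<epsilon> * norm (v - q)"
      by (rule compl)
    moreover have "complex_of_real ((norm (T (v - q)))\<^sup>2) = complex_of_real ((s * norm (v - q))\<^sup>2)"
      using vV[of "v - q"] by (simp add: cinner_self power_mult_distrib)
    hence "(norm (T (v - q)))\<^sup>2 = (s * norm (v - q))\<^sup>2"
      by (simp only: of_real_eq_iff)
    hence "norm (T (v - q)) = s * norm (v - q)"
      using \<epsilon> by (simp add: power2_eq_iff_nonneg)
    ultimately have "s * norm (v - q) \<le> \<epsilon> * norm (v - q)"
      by simp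
    hence "norm (v - q) = 0"
      using \<epsilon> by (metis mult_le_cancel_right norm_ge_zero not_le order_le_less)
    thus ?thesis
      using q by simp
  qed
  thus ?thesis
    unfolding singular_value_mult_def V C_def[symmetric]
    by (intro complex_vs.dim_unique[OF C(3)] orthonormal_on_independent[OF C(2)]) auto
qed

section \<open>Schatten norms by duality\<close>

text \<open>\<open>K\<close> bounds the pairing of \<open>T\<close> with every finite rank operator whose singular values \<open>b\<close> satisfy
  \<open>\<Sum> b\<^sup>q \<le> 1\<close>, where \<open>q = a / (a - 1)\<close> is the conjugate exponent. Index sets are taken in \<open>'h\<close> only to
  have some fixed type at hand; it is large enough for every orthonormal family in \<open>'h\<close>.\<close>

definition dual_bound :: "real \<Rightarrow> ('h::chilbert_space \<Rightarrow> 'h) \<Rightarrow> real \<Rightarrow> bool" where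
  "dual_bound a T K \<longleftrightarrow> (\<forall>(I :: 'h set) u z b. finite I \<longrightarrow> orthonormal_on I u \<longrightarrow> orthonormal_on I z \<longrightarrow>
     (\<forall>i\<in>I. 0 \<le> b i) \<longrightarrow> (\<Sum>i\<in>I. b i powr (a / (a - 1))) \<le> 1 \<longrightarrow>
     cmod (\<Sum>i\<in>I. complex_of_real (b i) * cinner (T (u i)) (z i)) \<le> K)"

lemma dual_boundI:
  fixes T :: "'h::chilbert_space \<Rightarrow> 'h"
  assumes "\<And>(I :: 'h set) u z b. finite I \<Longrightarrow> orthonormal_on I u \<Longrightarrow> orthonormal_on I z \<Longrightarrow>
     (\<And>i. i \<in> I \<Longrightarrow> 0 \<le> b i) \<Longrightarrow> (\<Sum>i\<in>I. b i powr (a / (a - 1))) \<le> 1 \<Longrightarrow>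
     cmod (\<Sum>i\<in>I. complex_of_real (b i) * cinner (T (u i)) (z i)) \<le> K"
  shows "dual_bound a T K"
  unfolding dual_bound_def
proof (intro allI impI)
  fix I :: "'h set" and u z :: "'h \<Rightarrow> 'h" and b
  assume "finite I" "orthonormal_on I u" "orthonormal_on I z" "\<forall>i\<in>I. 0 \<le> b i"
    "(\<Sum>i\<in>I. b i powr (a / (a - 1))) \<le> 1"
  thus "cmod (\<Sum>i\<in>I. complex_of_real (b i) * cinner (T (u i)) (z i)) \<le> K"
    by (intro assms) auto
qed

lemma dual_boundD:
  fixes I :: "'h::chilbert_space set" and T :: "'h \<Rightarrow> 'h"
  assumes "dual_bound a T K" "finite I" "orthonormal_on I u" "orthonormal_on I z"
    "\<And>i. i \<in> I \<Longrightarrow> 0 \<le> b i" "(\<Sum>i\<in>I. b i powr (a / (a - 1))) \<le> 1"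
  shows "cmod (\<Sum>i\<in>I. complex_of_real (b i) * cinner (T (u i)) (z i)) \<le> K"
  using assms(1)[unfolded dual_bound_def, THEN spec[of _ I], THEN spec[of _ u], THEN spec[of _ z],
      THEN spec[of _ b]] assms(2-) by simp

lemma dual_bound_mono: "dual_bound a T K \<Longrightarrow> K \<le> L \<Longrightarrow> dual_bound a T L"
  unfolding dual_bound_def by (meson order_trans)

lemma dual_bound_nonneg:
  assumes "dual_bound a T K"
  shows "0 \<le> K"
  using dual_boundD[OF assms, of "{}"] by (simp add: orthonormal_on_def)

lemma dual_bound_zero: "dual_bound a (\<lambda>_. 0) 0"
  by (rule dual_boundI) simp

lemma dual_bound_add:
  assumes "dual_bound a S K" "dual_bound a T L"
  shows "dual_bound a (\<lambda>x. S x + T x) (K + L)"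
proof (rule dual_boundI)
  fix I :: "'a set" and u z :: "'a \<Rightarrow> 'a" and b
  assume *: "finite I" "orthonormal_on I u" "orthonormal_on I z" "\<And>i. i \<in> I \<Longrightarrow> 0 \<le> b i"
    "(\<Sum>i\<in>I. b i powr (a / (a - 1))) \<le> 1"
  have eq: "(\<Sum>i\<in>I. complex_of_real (b i) * cinner (S (u i) + T (u i)) (z i))
      = (\<Sum>i\<in>I. complex_of_real (b i) * cinner (S (u i)) (z i))
        + (\<Sum>i\<in>I. complex_of_real (b i) * cinner (T (u i)) (z i))"
    by (simp add: cinner_add_left distrib_left sum.distrib)
  show "cmod (\<Sum>i\<in>I. complex_of_real (b i) * cinner (S (u i) + T (u i)) (z i)) \<le> K + L"
    unfolding eq by (rule norm_triangle_mono[OF dual_boundD[OF assms(1) *] dual_boundD[OF assms(2) *]])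
qed

lemma dual_bound_cscale:
  assumes "dual_bound a T K"
  shows "dual_bound a (\<lambda>x. cscale c (T x)) (cmod c * K)"
proof (rule dual_boundI)
  fix I :: "'a set" and u z :: "'a \<Rightarrow> 'a" and b
  assume *: "finite I" "orthonormal_on I u" "orthonormal_on I z" "\<And>i. i \<in> I \<Longrightarrow> 0 \<le> b i"
    "(\<Sum>i\<in>I. b i powr (a / (a - 1))) \<le> 1"
  have "(\<Sum>i\<in>I. complex_of_real (b i) * cinner (cscale c (T (u i))) (z i))
      = c * (\<Sum>i\<in>I. complex_of_real (b i) * cinner (T (u i)) (z i))"
    by (simp add: cinner_cscale_left sum_distrib_left mult_ac)
  thus "cmod (\<Sum>i\<in>I. complex_of_real (b i) * cinner (cscale c (T (u i))) (z i)) \<le> cmod c * K"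
    using dual_boundD[OF assms *] by (simp add: norm_mult mult_left_mono)
qed

lemma dual_bound_sum:
  assumes "\<And>i. i \<in> A \<Longrightarrow> dual_bound a (T i) (K i)"
  shows "dual_bound a (\<lambda>x. \<Sum>i\<in>A. T i x) (\<Sum>i\<in>A. K i)"
  using assms
  by (induction A rule: infinite_finite_induct) (auto intro: dual_bound_zero dual_bound_add)

lemma dual_bound_diff:
  assumes "dual_bound a S K" "dual_bound a T L"
  shows "dual_bound a (\<lambda>x. S x - T x) (K + L)"
  using dual_bound_add[OF assms(1) dual_bound_cscale[OF assms(2), of "-1"]]
  by (simp add: cscale_minus_one)

text \<open>A single pairing evaluates the operators at finitely many vectors, so strong convergence
  is enough for this semicontinuity.\<close>

lemma dual_bound_limit:
  assumes "\<And>x. (\<lambda>n. S n x) \<longlonglongrightarrow> T x" "eventually (\<lambda>n. dual_bound a (S n) K) sequentially"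
  shows "dual_bound a T K"
proof (rule dual_boundI)
  fix I :: "'a set" and u z :: "'a \<Rightarrow> 'a" and b
  assume *: "finite I" "orthonormal_on I u" "orthonormal_on I z" "\<And>i. i \<in> I \<Longrightarrow> 0 \<le> b i"
    "(\<Sum>i\<in>I. b i powr (a / (a - 1))) \<le> 1"
  have "(\<lambda>n. cmod (\<Sum>i\<in>I. complex_of_real (b i) * cinner (S n (u i)) (z i)))
      \<longlonglongrightarrow> cmod (\<Sum>i\<in>I. complex_of_real (b i) * cinner (T (u i)) (z i))"
    by (intro tendsto_intros bounded_linear.tendsto[OF bounded_linear_cinner_left] assms(1))
  moreover have "eventually (\<lambda>n. cmod (\<Sum>i\<in>I. complex_of_real (b i) * cinner (S n (u i)) (z i)) \<le> K)
      sequentially"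
    using assms(2) by eventually_elim (rule dual_boundD[OF _ *])
  ultimately show "cmod (\<Sum>i\<in>I. complex_of_real (b i) * cinner (T (u i)) (z i)) \<le> K"
    by (rule tendsto_upperbound) simp
qed

text \<open>Testing with the rank one operator between the directions of \<open>x\<close> and
  \<open>T x\<close> shows that every dual bound dominates the operator norm.\<close>

lemma dual_bound_norm:
  assumes T: "bounded_clinear T" and K: "dual_bound a T K"
  shows "norm (T x) \<le> K * norm x"
proof (cases "T x = 0")
  case True
  thus ?thesis
    using dual_bound_nonneg[OF K] by simp
next
  case False
  hence x: "x \<noteq> 0"
    using bounded_clinearD(3)[OF T] by auto
  define u z where "u = cscale (complex_of_real (1 / norm x)) x"
    and "z = cscale (complex_of_real (1 / norm (T x))) (T x)"
  have "norm u = 1" "norm z = 1"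
    using x False unfolding u_def z_def norm_cscale norm_of_real by simp_all
  hence "orthonormal_on {x} (\<lambda>_. u)" "orthonormal_on {x} (\<lambda>_. z)"
    by (simp_all add: orthonormal_on_def cinner_self)
  hence "cmod (cinner (T u) z) \<le> K"
    using dual_boundD[OF K, of "{x}" "\<lambda>_. u" "\<lambda>_. z" "\<lambda>_. 1"] by simp
  moreover have "cinner (T u) z = complex_of_real (norm (T x) / norm x)"
    using False by (simp add: u_def z_def bounded_clinearD[OF T] cinner_simps cinner_self power2_eq_square)
  ultimately have "norm (T x) / norm x \<le> K"
    by (simp only: norm_of_real abs_divide abs_norm_cancel)
  thus ?thesis
    using x by (simp add: field_simps)
qed

lemma weight_le_one:
  fixes b :: "'i \<Rightarrow> real"
  assumes "finite I" "\<And>i. i \<in> I \<Longrightarrow> 0 \<le> b i" "(\<Sum>i\<in>I. b i powr q) \<le> 1" "q > 0" "i \<in> I"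
  shows "b i \<le> 1"
proof -
  have "b i powr q \<le> (\<Sum>i\<in>I. b i powr q)"
    using assms by (intro member_le_sum) auto
  hence "b i powr q \<le> 1 powr q"
    using assms(3) by simp
  thus ?thesis
    using assms(4) assms(2)[OF assms(5)] by (meson not_le powr_less_mono2 zero_le_one)
qed

text \<open>Admissible weights are at most 1, so the Cauchy-Schwarz and Bessel inequalities leave
  the product of the two lengths.\<close>

lemma dual_bound_rank_one:
  assumes a: "a > 1"
  shows "dual_bound a (\<lambda>x. cscale (cinner x x0) y0) (norm x0 * norm y0)"
proof (rule dual_boundI)
  fix I :: "'a set" and u z :: "'a \<Rightarrow> 'a" and b
  assume *: "finite I" "orthonormal_on I u" "orthonormal_on I z" "\<And>i. i \<in> I \<Longrightarrow> 0 \<le> b i"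
    "(\<Sum>i\<in>I. b i powr (a / (a - 1))) \<le> 1"
  have b: "b i \<le> 1" if "i \<in> I" for i
    using weight_le_one[OF *(1,4,5) _ that] a by simp
  have "cmod (\<Sum>i\<in>I. complex_of_real (b i) * cinner (cscale (cinner (u i) x0) y0) (z i))
      \<le> (\<Sum>i\<in>I. 1 * (cmod (cinner (u i) x0) * cmod (cinner y0 (z i))))"
    using *(4) b
    by (intro order_trans[OF norm_sum] sum_mono)
       (auto simp: norm_mult cinner_simps intro!: mult_left_le_one_le)
  also have "\<dots> \<le> L2_set (\<lambda>i. cmod (cinner (u i) x0)) I * L2_set (\<lambda>i. cmod (cinner y0 (z i))) I"
    using L2_set_mult_ineq[of "\<lambda>i. cmod (cinner (u i) x0)" "\<lambda>i. cmod (cinner y0 (z i))" I] by simp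
  also have "\<dots> \<le> norm x0 * norm y0"
    unfolding L2_set_def using Bessel_left[OF *(1,2)] Bessel[OF *(1,3)]
    by (intro mult_mono real_le_lsqrt) (auto simp: sum_nonneg)
  finally show "cmod (\<Sum>i\<in>I. complex_of_real (b i) * cinner (cscale (cinner (u i) x0) y0) (z i))
      \<le> norm x0 * norm y0" .
qed

text \<open>A projection \<open>P\<close> is the mean of the two unitary operators \<open>1\<close> and \<open>2 P - 1\<close>.\<close>

lemma dual_bound_compress:
  assumes P: "orthogonal_projection P" and T: "bounded_clinear T" and K: "dual_bound a T K"
  shows "dual_bound a (\<lambda>x. P (T (P x))) K"
proof (rule dual_boundI)
  fix I :: "'a set" and u z :: "'a \<Rightarrow> 'a" and b
  assume *: "finite I" "orthonormal_on I u" "orthonormal_on I z" "\<And>i. i \<in> I \<Longrightarrow> 0 \<le> b i"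
    "(\<Sum>i\<in>I. b i powr (a / (a - 1))) \<le> 1"
  have lin: "bounded_clinear P" and idem: "P (P x) = P x"
    and sa: "cinner (P x) y = cinner x (P y)" for x y
    using P by (auto simp: orthogonal_projection_def fun_eq_iff)
  define U where "U x = (P x - x) + P x" for x
  have U: "cinner (U x) (U y) = cinner x y" for x y
  proof -
    have "cinner (P x) (P y) = cinner x (P y)"
      by (simp add: sa idem)
    thus ?thesis
      by (simp add: U_def cinner_simps sa)
  qed
  have on: "orthonormal_on I (\<lambda>i. U (v i))" if "orthonormal_on I v" for v
    using that by (simp add: orthonormal_on_def U)
  define \<Phi> where "\<Phi> u z = (\<Sum>i\<in>I. complex_of_real (b i) * cinner (T (u i)) (z i))" for u z
  have \<Phi>: "cmod (\<Phi> u z) \<le> K" if "orthonormal_on I u" "orthonormal_on I z" for u z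
    unfolding \<Phi>_def using dual_boundD[OF K *(1) that *(4,5)] .
  let ?Uu = "\<lambda>i. U (u i)" and ?Uz = "\<lambda>i. U (z i)"
  \<comment> \<open>With U = 2 P - 1 this is 4 P T P = (1 + U) T (1 + U), and each of the four terms
    pairs \<open>T\<close> with orthonormal systems.\<close>
  have "4 * cinner (P (T (P x))) y
      = cinner (T x) y + cinner (T (U x)) y + cinner (T x) (U y) + cinner (T (U x)) (U y)" for x y
    by (simp add: U_def bounded_clinearD[OF T] cinner_simps sa algebra_simps)
  hence "4 * (complex_of_real (b i) * cinner (P (T (P (u i)))) (z i))
      = complex_of_real (b i) * cinner (T (u i)) (z i) + complex_of_real (b i) * cinner (T (U (u i))) (z i)
        + complex_of_real (b i) * cinner (T (u i)) (U (z i))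
        + complex_of_real (b i) * cinner (T (U (u i))) (U (z i))" for i
    by (metis (no_types, lifting) distrib_left mult.left_commute)
  hence "4 * (\<Sum>i\<in>I. complex_of_real (b i) * cinner (P (T (P (u i)))) (z i))
      = \<Phi> u z + \<Phi> ?Uu z + \<Phi> u ?Uz + \<Phi> ?Uu ?Uz"
    by (simp add: \<Phi>_def sum_distrib_left sum.distrib)
  moreover have "cmod (\<Phi> u z + \<Phi> ?Uu z + \<Phi> u ?Uz + \<Phi> ?Uu ?Uz) \<le> K + K + K + K"
    by (intro norm_triangle_mono \<Phi> on *(2,3))
  ultimately have "cmod (4 * (\<Sum>i\<in>I. complex_of_real (b i) * cinner (P (T (P (u i)))) (z i)))
      \<le> K + K + K + K"
    by (simp only:)
  thus "cmod (\<Sum>i\<in>I. complex_of_real (b i) * cinner (P (T (P (u i)))) (z i)) \<le> K"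
    by (simp add: norm_mult)
qed

text \<open>The numbers \<open>\<bar>\<langle>u\<^sub>i, x\<^sub>n\<rangle> \<langle>y\<^sub>n, z\<^sub>i\<rangle>\<bar>\<close> form a doubly substochastic matrix, so Young's inequality can be
  summed against it.\<close>

lemma singular_sum_pairing_le:
  fixes x y :: "'n \<Rightarrow> 'h::chilbert_space" and u z :: "'i \<Rightarrow> 'h"
  assumes a: "a > 1" and N: "finite N" "orthonormal_on N x" "orthonormal_on N y"
    and I: "finite I" "orthonormal_on I u" "orthonormal_on I z"
    and s: "\<And>n. n \<in> N \<Longrightarrow> 0 \<le> s n" "(\<Sum>n\<in>N. s n powr a) \<le> S powr a" "0 \<le> S"
    and b: "\<And>i. i \<in> I \<Longrightarrow> 0 \<le> b i" "(\<Sum>i\<in>I. b i powr (a / (a - 1))) \<le> 1"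
  shows "cmod (\<Sum>i\<in>I. complex_of_real (b i) *
      (\<Sum>n\<in>N. complex_of_real (s n) * (cinner (u i) (x n) * cinner (y n) (z i)))) \<le> S"
proof -
  define q where "q = a / (a - 1)"
  have q: "q > 1" "1/a + 1/q = 1"
    using a by (auto simp: q_def field_simps)
  define A where "A i n = cmod (cinner (u i) (x n)) * cmod (cinner (y n) (z i))" for i n
  have A0: "0 \<le> A i n" for i n
    by (simp add: A_def)
  have unit: "norm (u i) = 1" "norm (z i) = 1" if "i \<in> I" for i
    using orthonormal_on_norm[OF I(2) that] orthonormal_on_norm[OF I(3) that] by simp_all
  have unit': "norm (x n) = 1" "norm (y n) = 1" if "n \<in> N" for n
    using orthonormal_on_norm[OF N(2) that] orthonormal_on_norm[OF N(3) that] by simp_all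
  have row: "(\<Sum>n\<in>N. A i n) \<le> 1" if "i \<in> I" for i
  proof -
    have "(\<Sum>n\<in>N. A i n)
        \<le> (\<Sum>n\<in>N. ((cmod (cinner (u i) (x n)))\<^sup>2 + (cmod (cinner (y n) (z i)))\<^sup>2) / 2)"
      unfolding A_def by (intro sum_mono product_le_half_squares)
    also have "\<dots> \<le> (1 + 1) / 2"
      unfolding sum_divide_distrib[symmetric] sum.distrib
      using Bessel[OF N(1,2), of "u i"] Bessel_left[OF N(1,3), of "z i"] unit[OF that]
      by (intro divide_right_mono add_mono) auto
    finally show ?thesis
      by simp
  qed
  have col: "(\<Sum>i\<in>I. A i n) \<le> 1" if "n \<in> N" for n
  proof -
    have "(\<Sum>i\<in>I. A i n)
        \<le> (\<Sum>i\<in>I. ((cmod (cinner (u i) (x n)))\<^sup>2 + (cmod (cinner (y n) (z i)))\<^sup>2) / 2)"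
      unfolding A_def by (intro sum_mono product_le_half_squares)
    also have "\<dots> \<le> (1 + 1) / 2"
      unfolding sum_divide_distrib[symmetric] sum.distrib
      using Bessel_left[OF I(1,2), of "x n"] Bessel[OF I(1,3), of "y n"] unit'[OF that]
      by (intro divide_right_mono add_mono) auto
    finally show ?thesis
      by simp
  qed
  have "cmod (\<Sum>i\<in>I. complex_of_real (b i) *
      (\<Sum>n\<in>N. complex_of_real (s n) * (cinner (u i) (x n) * cinner (y n) (z i))))
      \<le> (\<Sum>i\<in>I. b i * (\<Sum>n\<in>N. s n * A i n))"
    unfolding A_def
    by (intro order_trans[OF norm_sum] sum_mono)
       (auto simp: norm_mult b s intro!: mult_left_mono order_trans[OF norm_sum] sum_mono)
  also have "\<dots> = (\<Sum>i\<in>I. \<Sum>n\<in>N. b i * s n * A i n)"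
    by (simp add: sum_distrib_left mult_ac)
  also have "\<dots> \<le> S"
  proof (cases "S = 0")
    case True
    hence "(\<Sum>n\<in>N. s n powr a) = 0"
      using s(2) by (intro antisym sum_nonneg) auto
    hence "\<forall>n\<in>N. s n = 0"
      using N(1) by (subst (asm) sum_nonneg_eq_0_iff) auto
    thus ?thesis
      using True by simp
  next
    case False
    hence S: "S > 0"
      using s(3) by simp
    have "b i * s n * A i n \<le> S * (b i powr q / q * A i n + (s n powr a / S powr a) / a * A i n)"
      if "i \<in> I" "n \<in> N" for i n
    proof -
      \<comment> \<open>Dividing by \<open>S\<close> makes both total weights at most 1; after
        summation over rows and columns the Young terms contribute \<open>1 / a\<close> and
        \<open>1 / q\<close>.\<close>
      have "(s n / S) * b i \<le> (s n / S) powr a / a + b i powr q / q"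
        using s(1)[OF that(2)] b(1)[OF that(1)] S by (intro Youngs_inequality[OF a q]) auto
      hence "(s n / S) * b i * (S * A i n) \<le> ((s n / S) powr a / a + b i powr q / q) * (S * A i n)"
        using S A0 by (intro mult_right_mono) auto
      thus ?thesis
        using S s(1)[OF that(2)] by (simp add: powr_divide algebra_simps)
    qed
    hence "(\<Sum>i\<in>I. \<Sum>n\<in>N. b i * s n * A i n)
        \<le> (\<Sum>i\<in>I. \<Sum>n\<in>N. S * (b i powr q / q * A i n + (s n powr a / S powr a) / a * A i n))"
      by (intro sum_mono) auto
    also have "\<dots> = S * ((\<Sum>i\<in>I. \<Sum>n\<in>N. b i powr q / q * A i n)
        + (\<Sum>i\<in>I. \<Sum>n\<in>N. (s n powr a / S powr a) / a * A i n))"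
      by (simp only: sum_distrib_left[symmetric] sum.distrib)
    also have "(\<Sum>i\<in>I. \<Sum>n\<in>N. b i powr q / q * A i n) \<le> (\<Sum>i\<in>I. b i powr q / q * 1)"
      unfolding sum_distrib_left[symmetric] using row q by (intro sum_mono mult_left_mono) auto
    also have "\<dots> \<le> 1 / q"
      using b(2) q unfolding q_def[symmetric] by (simp add: divide_right_mono flip: sum_divide_distrib)
    also have "(\<Sum>i\<in>I. \<Sum>n\<in>N. (s n powr a / S powr a) / a * A i n)
        = (\<Sum>n\<in>N. (s n powr a / S powr a) / a * (\<Sum>i\<in>I. A i n))"
      by (subst sum.swap) (simp add: sum_distrib_left)
    also have "\<dots> \<le> (\<Sum>n\<in>N. (s n powr a / S powr a) / a * 1)"
      using col a by (intro sum_mono mult_left_mono) auto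
    also have "\<dots> \<le> 1 / a"
    proof -
      have "(\<Sum>n\<in>N. s n powr a) / S powr a / a \<le> 1 / a"
        using s(2) S a by (intro divide_right_mono) simp_all
      thus ?thesis
        by (simp add: sum_divide_distrib)
    qed
    finally have "(\<Sum>i\<in>I. \<Sum>n\<in>N. b i * s n * A i n) \<le> S * (1 / q + 1 / a)"
      using S by simp
    thus ?thesis
      using q(2) by (simp add: add.commute)
  qed
  finally show ?thesis .
qed

section \<open>Comparison of dual bounds with sums over singular values\<close>

lemma sum_card_fibres:
  fixes h :: "'b \<Rightarrow> real"
  assumes "finite B" "finite S"
  shows "(\<Sum>s\<in>S. real (card {x \<in> B. g x = s}) * h s) = (\<Sum>x\<in>{x \<in> B. g x \<in> S}. h (g x))"
proof -
  have "(\<Sum>x\<in>{x \<in> B. g x \<in> S}. h (g x)) = (\<Sum>s\<in>S. \<Sum>x | x \<in> {x \<in> B. g x \<in> S} \<and> g x = s. h (g x))"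
    using assms by (intro sum.group[symmetric]) auto
  also have "\<dots> = (\<Sum>s\<in>S. real (card {x \<in> B. g x = s}) * h s)"
  proof (rule sum.cong)
    fix s assume "s \<in> S"
    hence "{x. x \<in> {x \<in> B. g x \<in> S} \<and> g x = s} = {x \<in> B. g x = s}"
      by auto
    thus "(\<Sum>x | x \<in> {x \<in> B. g x \<in> S} \<and> g x = s. h (g x)) = real (card {x \<in> B. g x = s}) * h s"
      by simp
  qed simp
  finally show ?thesis ..
qed

text \<open>The \<open>a\<close>-th power of the norm is additive over singular vectors, so tails
  are differences of such sums, with the root taken only afterwards.\<close>

definition schatten_sum :: "real \<Rightarrow> ('h::chilbert_space \<Rightarrow> 'h) \<Rightarrow> real" where
  "schatten_sum a T = (\<Sum>\<^sub>\<infinity>s\<in>{0<..}. real (singular_value_mult T s) * s powr a)"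

lemma schatten_norm_eq: "schatten_norm a T = schatten_sum a T powr (1 / a)"
  by (simp add: schatten_norm_def schatten_sum_def)

lemma schatten_class_compact: "T \<in> schatten_class a \<Longrightarrow> compact_operator T"
  by (simp add: schatten_class_def)

lemma schatten_class_bounded_clinear: "T \<in> schatten_class a \<Longrightarrow> bounded_clinear T"
  using schatten_class_compact compact_operator_bounded_clinear by blast

text \<open>A maximal family above \<epsilon> containing \<open>B\<close> counts each of its
  singular values with full multiplicity, so its sum is a finite part of the series.\<close>

lemma singular_family_sum_le:
  assumes T: "T \<in> schatten_class a" and \<epsilon>: "\<epsilon> > 0" and B: "singular_family T \<epsilon> B"
  shows "(\<Sum>x\<in>B. norm (T x) powr a) \<le> schatten_sum a T"
proof -
  have cpt: "compact_operator T"
    using T by (rule schatten_class_compact)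
  obtain B' where B': "B \<subseteq> B'" "finite B'" "singular_family T \<epsilon> B'"
    "\<And>y. (\<And>b. b \<in> B' \<Longrightarrow> cinner y b = 0) \<Longrightarrow> norm (T y) \<le> \<epsilon> * norm y"
    using singular_family_extend[OF cpt \<epsilon> B] by metis
  define S where "S = (\<lambda>x. norm (T x)) ` B'"
  have S: "finite S" "S \<subseteq> {\<epsilon><..}"
    using B'(2) singular_familyD(2)[OF B'(3)] by (auto simp: S_def)
  have "(\<Sum>x\<in>B. norm (T x) powr a) \<le> (\<Sum>x\<in>B'. norm (T x) powr a)"
    using B' by (intro sum_mono2) auto
  also have "\<dots> = (\<Sum>x\<in>{x \<in> B'. norm (T x) \<in> S}. norm (T x) powr a)"
    by (rule sum.cong) (auto simp: S_def)
  also have "\<dots> = (\<Sum>s\<in>S. real (card {x \<in> B'. norm (T x) = s}) * s powr a)"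
    using sum_card_fibres[OF B'(2) S(1), of "\<lambda>x. norm (T x)" "\<lambda>s. s powr a"] by simp
  also have "\<dots> = (\<Sum>s\<in>S. real (singular_value_mult T s) * s powr a)"
    using S(2) singular_value_mult_eq_card[OF cpt \<epsilon> _ B'(2,3,4)] by (intro sum.cong) auto
  also have "\<dots> \<le> schatten_sum a T"
    unfolding schatten_sum_def using T S \<epsilon>
    by (intro finite_sum_le_infsum) (auto simp: schatten_class_def)
  finally show ?thesis .
qed

text \<open>Splitting off a finite set \<open>B\<close> of singular vectors; the case \<open>B = {}\<close> approximates \<open>T\<close> itself.\<close>

lemma approximate_singular_value_decomposition:
  assumes T: "T \<in> schatten_class a" and B: "singular_family T \<epsilon> B"
    and \<delta>: "0 < \<delta>" "\<delta> \<le> \<epsilon>"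
  obtains N w where "finite N" "orthonormal_on N (\<lambda>b. b)" "orthonormal_on N w"
    "(\<Sum>b\<in>N. norm (T b) powr a) \<le> schatten_sum a T - (\<Sum>b\<in>B. norm (T b) powr a)"
    "\<forall>v. norm (T (v - (\<Sum>b\<in>B. cscale (cinner v b) b))
       - (\<Sum>b\<in>N. cscale (complex_of_real (norm (T b)) * cinner v b) (w b))) \<le> \<delta> * norm v"
proof -
  have cpt: "compact_operator T" and lin: "bounded_clinear T"
    using T schatten_class_compact schatten_class_bounded_clinear by auto
  have "singular_family T \<delta> B"
    using B \<delta> by (auto simp: singular_family_def)
  then obtain B' where B': "B \<subseteq> B'" "finite B'" "singular_family T \<delta> B'"
    "\<And>y. (\<And>b. b \<in> B' \<Longrightarrow> cinner y b = 0) \<Longrightarrow> norm (T y) \<le> \<delta> * norm y"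
    using singular_family_extend[OF cpt \<delta>(1)] by metis
  note on = singular_familyD(1)[OF B'(3)]
  define N where "N = B' - B"
  \<comment> \<open>The residual is orthogonal to the maximal family \<open>B'\<close>, so
    \<open>T\<close> shrinks it to at most \<delta> times its length; the new vectors in
    \<open>N\<close> carry the rest.\<close>
  define r where "r v = v - (\<Sum>b\<in>B'. cscale (cinner v b) b)" for v
  define w where "w b = cscale (complex_of_real (1 / norm (T b))) (T b)" for b
  have N: "finite N" "N \<subseteq> B'"
    using B' by (auto simp: N_def)
  have Tpos: "norm (T b) > 0" if "b \<in> B'" for b
    using singular_familyD(2)[OF B'(3) that] \<delta>(1) by linarith
  have Tb: "T b = cscale (complex_of_real (norm (T b))) (w b)" if "b \<in> B'" for b
    using Tpos[OF that] by (simp add: w_def cscale_cscale flip: of_real_mult)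
  have on_w: "orthonormal_on N w"
    unfolding orthonormal_on_def
  proof (intro ballI)
    fix b c assume bc: "b \<in> N" "c \<in> N"
    hence bc': "b \<in> B'" "c \<in> B'"
      using N(2) by auto
    have "cinner (w b) (w c) = complex_of_real (1 / norm (T b)) * complex_of_real (1 / norm (T c))
        * (complex_of_real ((norm (T b))\<^sup>2) * cinner b c)"
      using singular_familyD(3)[OF B'(3) bc'(1), of c] by (simp add: w_def cinner_simps)
    thus "cinner (w b) (w c) = (if b = c then 1 else 0)"
      using orthonormal_onD[OF on bc'] Tpos[OF bc'(1)] Tpos[OF bc'(2)] by (simp add: power2_eq_square)
  qed
  have on_N: "orthonormal_on N (\<lambda>b. b)"
    using orthonormal_on_subset[OF on N(2)] by (simp add: orthonormal_on_def)
  have "T (v - (\<Sum>b\<in>B. cscale (cinner v b) b))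
      = (\<Sum>b\<in>N. cscale (complex_of_real (norm (T b)) * cinner v b) (w b)) + T (r v)" for v
  proof -
    have "v - (\<Sum>b\<in>B. cscale (cinner v b) b) = (\<Sum>b\<in>N. cscale (cinner v b) b) + r v"
      unfolding r_def N_def using sum.subset_diff[OF B'(1,2), of "\<lambda>b. cscale (cinner v b) b"]
      by simp
    moreover have "T (\<Sum>b\<in>N. cscale (cinner v b) b)
        = (\<Sum>b\<in>N. cscale (complex_of_real (norm (T b)) * cinner v b) (w b))"
      unfolding bounded_clinearD[OF lin]
    proof (rule sum.cong)
      fix b assume "b \<in> N"
      hence "T b = cscale (complex_of_real (norm (T b))) (w b)"
        using Tb N(2) by blast
      hence "cscale (cinner v b) (T b) = cscale (cinner v b) (cscale (complex_of_real (norm (T b))) (w b))"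
        by (rule arg_cong)
      thus "cscale (cinner v b) (T b) = cscale (complex_of_real (norm (T b)) * cinner v b) (w b)"
        by (simp add: cscale_cscale mult.commute)
    qed simp
    ultimately show ?thesis
      by (simp add: bounded_clinearD(1)[OF lin])
  qed
  moreover have "norm (T (r v)) \<le> \<delta> * norm v" for v
  proof -
    have "norm (T (r v)) \<le> \<delta> * norm (r v)"
      unfolding r_def using orthonormal_on_residual[OF B'(2) on] by (intro B'(4)) auto
    moreover have "(norm (r v))\<^sup>2 \<le> (norm v)\<^sup>2"
      unfolding r_def using orthonormal_on_decompose[OF B'(2) on, of v] by (simp add: sum_nonneg)
    hence "norm (r v) \<le> norm v"
      by (rule power2_le_imp_le) simp
    ultimately show ?thesis
      using \<delta>(1) by (meson less_imp_le mult_left_mono order_trans)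
  qed
  moreover have "(\<Sum>b\<in>N. norm (T b) powr a) \<le> schatten_sum a T - (\<Sum>b\<in>B. norm (T b) powr a)"
    using singular_family_sum_le[OF T \<delta>(1) B'(3)]
      sum.subset_diff[OF B'(1,2), of "\<lambda>b. norm (T b) powr a"]
    by (simp add: N_def)
  ultimately show ?thesis
    using that[OF N(1) on_N on_w] by simp
qed

text \<open>After removal of \<open>B\<close> the \<open>a\<close>-th powers of the remaining
  singular values sum to at most the difference. The approximate decomposition costs \<delta> times
  the fixed finite sum of the weights, and \<delta> tends to 0.\<close>

lemma dual_bound_tail:
  assumes a: "a > 1" and T: "T \<in> schatten_class a" and \<epsilon>: "\<epsilon> > 0"
    and B: "finite B" "singular_family T \<epsilon> B"
  shows "dual_bound a (\<lambda>x. T (x - (\<Sum>b\<in>B. cscale (cinner x b) b)))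
    ((schatten_sum a T - (\<Sum>b\<in>B. norm (T b) powr a)) powr (1 / a))"
proof (rule dual_boundI)
  fix I :: "'a set" and u z :: "'a \<Rightarrow> 'a" and \<beta>
  assume *: "finite I" "orthonormal_on I u" "orthonormal_on I z" "\<And>i. i \<in> I \<Longrightarrow> 0 \<le> \<beta> i"
    "(\<Sum>i\<in>I. \<beta> i powr (a / (a - 1))) \<le> 1"
  define W where "W = schatten_sum a T - (\<Sum>b\<in>B. norm (T b) powr a)"
  define D where "D = (\<lambda>x. T (x - (\<Sum>b\<in>B. cscale (cinner x b) b)))"
  have W: "W \<ge> 0"
    using singular_family_sum_le[OF T \<epsilon> B(2)] by (simp add: W_def)
  have "cmod (\<Sum>i\<in>I. complex_of_real (\<beta> i) * cinner (D (u i)) (z i))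
      \<le> W powr (1 / a) + \<delta> * (\<Sum>i\<in>I. \<beta> i)" if \<delta>: "0 < \<delta>" "\<delta> < \<epsilon>" for \<delta>
  proof -
    obtain N w where N: "finite N" "orthonormal_on N (\<lambda>b. b)" "orthonormal_on N w"
      "(\<Sum>b\<in>N. norm (T b) powr a) \<le> W"
      "\<forall>v. norm (D v - (\<Sum>b\<in>N. cscale (complex_of_real (norm (T b)) * cinner v b) (w b))) \<le> \<delta> * norm v"
      unfolding D_def
      by (rule approximate_singular_value_decomposition
          [OF T B(2) \<delta>(1) less_imp_le[OF \<delta>(2)], folded W_def])
    define R where "R v = D v - (\<Sum>b\<in>N. cscale (complex_of_real (norm (T b)) * cinner v b) (w b))" for v
    have D: "D v = (\<Sum>b\<in>N. cscale (complex_of_real (norm (T b)) * cinner v b) (w b)) + R v" for v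
      by (simp add: R_def)
    have eq: "(\<Sum>i\<in>I. complex_of_real (\<beta> i) * cinner (D (u i)) (z i))
        = (\<Sum>i\<in>I. complex_of_real (\<beta> i) *
            (\<Sum>b\<in>N. complex_of_real (norm (T b)) * (cinner (u i) b * cinner (w b) (z i))))
          + (\<Sum>i\<in>I. complex_of_real (\<beta> i) * cinner (R (u i)) (z i))"
      by (simp add: D cinner_simps distrib_left sum.distrib mult_ac)
    have "cmod (\<Sum>i\<in>I. complex_of_real (\<beta> i) *
            (\<Sum>b\<in>N. complex_of_real (norm (T b)) * (cinner (u i) b * cinner (w b) (z i))))
        \<le> W powr (1 / a)"
      using a W N(4) by (intro singular_sum_pairing_le[OF a N(1-3) *(1-3) _ _ _ *(4,5)])
                   (auto simp: powr_powr)
    moreover have "cmod (\<Sum>i\<in>I. complex_of_real (\<beta> i) * cinner (R (u i)) (z i))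
        \<le> (\<Sum>i\<in>I. \<beta> i * \<delta>)"
    proof (intro order_trans[OF norm_sum] sum_mono)
      fix i assume i: "i \<in> I"
      have "cmod (cinner (R (u i)) (z i)) \<le> norm (R (u i)) * norm (z i)"
        by (rule cmod_cinner_le)
      also have "\<dots> \<le> \<delta>"
        using N(5)[rule_format, of "u i"] orthonormal_on_norm[OF *(2) i] orthonormal_on_norm[OF *(3) i]
        by (simp add: R_def)
      finally show "cmod (complex_of_real (\<beta> i) * cinner (R (u i)) (z i)) \<le> \<beta> i * \<delta>"
        using *(4)[OF i] by (simp add: norm_mult mult_left_mono)
    qed
    ultimately show ?thesis
      unfolding eq by (intro order_trans[OF norm_triangle_ineq] add_mono)
        (auto simp: sum_distrib_left mult.commute)
  qed
  hence "eventually (\<lambda>\<delta>. cmod (\<Sum>i\<in>I. complex_of_real (\<beta> i) * cinner (D (u i)) (z i))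
      \<le> W powr (1 / a) + \<delta> * (\<Sum>i\<in>I. \<beta> i)) (at_right 0)"
    using eventually_at_right_real[OF \<epsilon>] by (auto elim!: eventually_mono)
  moreover have "((\<lambda>\<delta>. W powr (1 / a) + \<delta> * (\<Sum>i\<in>I. \<beta> i)) \<longlongrightarrow> W powr (1 / a) + 0 * (\<Sum>i\<in>I. \<beta> i))
      (at_right 0)"
    by (intro tendsto_intros)
  ultimately have "cmod (\<Sum>i\<in>I. complex_of_real (\<beta> i) * cinner (D (u i)) (z i))
      \<le> W powr (1 / a) + 0 * (\<Sum>i\<in>I. \<beta> i)"
    by (intro tendsto_lowerbound) auto
  thus "cmod (\<Sum>i\<in>I. complex_of_real (\<beta> i) * cinner (T (u i - (\<Sum>b\<in>B. cscale (cinner (u i) b) b))) (z i))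
      \<le> (schatten_sum a T - (\<Sum>b\<in>B. norm (T b) powr a)) powr (1 / a)"
    by (simp add: D_def W_def)
qed

text \<open>The Hoelder half of trace duality: the tail estimate with nothing removed.\<close>

lemma schatten_class_imp_dual_bound:
  assumes "a > 1" "T \<in> schatten_class a"
  shows "dual_bound a T (schatten_norm a T)"
  using dual_bound_tail[OF assms zero_less_one, of "{}"]
  by (simp add: singular_family_def orthonormal_on_def schatten_norm_eq)

text \<open>A threshold below the smallest element of \<open>S\<close> lets one maximal family
  realise all multiplicities that occur. This trades a part of the series for vectors that can be
  tested.\<close>

lemma finite_singular_sum_eq:
  assumes T: "compact_operator T" and S: "finite S" "S \<subseteq> {0<..}"
  obtains \<epsilon> B where "\<epsilon> > 0" "finite B" "singular_family T \<epsilon> B"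
    "(\<Sum>s\<in>S. real (singular_value_mult T s) * s powr a)
      = (\<Sum>x\<in>{x \<in> B. norm (T x) \<in> S}. norm (T x) powr a)"
proof -
  obtain \<epsilon> where \<epsilon>: "\<epsilon> > 0" "\<And>s. s \<in> S \<Longrightarrow> \<epsilon> < s"
  proof (cases "S = {}")
    case False
    hence "0 < Min S"
      using S by auto
    thus ?thesis
      using that[of "Min S / 2"] Min_le[OF S(1)] by (metis half_gt_zero field_sum_of_halves
          less_add_same_cancel1 order_less_le_trans)
  qed (use that[of 1] in auto)
  have "singular_family T \<epsilon> {}"
    by (simp add: singular_family_def orthonormal_on_def)
  then obtain B where B: "finite B" "singular_family T \<epsilon> B"
    "\<And>y. (\<And>b. b \<in> B \<Longrightarrow> cinner y b = 0) \<Longrightarrow> norm (T y) \<le> \<epsilon> * norm y"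
    using singular_family_extend[OF T \<epsilon>(1)] by metis
  have "(\<Sum>s\<in>S. real (singular_value_mult T s) * s powr a)
      = (\<Sum>s\<in>S. real (card {x \<in> B. norm (T x) = s}) * s powr a)"
    using \<epsilon> singular_value_mult_eq_card[OF T \<epsilon>(1) _ B] by (intro sum.cong) auto
  also have "\<dots> = (\<Sum>x\<in>{x \<in> B. norm (T x) \<in> S}. norm (T x) powr a)"
    by (rule sum_card_fibres[OF B(1) S(1)])
  finally show ?thesis
    by (rule that[OF \<epsilon>(1) B(1,2)])
qed

text \<open>The extremal case of Hoelder's inequality: test with weights proportional to
  \<open>norm (T x) powr (a - 1)\<close> along the normalised images. Division by
  \<open>Q powr (1 / q)\<close> makes the weights admissible, and the pairing equals
  \<open>Q powr (1 / a)\<close>.\<close>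

lemma singular_sum_le_dual_bound:
  assumes a: "a > 1" and K: "dual_bound a T K"
    and C: "finite C" "singular_family T \<epsilon> C" "\<epsilon> > 0"
  shows "(\<Sum>x\<in>C. norm (T x) powr a) \<le> K powr a"
proof -
  define Q where "Q = (\<Sum>x\<in>C. norm (T x) powr a)"
  define q where "q = a / (a - 1)"
  have q: "q > 1" "(a - 1) * q = a" "1 - 1/q = 1/a"
    using a by (auto simp: q_def field_simps)
  have K0: "0 \<le> K"
    using K by (rule dual_bound_nonneg)
  have "Q \<ge> 0"
    by (simp add: Q_def sum_nonneg)
  show ?thesis
  proof (cases "Q = 0")
    case False
    hence Q: "Q > 0"
      using \<open>Q \<ge> 0\<close> by simp
    have pos: "norm (T x) > 0" if "x \<in> C" for x
      using singular_familyD(2)[OF C(2) that] C(3) by linarith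
    define z where "z x = cscale (complex_of_real (1 / norm (T x))) (T x)" for x
    define b where "b x = norm (T x) powr (a - 1) / Q powr (1 / q)" for x
    have on: "orthonormal_on C (\<lambda>x. x)"
      using singular_familyD(1)[OF C(2)] by (simp add: orthonormal_on_def)
    have on_z: "orthonormal_on C z"
      unfolding orthonormal_on_def
    proof (intro ballI)
      fix x y assume xy: "x \<in> C" "y \<in> C"
      have "cinner (z x) (z y) = complex_of_real (1 / norm (T x)) * complex_of_real (1 / norm (T y))
          * (complex_of_real ((norm (T x))\<^sup>2) * cinner x y)"
        using singular_familyD(3)[OF C(2) xy(1), of y] by (simp add: z_def cinner_simps)
      thus "cinner (z x) (z y) = (if x = y then 1 else 0)"
        using orthonormal_onD[OF on xy] pos[OF xy(1)] pos[OF xy(2)] by (simp add: power2_eq_square)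
    qed
    have "(\<Sum>x\<in>C. b x powr q) = (\<Sum>x\<in>C. norm (T x) powr a / Q)"
      using Q q by (intro sum.cong) (auto simp: b_def powr_divide powr_powr)
    also have "\<dots> = 1"
      using Q by (simp add: Q_def flip: sum_divide_distrib)
    finally have b1: "(\<Sum>x\<in>C. b x powr (a / (a - 1))) \<le> 1"
      by (simp add: q_def)
    have "(\<Sum>x\<in>C. complex_of_real (b x) * cinner (T x) (z x))
        = (\<Sum>x\<in>C. complex_of_real (norm (T x) powr a / Q powr (1 / q)))"
    proof (rule sum.cong)
      fix x assume x: "x \<in> C"
      have "cinner (T x) (z x) = complex_of_real (norm (T x))"
        using pos[OF x] by (simp add: z_def cinner_simps cinner_self power2_eq_square)
      moreover have "norm (T x) powr (a - 1) * norm (T x) = norm (T x) powr a"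
        using pos[OF x] powr_add[of "norm (T x)" "a - 1" 1] by simp
      ultimately show "complex_of_real (b x) * cinner (T x) (z x)
          = complex_of_real (norm (T x) powr a / Q powr (1 / q))"
        by (simp add: b_def flip: of_real_mult)
    qed simp
    also have "\<dots> = complex_of_real (Q / Q powr (1 / q))"
      unfolding Q_def of_real_sum[symmetric] sum_divide_distrib[symmetric] ..
    finally have "cmod (complex_of_real (Q / Q powr (1 / q))) \<le> K"
      using dual_boundD[OF K C(1) on on_z _ b1] by (simp add: b_def)
    hence "Q / Q powr (1 / q) \<le> K"
      unfolding norm_of_real by linarith
    moreover have "Q / Q powr (1 / q) = Q powr (1 / a)"
      using Q powr_diff[of Q 1 "1/q"] unfolding q(3) by simp
    ultimately have "(Q powr (1 / a)) powr a \<le> K powr a"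
      using a by (intro powr_mono2) auto
    thus ?thesis
      using Q a unfolding Q_def[symmetric] by (simp add: powr_powr)
  qed (simp add: Q_def)
qed

text \<open>With \<open>schatten_class_imp_dual_bound\<close> this identifies the norm as the least
  dual bound, so estimates of pairings transfer to singular values.\<close>

lemma dual_bound_imp_schatten_class:
  assumes a: "a > 1" and T: "compact_operator T" and K: "dual_bound a T K"
  shows "T \<in> schatten_class a" "schatten_norm a T \<le> K"
proof -
  define g where "g s = real (singular_value_mult T s) * s powr a" for s
  have fin: "sum g S \<le> K powr a" if S: "finite S" "S \<subseteq> {0<..}" for S
  proof -
    obtain \<epsilon> B where B: "\<epsilon> > 0" "finite B" "singular_family T \<epsilon> B"
      "sum g S = (\<Sum>x\<in>{x \<in> B. norm (T x) \<in> S}. norm (T x) powr a)"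
      by (rule finite_singular_sum_eq[OF T S, of a, folded g_def])
    have "singular_family T \<epsilon> {x \<in> B. norm (T x) \<in> S}"
      using B(3) orthonormal_on_subset[of B id "{x \<in> B. norm (T x) \<in> S}"]
      by (auto simp: singular_family_def)
    thus ?thesis
      unfolding B(4) using B(1,2) by (intro singular_sum_le_dual_bound[OF a K]) auto
  qed
  have sm: "g summable_on {0<..}"
    using fin by (intro nonneg_bdd_above_summable_on) (auto simp: g_def bdd_above_def)
  thus "T \<in> schatten_class a"
    using T by (simp add: schatten_class_def g_def[abs_def])
  have "schatten_sum a T \<le> K powr a"
    unfolding schatten_sum_def g_def[symmetric] using sm fin by (rule infsum_le_finite_sums)
  hence "schatten_sum a T powr (1 / a) \<le> (K powr a) powr (1 / a)"
    using a by (intro powr_mono2) (auto simp: schatten_sum_def infsum_nonneg)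
  thus "schatten_norm a T \<le> K"
    using a dual_bound_nonneg[OF K] by (simp add: schatten_norm_eq powr_powr)
qed

text \<open>A finite part of the series is chosen that misses at most \<open>\<eta> powr a\<close>,
  the amount whose \<open>a\<close>-th root is \<eta>; the singular vectors behind it form
  \<open>B\<close>.\<close>

lemma finite_rank_approximation:
  assumes a: "a > 1" and T: "T \<in> schatten_class a" and \<eta>: "\<eta> > 0"
  obtains B where "finite B" "dual_bound a (\<lambda>x. T x - (\<Sum>b\<in>B. cscale (cinner x b) (T b))) \<eta>"
proof -
  define g where "g s = real (singular_value_mult T s) * s powr a" for s
  have sm: "g summable_on {0<..}" and cpt: "compact_operator T" and lin: "bounded_clinear T"
    using T schatten_class_bounded_clinear[OF T] by (simp_all add: schatten_class_def g_def[abs_def])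
  obtain S where S: "finite S" "S \<subseteq> {0<..}" "dist (sum g S) (schatten_sum a T) \<le> \<eta> powr a"
    using infsum_finite_approximation[OF sm, of "\<eta> powr a"] \<eta>
    unfolding schatten_sum_def g_def[symmetric] by auto
  obtain \<epsilon> B where B: "\<epsilon> > 0" "finite B" "singular_family T \<epsilon> B"
    "sum g S = (\<Sum>x\<in>{x \<in> B. norm (T x) \<in> S}. norm (T x) powr a)"
    by (rule finite_singular_sum_eq[OF cpt S(1,2), of a, folded g_def])
  have "sum g S \<le> (\<Sum>x\<in>B. norm (T x) powr a)"
    unfolding B(4) using B(2) by (intro sum_mono2) auto
  hence "schatten_sum a T - (\<Sum>b\<in>B. norm (T b) powr a) \<le> \<eta> powr a"
    using S(3) by (auto simp: dist_real_def)
  moreover have "0 \<le> schatten_sum a T - (\<Sum>b\<in>B. norm (T b) powr a)"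
    using singular_family_sum_le[OF T B(1,3)] by simp
  ultimately have "(schatten_sum a T - (\<Sum>b\<in>B. norm (T b) powr a)) powr (1 / a)
      \<le> (\<eta> powr a) powr (1 / a)"
    using a by (intro powr_mono2) auto
  also have "\<dots> = \<eta>"
    using a \<eta> by (simp add: powr_powr)
  finally have "dual_bound a (\<lambda>x. T (x - (\<Sum>b\<in>B. cscale (cinner x b) b))) \<eta>"
    using dual_bound_tail[OF a T B(1-3)] dual_bound_mono by blast
  thus ?thesis
    using that[OF B(2)] by (simp add: bounded_clinearD[OF lin])
qed

lemma schatten_class_iff:
  assumes "a > 1"
  shows "T \<in> schatten_class a \<longleftrightarrow> compact_operator T \<and> (\<exists>K. dual_bound a T K)"
  using assms dual_bound_imp_schatten_class(1) schatten_class_imp_dual_bound schatten_class_compact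
  by blast

lemma schatten_class_zero:
  assumes "a > 1"
  shows "(\<lambda>_. 0) \<in> schatten_class a"
  using assms schatten_class_iff compact_operator_zero dual_bound_zero by blast

text \<open>Dual bounds add because pairings are linear; this is the source of the triangle
  inequality.\<close>

lemma schatten_class_add:
  assumes "a > 1" "S \<in> schatten_class a" "T \<in> schatten_class a"
  shows "(\<lambda>x. S x + T x) \<in> schatten_class a"
    "schatten_norm a (\<lambda>x. S x + T x) \<le> schatten_norm a S + schatten_norm a T"
proof -
  have "compact_operator (\<lambda>x. S x + T x)"
    using assms by (intro compact_operator_add schatten_class_compact)
  moreover have "dual_bound a (\<lambda>x. S x + T x) (schatten_norm a S + schatten_norm a T)"
    using assms by (intro dual_bound_add schatten_class_imp_dual_bound)
  ultimately show "(\<lambda>x. S x + T x) \<in> schatten_class a"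
    "schatten_norm a (\<lambda>x. S x + T x) \<le> schatten_norm a S + schatten_norm a T"
    using dual_bound_imp_schatten_class[OF assms(1)] by auto
qed

lemma schatten_class_cscale:
  assumes "a > 1" "T \<in> schatten_class a"
  shows "(\<lambda>x. cscale c (T x)) \<in> schatten_class a"
    "schatten_norm a (\<lambda>x. cscale c (T x)) \<le> cmod c * schatten_norm a T"
proof -
  have "compact_operator (\<lambda>x. cscale c (T x))"
    using assms by (intro compact_operator_cscale schatten_class_compact)
  moreover have "dual_bound a (\<lambda>x. cscale c (T x)) (cmod c * schatten_norm a T)"
    using assms by (intro dual_bound_cscale schatten_class_imp_dual_bound)
  ultimately show "(\<lambda>x. cscale c (T x)) \<in> schatten_class a"
    "schatten_norm a (\<lambda>x. cscale c (T x)) \<le> cmod c * schatten_norm a T"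
    using dual_bound_imp_schatten_class[OF assms(1)] by auto
qed

lemma schatten_class_diff:
  assumes "a > 1" "S \<in> schatten_class a" "T \<in> schatten_class a"
  shows "(\<lambda>x. S x - T x) \<in> schatten_class a"
  using schatten_class_add(1)[OF assms(1,2) schatten_class_cscale(1)[OF assms(1,3), of "-1"]]
  by (simp add: cscale_minus_one)

section \<open>A maximum principle on the strip\<close>

text \<open>The factor \<open>exp (\<epsilon> (w\<^sup>2 - 1))\<close> has modulus at most \<open>exp (- \<epsilon> (Im w)\<^sup>2)\<close> on the strip, which reduces the
  claim to a rectangle.\<close>

lemma strip_maximum_principle:
  assumes f: "f holomorphic_on UNIV"
    and K: "\<And>w. 0 \<le> Re w \<Longrightarrow> Re w \<le> 1 \<Longrightarrow> cmod (f w) \<le> K"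
    and left: "\<And>w. Re w = 0 \<Longrightarrow> cmod (f w) \<le> 1" and right: "\<And>w. Re w = 1 \<Longrightarrow> cmod (f w) \<le> 1"
    and w: "0 \<le> Re w" "Re w \<le> 1"
  shows "cmod (f w) \<le> 1"
proof -
  have K0: "K \<ge> 0"
    using K[OF w] norm_ge_zero[of "f w"] by linarith
  have main: "cmod (f w) * exp (\<epsilon> * (Re (w\<^sup>2) - 1)) \<le> 1" if \<epsilon>: "\<epsilon> > 0" for \<epsilon>
  proof -
    define g where "g v = f v * exp (complex_of_real \<epsilon> * (v\<^sup>2 - 1))" for v
    have norm_g: "cmod (g v) = cmod (f v) * exp (\<epsilon> * (Re (v\<^sup>2) - 1))" for v
      by (simp add: g_def norm_mult)
    have le: "cmod (g v) \<le> cmod (f v) * exp (- (\<epsilon> * (Im v)\<^sup>2))" if "0 \<le> Re v" "Re v \<le> 1" for v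
    proof -
      have "(Re v)\<^sup>2 \<le> 1"
        using that by (simp add: power_le_one)
      hence "Re (v\<^sup>2) - 1 \<le> - (Im v)\<^sup>2"
        by (simp add: Re_power2)
      hence "\<epsilon> * (Re (v\<^sup>2) - 1) \<le> \<epsilon> * (- (Im v)\<^sup>2)"
        using \<epsilon> by (intro mult_left_mono) auto
      thus ?thesis
        unfolding norm_g by (intro mult_left_mono) auto
    qed
    \<comment> \<open>The height ensures \<open>K \<le> \<epsilon> * R\<^sup>2 \<le> exp (\<epsilon>
      * R\<^sup>2)\<close>, so on the horizontal sides the damping factor absorbs the a priori
      bound.\<close>
    define R where "R = \<bar>Im w\<bar> + K / \<epsilon> + 1"
    have R: "R \<ge> 1" "\<bar>Im w\<bar> \<le> R" "K / \<epsilon> \<le> R"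
      using K0 \<epsilon> by (auto simp: R_def)
    have "R * 1 \<le> R * R"
      using R(1) by (intro mult_left_mono) auto
    hence "K / \<epsilon> \<le> R\<^sup>2"
      using R(3) by (simp add: power2_eq_square)
    hence "K \<le> \<epsilon> * R\<^sup>2"
      using \<epsilon> by (simp add: field_simps)
    moreover have "1 + \<epsilon> * R\<^sup>2 \<le> exp (\<epsilon> * R\<^sup>2)"
      by (rule exp_ge_add_one_self)
    ultimately have "K \<le> exp (\<epsilon> * R\<^sup>2)"
      by linarith
    hence KR: "K * exp (- (\<epsilon> * R\<^sup>2)) \<le> 1"
      by (simp add: exp_minus field_simps)
    define S where "S = cbox (Complex 0 (-R)) (Complex 1 R)"
    have "cmod (g w) \<le> 1"
    proof (rule maximum_modulus_frontier[of g S])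
      show "g holomorphic_on interior S"
        unfolding g_def by (intro holomorphic_intros holomorphic_on_subset[OF f]) auto
      have "g holomorphic_on UNIV"
        unfolding g_def by (intro holomorphic_intros f)
      thus "continuous_on (closure S) g"
        by (meson continuous_on_subset holomorphic_on_imp_continuous_on subset_UNIV)
      show "w \<in> S"
        using w R by (auto simp: S_def in_cbox_complex_iff)
    next
      fix v assume "v \<in> frontier S"
      hence v: "0 \<le> Re v" "Re v \<le> 1" "Re v = 0 \<or> Re v = 1 \<or> \<bar>Im v\<bar> = R"
        by (auto simp: S_def frontier_cbox in_cbox_complex_iff in_box_complex_iff)
      from v(3) show "cmod (g v) \<le> 1"
      proof (elim disjE)
        assume "\<bar>Im v\<bar> = R"
        hence "(Im v)\<^sup>2 = R\<^sup>2"
          by (metis power2_abs)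
        hence "cmod (g v) \<le> cmod (f v) * exp (- (\<epsilon> * R\<^sup>2))"
          using le[OF v(1,2)] by simp
        also have "\<dots> \<le> K * exp (- (\<epsilon> * R\<^sup>2))"
          using K[OF v(1,2)] by (intro mult_right_mono) auto
        finally show ?thesis
          using KR by simp
      next
        assume "Re v = 0"
        hence "cmod (f v) * exp (- (\<epsilon> * (Im v)\<^sup>2)) \<le> 1 * 1"
          using \<epsilon> by (intro mult_mono left) auto
        thus ?thesis
          using le[OF v(1,2)] by simp
      next
        assume "Re v = 1"
        hence "cmod (f v) * exp (- (\<epsilon> * (Im v)\<^sup>2)) \<le> 1 * 1"
          using \<epsilon> by (intro mult_mono right) auto
        thus ?thesis
          using le[OF v(1,2)] by simp
      qed
    qed (auto simp: S_def)
    thus ?thesis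
      by (simp add: norm_g)
  qed
  \<comment> \<open>The damping disappears as \<epsilon> tends to 0 at the fixed point
    \<open>w\<close>.\<close>
  have "((\<lambda>\<epsilon>. cmod (f w) * exp (\<epsilon> * (Re (w\<^sup>2) - 1))) \<longlongrightarrow> cmod (f w) * exp (0 * (Re (w\<^sup>2) - 1))) (at_right 0)"
    by (intro tendsto_intros)
  moreover have "eventually (\<lambda>\<epsilon>. cmod (f w) * exp (\<epsilon> * (Re (w\<^sup>2) - 1)) \<le> 1) (at_right 0)"
    using eventually_at_right_less[of 0] by eventually_elim (rule main)
  ultimately have "cmod (f w) * exp (0 * (Re (w\<^sup>2) - 1)) \<le> 1"
    by (rule tendsto_upperbound) simp
  thus ?thesis
    by simp
qed

text \<open>Finite sums and products preserve this class, so the a priori bound demanded by the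
  maximum principle need only be checked for powers with constant base.\<close>

definition strip_bounded :: "(complex \<Rightarrow> complex) \<Rightarrow> bool" where
  "strip_bounded f \<longleftrightarrow> f holomorphic_on UNIV \<and>
     (\<exists>K. \<forall>w. 0 \<le> Re w \<longrightarrow> Re w \<le> 1 \<longrightarrow> cmod (f w) \<le> K)"

lemma strip_boundedI:
  "f holomorphic_on UNIV \<Longrightarrow> (\<And>w. 0 \<le> Re w \<Longrightarrow> Re w \<le> 1 \<Longrightarrow> cmod (f w) \<le> K) \<Longrightarrow> strip_bounded f"
  unfolding strip_bounded_def by blast

lemma strip_bounded_const: "strip_bounded (\<lambda>_. c)"
  by (rule strip_boundedI[where K = "cmod c"]) auto

lemma strip_bounded_add:
  assumes "strip_bounded f" "strip_bounded g"
  shows "strip_bounded (\<lambda>w. f w + g w)"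
proof -
  obtain K where K: "f holomorphic_on UNIV" "\<And>w. 0 \<le> Re w \<Longrightarrow> Re w \<le> 1 \<Longrightarrow> cmod (f w) \<le> K"
    using assms(1) unfolding strip_bounded_def by blast
  obtain L where L: "g holomorphic_on UNIV" "\<And>w. 0 \<le> Re w \<Longrightarrow> Re w \<le> 1 \<Longrightarrow> cmod (g w) \<le> L"
    using assms(2) unfolding strip_bounded_def by blast
  show ?thesis
    by (rule strip_boundedI[where K = "K + L"]) (intro holomorphic_intros norm_triangle_mono K L; assumption)+
qed

lemma strip_bounded_mult:
  assumes "strip_bounded f" "strip_bounded g"
  shows "strip_bounded (\<lambda>w. f w * g w)"
proof -
  obtain K where K: "f holomorphic_on UNIV" "\<And>w. 0 \<le> Re w \<Longrightarrow> Re w \<le> 1 \<Longrightarrow> cmod (f w) \<le> K"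
    using assms(1) unfolding strip_bounded_def by blast
  obtain L where L: "g holomorphic_on UNIV" "\<And>w. 0 \<le> Re w \<Longrightarrow> Re w \<le> 1 \<Longrightarrow> cmod (g w) \<le> L"
    using assms(2) unfolding strip_bounded_def by blast
  have "cmod (f w * g w) \<le> K * L" if "0 \<le> Re w" "Re w \<le> 1" for w
    unfolding norm_mult using K(2)[OF that] L(2)[OF that] order_trans[OF norm_ge_zero K(2)[OF that]]
    by (intro mult_mono) auto
  thus ?thesis
    using K(1) L(1) by (intro strip_boundedI holomorphic_intros)
qed

lemma strip_bounded_sum:
  assumes "\<And>i. i \<in> I \<Longrightarrow> strip_bounded (f i)"
  shows "strip_bounded (\<lambda>w. \<Sum>i\<in>I. f i w)"
  using assms
  by (induction I rule: infinite_finite_induct) (auto intro: strip_bounded_const strip_bounded_add)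

lemma norm_real_powr:
  "t \<ge> 0 \<Longrightarrow> cmod (complex_of_real t powr (of_real \<alpha> + of_real \<beta> * w)) = t powr (\<alpha> + \<beta> * Re w)"
  by (subst norm_powr_real_powr) auto

lemma strip_bounded_powr:
  assumes "t \<ge> 0"
  shows "strip_bounded (\<lambda>w. complex_of_real t powr (of_real \<alpha> + of_real \<beta> * w))"
proof (rule strip_boundedI[where K = "exp (\<bar>ln t\<bar> * (\<bar>\<alpha>\<bar> + \<bar>\<beta>\<bar>))"])
  \<comment> \<open>Only the exponent varies, so no branch cut interferes; for \<open>t = 0\<close>
    the power is constantly 0.\<close>
  show "(\<lambda>w. complex_of_real t powr (of_real \<alpha> + of_real \<beta> * w)) holomorphic_on UNIV"
    by (intro holomorphic_intros)
next
  fix w assume w: "0 \<le> Re w" "Re w \<le> 1"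
  have "\<alpha> + \<beta> * Re w \<le> \<bar>\<alpha>\<bar> + \<bar>\<beta>\<bar>" "- (\<alpha> + \<beta> * Re w) \<le> \<bar>\<alpha>\<bar> + \<bar>\<beta>\<bar>"
  proof -
    have "\<bar>\<beta> * Re w\<bar> \<le> \<bar>\<beta>\<bar>"
      using w by (simp add: abs_mult mult_left_le)
    thus "\<alpha> + \<beta> * Re w \<le> \<bar>\<alpha>\<bar> + \<bar>\<beta>\<bar>" "- (\<alpha> + \<beta> * Re w) \<le> \<bar>\<alpha>\<bar> + \<bar>\<beta>\<bar>"
      by linarith+
  qed
  hence "\<bar>\<alpha> + \<beta> * Re w\<bar> \<le> \<bar>\<alpha>\<bar> + \<bar>\<beta>\<bar>"
    by linarith
  hence "\<bar>ln t\<bar> * \<bar>\<alpha> + \<beta> * Re w\<bar> \<le> \<bar>ln t\<bar> * (\<bar>\<alpha>\<bar> + \<bar>\<beta>\<bar>)"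
    by (rule mult_left_mono) simp
  hence "(\<alpha> + \<beta> * Re w) * ln t \<le> \<bar>ln t\<bar> * (\<bar>\<alpha>\<bar> + \<bar>\<beta>\<bar>)"
    using abs_ge_self[of "(\<alpha> + \<beta> * Re w) * ln t"] by (simp add: abs_mult mult.commute)
  thus "cmod (complex_of_real t powr (of_real \<alpha> + of_real \<beta> * w)) \<le> exp (\<bar>ln t\<bar> * (\<bar>\<alpha>\<bar> + \<bar>\<beta>\<bar>))"
    unfolding norm_real_powr[OF assms] by (simp add: powr_def)
qed

section \<open>The bilinear form of a Schur multiplier\<close>

text \<open>The basis stays in the fixed space of \<open>E\<close>. Bases built for mutually
  orthogonal projections therefore unite to one finite orthonormal system, even when the ranges are
  infinite-dimensional.\<close>

lemma Gram_Schmidt: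
  fixes v :: "'n \<Rightarrow> 'h::chilbert_space"
  assumes "finite N" "bounded_clinear E" "\<And>n. n \<in> N \<Longrightarrow> E (v n) = v n"
  obtains G where "finite G" "orthonormal_on G id" "\<And>g. g \<in> G \<Longrightarrow> E g = g"
    "\<And>n. n \<in> N \<Longrightarrow> v n = (\<Sum>g\<in>G. cscale (cinner (v n) g) g)"
proof -
  note lin = bounded_clinearD[OF assms(2)]
  have "\<exists>G. finite G \<and> orthonormal_on G id \<and> (\<forall>g\<in>G. E g = g) \<and>
      (\<forall>n\<in>N. v n = (\<Sum>g\<in>G. cscale (cinner (v n) g) g))"
    using assms(1,3)
  proof (induction N rule: finite_induct)
    case empty
    show ?case
      by (rule exI[of _ "{}"]) (simp add: orthonormal_on_def)
  next
    case (insert n N)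
    then obtain G where G: "finite G" "orthonormal_on G id" "\<And>g. g \<in> G \<Longrightarrow> E g = g"
      "\<And>k. k \<in> N \<Longrightarrow> v k = (\<Sum>g\<in>G. cscale (cinner (v k) g) g)"
      by (metis insert_iff)
    define r where "r = v n - (\<Sum>g\<in>G. cscale (cinner (v n) g) g)"
    show ?case
    proof (cases "r = 0")
      case True
      hence "v n = (\<Sum>g\<in>G. cscale (cinner (v n) g) g)"
        by (simp add: r_def)
      thus ?thesis
        using G(4) by (intro exI[of _ G] conjI ballI G(1-3)) auto
    next
      case False
      define h where "h = cscale (complex_of_real (1 / norm r)) r"
      have "E r = r"
        using insert.prems G(3) by (simp add: r_def lin)
      hence Eh: "E h = h"
        by (simp add: h_def lin)
      have nh: "norm h = 1"
        using False unfolding h_def norm_cscale norm_of_real by simp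
      have "cinner r g = 0" if "g \<in> G" for g
        using orthonormal_on_residual[OF G(1,2) that, of "v n"] by (simp add: r_def)
      hence hG: "cinner h g = 0" if "g \<in> G" for g
        using that by (simp add: h_def cinner_simps)
      hence Gh: "cinner g h = 0" if "g \<in> G" for g
        using that cinner_commute[of g h] by simp
      have hn: "h \<notin> G"
        using nh hG[of h] by (auto simp: cinner_self)
      have old: "cinner (v k) h = 0" if "k \<in> N" for k
      proof -
        have "cinner (\<Sum>g\<in>G. cscale (cinner (v k) g) g) h = 0"
          unfolding cinner_sum_left cinner_cscale_left using Gh by (intro sum.neutral) auto
        thus ?thesis
          using G(4)[OF that] by simp
      qed
      have "cinner (v n) h = cinner r h"
        unfolding r_def cinner_diff_left cinner_sum_left cinner_cscale_left using Gh by simp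
      hence "cscale (cinner (v n) h) h = r"
        using False by (simp add: h_def cinner_simps cinner_self cscale_cscale power2_eq_square)
      hence new: "v n = cscale (cinner (v n) h) h + (\<Sum>g\<in>G. cscale (cinner (v n) g) g)"
        by (simp add: r_def)
      show ?thesis
      proof (intro exI[of _ "insert h G"] conjI ballI)
        show "orthonormal_on (insert h G) id"
          by (rule orthonormal_on_insert[OF G(2) nh hG])
        fix k assume "k \<in> insert n N"
        thus "v k = (\<Sum>g\<in>insert h G. cscale (cinner (v k) g) g)"
          using new old G(1,4) hn by (cases "k = n") auto
      qed (use G Eh in auto)
    qed
  qed
  thus ?thesis
    using that by blast
qed

locale projection_family =
  fixes L :: "'l set" and E :: "'l \<Rightarrow> 'h::chilbert_space \<Rightarrow> 'h"
  assumes finite_L: "finite L"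
    and proj: "l \<in> L \<Longrightarrow> orthogonal_projection (E l)"
    and disjoint: "l \<in> L \<Longrightarrow> k \<in> L \<Longrightarrow> l \<noteq> k \<Longrightarrow> E l (E k x) = 0"
begin

lemma lin: "l \<in> L \<Longrightarrow> bounded_clinear (E l)"
  and idem: "l \<in> L \<Longrightarrow> E l (E l x) = E l x"
  and selfadjoint: "l \<in> L \<Longrightarrow> cinner (E l x) y = cinner x (E l y)"
  using proj by (auto simp: orthogonal_projection_def fun_eq_iff)

lemma cinner_components:
  assumes "l \<in> L" "k \<in> L" "l \<noteq> k"
  shows "cinner (E l x) (E k y) = 0"
  using assms by (simp add: selfadjoint disjoint)

lemma norm_combination:
  "(norm (\<Sum>l\<in>L. cscale (c l) (E l x)))\<^sup>2 = (\<Sum>l\<in>L. (cmod (c l))\<^sup>2 * (norm (E l x))\<^sup>2)"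
proof -
  have "(norm (\<Sum>l\<in>L. cscale (c l) (E l x)))\<^sup>2 = (\<Sum>l\<in>L. (norm (cscale (c l) (E l x)))\<^sup>2)"
    by (rule norm_Pythagoras[OF finite_L]) (simp add: cinner_simps cinner_components)
  thus ?thesis
    by (simp add: power_mult_distrib)
qed

lemma orthogonal_projection_sum: "orthogonal_projection (\<lambda>x. \<Sum>l\<in>L. E l x)"
  unfolding orthogonal_projection_def
proof (intro conjI allI)
  show "bounded_clinear (\<lambda>x. \<Sum>l\<in>L. E l x)"
    by (intro bounded_clinear_sum lin)
  show "cinner (\<Sum>l\<in>L. E l x) y = cinner x (\<Sum>l\<in>L. E l y)" for x y
    unfolding cinner_sum_left cinner_sum_right by (intro sum.cong refl selfadjoint)
  show "(\<lambda>x. \<Sum>l\<in>L. E l x) \<circ> (\<lambda>x. \<Sum>l\<in>L. E l x) = (\<lambda>x. \<Sum>l\<in>L. E l x)"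
  proof
    fix x
    have "E l (\<Sum>k\<in>L. E k x) = E l x" if l: "l \<in> L" for l
    proof -
      have "E l (\<Sum>k\<in>L. E k x) = (\<Sum>k\<in>L. if k = l then E l x else 0)"
        unfolding bounded_clinearD(5)[OF lin[OF l]] using l
        by (intro sum.cong) (auto simp: idem disjoint)
      thus ?thesis
        using l finite_L by simp
    qed
    thus "((\<lambda>x. \<Sum>l\<in>L. E l x) \<circ> (\<lambda>x. \<Sum>l\<in>L. E l x)) x = (\<Sum>l\<in>L. E l x)"
      by simp
  qed
qed

lemma norm_components_le: "(\<Sum>l\<in>L. (norm (E l x))\<^sup>2) \<le> (norm x)\<^sup>2"
proof -
  define p where "p = (\<Sum>l\<in>L. E l x)"
  have "(\<Sum>l\<in>L. (norm (E l x))\<^sup>2) = (norm p)\<^sup>2"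
    using norm_combination[of "\<lambda>_. 1" x] by (simp add: p_def)
  moreover have "cinner p p = cinner p x"
  proof -
    have sa: "cinner (\<Sum>l\<in>L. E l v) w = cinner v (\<Sum>l\<in>L. E l w)"
      and idp: "(\<Sum>l\<in>L. E l (\<Sum>k\<in>L. E k v)) = (\<Sum>l\<in>L. E l v)" for v w
      using orthogonal_projection_sum by (simp_all add: orthogonal_projection_def fun_eq_iff)
    have "cinner p p = cinner x (\<Sum>l\<in>L. E l (\<Sum>k\<in>L. E k x))"
      unfolding p_def by (rule sa)
    also have "\<dots> = cinner p x"
      unfolding idp by (simp add: p_def sa)
    finally show ?thesis .
  qed
  hence "(norm p)\<^sup>2 = inner p x"
    by (metis Re_cinner power2_norm_eq_inner)
  moreover have "0 \<le> (norm (x - p))\<^sup>2"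
    by simp
  ultimately show ?thesis
    by (simp add: power2_norm_eq_inner inner_simps inner_commute)
qed

end

locale schur_pairing = projection_family L E
  for L :: "'l set" and E :: "'l \<Rightarrow> 'h::chilbert_space \<Rightarrow> 'h" +
  fixes I :: "'i set" and u z :: "'i \<Rightarrow> 'h" and N :: "'n set" and x y :: "'n \<Rightarrow> 'h"
  assumes I: "finite I" "orthonormal_on I u" "orthonormal_on I z"
    and N: "finite N" "orthonormal_on N x" "orthonormal_on N y"
begin

text \<open>The pairing of \<open>\<Sum>\<^sub>l\<^sub>k \<mu>\<^sub>l\<^sub>k E\<^sub>l A E\<^sub>k\<close>, where \<open>A\<close> has singular value decomposition \<open>(s, x, y)\<close>, with the
  finite rank operator given by \<open>(b, u, z)\<close>; the weights may be complex.\<close>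

definition form :: "('l \<Rightarrow> 'l \<Rightarrow> complex) \<Rightarrow> ('i \<Rightarrow> complex) \<Rightarrow> ('n \<Rightarrow> complex) \<Rightarrow> complex" where
  "form \<mu> b s = (\<Sum>i\<in>I. \<Sum>n\<in>N. b i * s n *
     (\<Sum>l\<in>L. \<Sum>k\<in>L. \<mu> l k * (cinner (E k (u i)) (x n) * cinner (E l (y n)) (z i))))"

text \<open>Multiplying mutually orthogonal blocks by numbers of modulus at most 1 does not increase
  the Hilbert-Schmidt norm. The norm is computed in a finite orthonormal system \<open>J\<close>
  adapted to the blocks, in which all \<open>E l (y n)\<close> can be expanded.\<close>

lemma form_le_Hilbert_Schmidt:
  assumes \<mu>: "\<And>l k. l \<in> L \<Longrightarrow> k \<in> L \<Longrightarrow> cmod (\<mu> l k) \<le> 1"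
    and b: "(\<Sum>i\<in>I. (cmod (b i))\<^sup>2) \<le> 1" and s: "(\<Sum>n\<in>N. (cmod (s n))\<^sup>2) \<le> 1"
  shows "cmod (form \<mu> b s) \<le> 1"
proof -
  have "\<exists>G. finite G \<and> orthonormal_on G id \<and> (\<forall>g\<in>G. E l g = g) \<and>
      (\<forall>n\<in>N. E l (y n) = (\<Sum>g\<in>G. cscale (cinner (E l (y n)) g) g))" if "l \<in> L" for l
  proof -
    have "E l (E l (y n)) = E l (y n)" for n
      using that by (rule idem)
    from Gram_Schmidt[of N "E l" "\<lambda>n. E l (y n)", OF N(1) lin[OF that] this] show ?thesis
      by metis
  qed
  then obtain G where G: "\<And>l. l \<in> L \<Longrightarrow> finite (G l)" "\<And>l. l \<in> L \<Longrightarrow> orthonormal_on (G l) id"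
    "\<And>l g. l \<in> L \<Longrightarrow> g \<in> G l \<Longrightarrow> E l g = g"
    "\<And>l n. l \<in> L \<Longrightarrow> n \<in> N \<Longrightarrow> E l (y n) = (\<Sum>g\<in>G l. cscale (cinner (E l (y n)) g) g)"
    by metis
  define J where "J = Sigma L G"
  have J: "finite J"
    using finite_L G(1) by (auto simp: J_def)
  have on_J: "orthonormal_on J snd"
    unfolding orthonormal_on_def
  proof (intro ballI)
    fix p q assume pq: "p \<in> J" "q \<in> J"
    obtain l g k h where lk: "p = (l, g)" "q = (k, h)" "l \<in> L" "k \<in> L" "g \<in> G l" "h \<in> G k"
      using pq by (auto simp: J_def)
    show "cinner (snd p) (snd q) = (if p = q then 1 else 0)"
    proof (cases "l = k")
      case True
      thus ?thesis
        using orthonormal_onD[OF G(2)[OF lk(3)], of g h] lk by auto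
    next
      case False
      thus ?thesis
        using cinner_components[OF lk(3,4) False, of g h] G(3) lk by auto
    qed
  qed
  \<comment> \<open>For the operator A with weights \<open>s\<close> from \<open>x\<close> to
    \<open>y\<close>, \<open>P g\<close> is the adjoint of A at \<open>g\<close>; for
    \<open>g\<close> in \<open>G l\<close>, \<open>q l g\<close> is the adjoint of the multiplied
    operator at \<open>g\<close>.\<close>
  define P where "P g = (\<Sum>n\<in>N. cscale (cnj (s n * cinner (y n) g)) (x n))" for g
  define q where "q l g = (\<Sum>k\<in>L. cscale (cnj (\<mu> l k)) (E k (P g)))" for l g
  have expand: "cinner (E l (y n)) w = (\<Sum>g\<in>G l. cinner (y n) g * cinner g w)"
    if "l \<in> L" "n \<in> N" for l n w
  proof -
    have "cinner (E l (y n)) w = (\<Sum>g\<in>G l. cinner (E l (y n)) g * cinner g w)"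
      by (subst G(4)[OF that]) (simp add: cinner_simps)
    also have "\<dots> = (\<Sum>g\<in>G l. cinner (y n) g * cinner g w)"
      using that(1) by (intro sum.cong) (auto simp: selfadjoint G(3))
    finally show ?thesis .
  qed
  have q: "cinner w (q l g) = (\<Sum>k\<in>L. \<Sum>n\<in>N. \<mu> l k * (s n * (cinner (y n) g * cinner (E k w) (x n))))" for w l g
    unfolding q_def
    by (simp add: cinner_simps selfadjoint[symmetric] P_def sum_distrib_left mult_ac)
  have "form \<mu> b s = (\<Sum>i\<in>I. \<Sum>l\<in>L. \<Sum>g\<in>G l. (b i * cinner g (z i)) * cinner (u i) (q l g))"
    unfolding form_def
  proof (rule sum.cong)
    fix i
    have "(\<Sum>n\<in>N. b i * s n *
        (\<Sum>l\<in>L. \<Sum>k\<in>L. \<mu> l k * (cinner (E k (u i)) (x n) * cinner (E l (y n)) (z i))))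
      = (\<Sum>n\<in>N. \<Sum>l\<in>L. \<Sum>k\<in>L. \<Sum>g\<in>G l.
          b i * cinner g (z i) * (\<mu> l k * (s n * (cinner (y n) g * cinner (E k (u i)) (x n)))))"
      unfolding sum_distrib_left
      by (intro sum.cong refl) (simp add: expand sum_distrib_left mult_ac)
    also have "\<dots> = (\<Sum>l\<in>L. \<Sum>k\<in>L. \<Sum>g\<in>G l. \<Sum>n\<in>N.
          b i * cinner g (z i) * (\<mu> l k * (s n * (cinner (y n) g * cinner (E k (u i)) (x n)))))"
      by (subst sum.swap, intro sum.cong refl, subst sum.swap, intro sum.cong refl, rule sum.swap)
    also have "\<dots> = (\<Sum>l\<in>L. \<Sum>g\<in>G l. \<Sum>k\<in>L. \<Sum>n\<in>N.
          b i * cinner g (z i) * (\<mu> l k * (s n * (cinner (y n) g * cinner (E k (u i)) (x n)))))"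
      by (intro sum.cong refl sum.swap)
    also have "\<dots> = (\<Sum>l\<in>L. \<Sum>g\<in>G l. (b i * cinner g (z i)) * cinner (u i) (q l g))"
      unfolding q sum_distrib_left ..
    finally show "(\<Sum>n\<in>N. b i * s n *
        (\<Sum>l\<in>L. \<Sum>k\<in>L. \<mu> l k * (cinner (E k (u i)) (x n) * cinner (E l (y n)) (z i))))
      = (\<Sum>l\<in>L. \<Sum>g\<in>G l. (b i * cinner g (z i)) * cinner (u i) (q l g))" .
  qed simp
  also have "\<dots> = (\<Sum>i\<in>I. \<Sum>(l, g)\<in>J. (b i * cinner g (z i)) * cinner (u i) (q l g))"
    unfolding J_def using finite_L G(1) by (subst sum.Sigma) auto
  finally have eq: "form \<mu> b s = (\<Sum>i\<in>I. \<Sum>(l, g)\<in>J. (b i * cinner g (z i)) * cinner (u i) (q l g))" .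
  \<comment> \<open>Both square sums will be at most 1, so half the sum of squares can replace the
    Cauchy-Schwarz inequality.\<close>
  have "cmod (form \<mu> b s)
      \<le> (\<Sum>i\<in>I. \<Sum>(l, g)\<in>J. cmod (b i * cinner g (z i)) * cmod (cinner (u i) (q l g)))"
    unfolding eq by (intro order_trans[OF norm_sum] sum_mono) (auto simp: norm_mult)
  also have "\<dots> \<le> (\<Sum>i\<in>I. \<Sum>(l, g)\<in>J.
      ((cmod (b i * cinner g (z i)))\<^sup>2 + (cmod (cinner (u i) (q l g)))\<^sup>2) / 2)"
    unfolding case_prod_unfold by (intro sum_mono product_le_half_squares)
  also have "\<dots> = ((\<Sum>i\<in>I. \<Sum>(l, g)\<in>J. (cmod (b i * cinner g (z i)))\<^sup>2)
      + (\<Sum>i\<in>I. \<Sum>(l, g)\<in>J. (cmod (cinner (u i) (q l g)))\<^sup>2)) / 2"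
    by (simp add: case_prod_unfold sum.distrib flip: sum_divide_distrib)
  also have "\<dots> \<le> (1 + 1) / 2"
  proof (intro divide_right_mono add_mono)
    have "(\<Sum>(l, g)\<in>J. (cmod (b i * cinner g (z i)))\<^sup>2) \<le> (cmod (b i))\<^sup>2" if i: "i \<in> I" for i
    proof -
      have "(\<Sum>(l, g)\<in>J. (cmod (b i * cinner g (z i)))\<^sup>2)
          = (cmod (b i))\<^sup>2 * (\<Sum>p\<in>J. (cmod (cinner (snd p) (z i)))\<^sup>2)"
        by (simp add: case_prod_unfold norm_mult power_mult_distrib sum_distrib_left)
      also have "\<dots> \<le> (cmod (b i))\<^sup>2 * (norm (z i))\<^sup>2"
        by (intro mult_left_mono Bessel_left[OF J on_J]) auto
      finally show ?thesis
        using orthonormal_on_norm[OF I(3) i] by simp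
    qed
    hence "(\<Sum>i\<in>I. \<Sum>(l, g)\<in>J. (cmod (b i * cinner g (z i)))\<^sup>2) \<le> (\<Sum>i\<in>I. (cmod (b i))\<^sup>2)"
      by (rule sum_mono)
    thus "(\<Sum>i\<in>I. \<Sum>(l, g)\<in>J. (cmod (b i * cinner g (z i)))\<^sup>2) \<le> 1"
      using b by simp
  next
    have norm_q: "(norm (q l g))\<^sup>2 \<le> (norm (P g))\<^sup>2" if l: "l \<in> L" for l g
    proof -
      have "(norm (q l g))\<^sup>2 = (\<Sum>k\<in>L. (cmod (\<mu> l k))\<^sup>2 * (norm (E k (P g)))\<^sup>2)"
        unfolding q_def norm_combination by simp
      also have "\<dots> \<le> (\<Sum>k\<in>L. 1 * (norm (E k (P g)))\<^sup>2)"
        using \<mu>[OF l] by (intro sum_mono mult_right_mono) (auto simp: power_le_one)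
      also have "\<dots> \<le> (norm (P g))\<^sup>2"
        using norm_components_le[of "P g"] by simp
      finally show ?thesis .
    qed
    have "(\<Sum>i\<in>I. \<Sum>(l, g)\<in>J. (cmod (cinner (u i) (q l g)))\<^sup>2)
        = (\<Sum>(l, g)\<in>J. \<Sum>i\<in>I. (cmod (cinner (u i) (q l g)))\<^sup>2)"
      unfolding case_prod_unfold by (rule sum.swap)
    also have "\<dots> \<le> (\<Sum>(l, g)\<in>J. (norm (q l g))\<^sup>2)"
      unfolding case_prod_unfold by (intro sum_mono Bessel_left[OF I(1,2)])
    also have "\<dots> \<le> (\<Sum>p\<in>J. (norm (P (snd p)))\<^sup>2)"
      unfolding case_prod_unfold by (intro sum_mono norm_q) (auto simp: J_def)
    also have "\<dots> = (\<Sum>p\<in>J. \<Sum>n\<in>N. (cmod (s n))\<^sup>2 * (cmod (cinner (y n) (snd p)))\<^sup>2)"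
      unfolding P_def orthonormal_on_norm_sum[OF N(1,2)]
      by (simp add: norm_mult power_mult_distrib)
    also have "\<dots> = (\<Sum>n\<in>N. (cmod (s n))\<^sup>2 * (\<Sum>p\<in>J. (cmod (cinner (y n) (snd p)))\<^sup>2))"
      by (subst sum.swap) (simp add: sum_distrib_left)
    also have "\<dots> \<le> (\<Sum>n\<in>N. (cmod (s n))\<^sup>2 * (norm (y n))\<^sup>2)"
      by (intro sum_mono mult_left_mono Bessel[OF J on_J]) auto
    also have "\<dots> = (\<Sum>n\<in>N. (cmod (s n))\<^sup>2)"
      using orthonormal_on_norm[OF N(3)] by simp
    finally show "(\<Sum>i\<in>I. \<Sum>(l, g)\<in>J. (cmod (cinner (u i) (q l g)))\<^sup>2) \<le> 1"
      using s by simp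
  qed simp
  finally show ?thesis
    by simp
qed

text \<open>For a trace class test operator it suffices to treat one pair \<open>u i\<close>,
  \<open>z i\<close>. There the form splits along the orthogonal components of \<open>z i\<close>,
  and interchanging summations leaves the column sums of the symbol as weights on the components of
  \<open>u i\<close>.\<close>

lemma form_le_operator_norm:
  assumes \<mu>: "\<And>k. k \<in> L \<Longrightarrow> (\<Sum>l\<in>L. (cmod (\<mu> l k))\<^sup>2) \<le> 1"
    and b: "(\<Sum>i\<in>I. cmod (b i)) \<le> 1" and s: "\<And>n. n \<in> N \<Longrightarrow> cmod (s n) \<le> 1"
  shows "cmod (form \<mu> b s) \<le> 1"
proof -
  define A where "A h = (\<Sum>n\<in>N. cscale (s n * cinner h (x n)) (y n))" for h
  have A: "norm (A h) \<le> norm h" for h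
  proof (rule power2_le_imp_le)
    have "(norm (A h))\<^sup>2 = (\<Sum>n\<in>N. (cmod (s n))\<^sup>2 * (cmod (cinner h (x n)))\<^sup>2)"
      unfolding A_def orthonormal_on_norm_sum[OF N(1,3)] by (simp add: norm_mult power_mult_distrib)
    also have "\<dots> \<le> (\<Sum>n\<in>N. 1 * (cmod (cinner h (x n)))\<^sup>2)"
      using s by (intro sum_mono mult_right_mono) (auto simp: power_le_one)
    also have "\<dots> \<le> (norm h)\<^sup>2"
      using Bessel[OF N(1,2)] by simp
    finally show "(norm (A h))\<^sup>2 \<le> (norm h)\<^sup>2" .
  qed simp
  have inner_le: "cmod (\<Sum>n\<in>N. s n *
      (\<Sum>l\<in>L. \<Sum>k\<in>L. \<mu> l k * (cinner (E k (u i)) (x n) * cinner (E l (y n)) (z i)))) \<le> 1"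
    if i: "i \<in> I" for i
  proof -
    define g where "g l = (\<Sum>k\<in>L. cscale (\<mu> l k) (E k (u i)))" for l
    have "(\<Sum>n\<in>N. s n *
        (\<Sum>l\<in>L. \<Sum>k\<in>L. \<mu> l k * (cinner (E k (u i)) (x n) * cinner (E l (y n)) (z i))))
      = (\<Sum>n\<in>N. \<Sum>l\<in>L. s n * cinner (g l) (x n) * cinner (y n) (E l (z i)))"
      unfolding sum_distrib_left g_def
      by (intro sum.cong refl) (simp add: cinner_simps selfadjoint sum_distrib_left sum_distrib_right mult_ac)
    also have "\<dots> = (\<Sum>l\<in>L. cinner (A (g l)) (E l (z i)))"
      by (subst sum.swap) (simp add: A_def cinner_simps)
    finally have "cmod (\<Sum>n\<in>N. s n *
        (\<Sum>l\<in>L. \<Sum>k\<in>L. \<mu> l k * (cinner (E k (u i)) (x n) * cinner (E l (y n)) (z i))))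
      \<le> (\<Sum>l\<in>L. cmod (cinner (A (g l)) (E l (z i))))"
      by (simp add: norm_sum)
    also have "\<dots> \<le> (\<Sum>l\<in>L. ((norm (g l))\<^sup>2 + (norm (E l (z i)))\<^sup>2) / 2)"
    proof (rule sum_mono)
      fix l
      have "cmod (cinner (A (g l)) (E l (z i))) \<le> norm (g l) * norm (E l (z i))"
        by (rule order_trans[OF cmod_cinner_le]) (intro mult_right_mono A, simp)
      thus "cmod (cinner (A (g l)) (E l (z i))) \<le> ((norm (g l))\<^sup>2 + (norm (E l (z i)))\<^sup>2) / 2"
        using sum_squares_bound[of "norm (g l)" "norm (E l (z i))"] by simp
    qed
    also have "\<dots> = ((\<Sum>l\<in>L. (norm (g l))\<^sup>2) + (\<Sum>l\<in>L. (norm (E l (z i)))\<^sup>2)) / 2"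
      by (simp add: sum.distrib flip: sum_divide_distrib)
    also have "\<dots> \<le> (1 + 1) / 2"
    proof (intro divide_right_mono add_mono)
      have "(\<Sum>l\<in>L. (norm (g l))\<^sup>2) = (\<Sum>k\<in>L. (\<Sum>l\<in>L. (cmod (\<mu> l k))\<^sup>2) * (norm (E k (u i)))\<^sup>2)"
        unfolding g_def norm_combination by (subst sum.swap) (simp add: sum_distrib_right)
      also have "\<dots> \<le> (\<Sum>k\<in>L. 1 * (norm (E k (u i)))\<^sup>2)"
        using \<mu> by (intro sum_mono mult_right_mono) auto
      finally show "(\<Sum>l\<in>L. (norm (g l))\<^sup>2) \<le> 1"
        using norm_components_le[of "u i"] orthonormal_on_norm[OF I(2) i] by simp
      show "(\<Sum>l\<in>L. (norm (E l (z i)))\<^sup>2) \<le> 1"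
        using norm_components_le[of "z i"] orthonormal_on_norm[OF I(3) i] by simp
    qed simp
    finally show ?thesis
      by simp
  qed
  have eq: "form \<mu> b s = (\<Sum>i\<in>I. b i * (\<Sum>n\<in>N. s n *
      (\<Sum>l\<in>L. \<Sum>k\<in>L. \<mu> l k * (cinner (E k (u i)) (x n) * cinner (E l (y n)) (z i)))))"
    unfolding form_def by (intro sum.cong refl) (simp add: sum_distrib_left mult.assoc)
  have "cmod (form \<mu> b s) \<le> (\<Sum>i\<in>I. cmod (b i) * 1)"
    unfolding eq
    by (rule order_trans[OF norm_sum], rule sum_mono, subst norm_mult)
       (intro mult_left_mono inner_le norm_ge_zero)
  thus ?thesis
    using b by simp
qed

lemma swapped: "schur_pairing L E N x y I u z"
  by unfold_locales (fact N I)+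

text \<open>Exchanging the operator and the test operator leaves the block position (l, k) in place,
  so the condition on columns carries over instead of becoming one on rows.\<close>

lemma form_swap:
  "form \<mu> b s = cnj (schur_pairing.form L E N x y I u z (\<lambda>l k. cnj (\<mu> l k)) (\<lambda>n. cnj (s n)) (\<lambda>i. cnj (b i)))"
proof -
  have "cnj (cinner (E k (x n)) (u i)) = cinner (E k (u i)) (x n)"
    "cnj (cinner (E l (z i)) (y n)) = cinner (E l (y n)) (z i)" if "l \<in> L" "k \<in> L" for l k i n
    using that by (metis cinner_commute selfadjoint)+
  thus ?thesis
    unfolding form_def schur_pairing.form_def[OF swapped]
    by (subst sum.swap) (simp add: mult_ac)
qed

text \<open>Stein interpolation between \<open>form_le_Hilbert_Schmidt\<close> on the line \<open>Re w = 0\<close> and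
  \<open>form_le_operator_norm\<close> (with exchanged roles) on the line \<open>Re w = 1\<close>.\<close>

lemma form_le_interpolation:
  fixes \<mu> :: "'l \<Rightarrow> 'l \<Rightarrow> complex" and b :: "'i \<Rightarrow> real" and s :: "'n \<Rightarrow> real"
  assumes a: "1 < a" "a < 2" and \<theta>: "\<theta> = 2 / a - 1"
    and \<mu>: "\<And>k. k \<in> L \<Longrightarrow> (\<Sum>l\<in>L. cmod (\<mu> l k) powr (2 / \<theta>)) \<le> 1"
    and b: "\<And>i. i \<in> I \<Longrightarrow> 0 \<le> b i" "(\<Sum>i\<in>I. b i powr (a / (a - 1))) \<le> 1"
    and s: "\<And>n. n \<in> N \<Longrightarrow> 0 \<le> s n" "(\<Sum>n\<in>N. s n powr a) \<le> 1"
  shows "cmod (form \<mu> (\<lambda>i. complex_of_real (b i)) (\<lambda>n. complex_of_real (s n))) \<le> 1"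
proof -
  define q where "q = a / (a - 1)"
  have q: "q > 0"
    using a by (simp add: q_def)
  have \<theta>1: "0 < \<theta>" "\<theta> < 1"
    using a by (auto simp: \<theta> field_simps)
  have exps: "a / 2 + a / 2 * \<theta> = 1" "q / 2 + - (q / 2) * \<theta> = 1"
  proof -
    show "a / 2 + a / 2 * \<theta> = 1"
      using a by (simp add: \<theta> field_simps)
    have "q / 2 + - (q / 2) * \<theta> = q * (1 - 1 / a)"
      by (simp add: \<theta> algebra_simps)
    also have "\<dots> = 1"
      using a by (simp add: q_def divide_simps)
    finally show "q / 2 + - (q / 2) * \<theta> = 1" .
  qed
  \<comment> \<open>At the points 0, \<theta>, 1 the real exponents are a / 2, 1, a for the singular
    values, q / 2, 1, 0 for the test weights and 0, 1, 1 / \<theta> for the symbol. So both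
    operators start in the Hilbert-Schmidt class, \<theta> returns the given form, and real part 1
    pairs the trace class with bounded operators.\<close>
  define S where "S w n = complex_of_real (s n) powr (of_real (a / 2) + of_real (a / 2) * w)" for w n
  define B where "B w i = complex_of_real (b i) powr (of_real (q / 2) + of_real (- (q / 2)) * w)" for w i
  \<comment> \<open>The factor \<open>sgn\<close> carries the phase and keeps vanishing entries
    zero.\<close>
  define M where "M w l k = sgn (\<mu> l k) *
      complex_of_real (cmod (\<mu> l k)) powr (of_real 0 + of_real (1 / \<theta>) * w)" for w l k
  define F where "F w = form (M w) (B w) (S w)" for w
  have norm_S: "cmod (S w n) = s n powr (a / 2 + a / 2 * Re w)" if "n \<in> N" for w n
    unfolding S_def using s(1)[OF that] by (rule norm_real_powr)
  have norm_B: "cmod (B w i) = b i powr (q / 2 + - (q / 2) * Re w)" if "i \<in> I" for w i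
    unfolding B_def using b(1)[OF that] by (rule norm_real_powr)
  have norm_M: "cmod (M w l k) = (if \<mu> l k = 0 then 0 else cmod (\<mu> l k) powr (Re w / \<theta>))" for w l k
    unfolding M_def norm_mult using norm_real_powr[of "cmod (\<mu> l k)" 0 "1/\<theta>" w] by (simp add: norm_sgn)
  have "strip_bounded F"
    unfolding F_def form_def S_def B_def M_def
    by (intro strip_bounded_sum strip_bounded_mult strip_bounded_const strip_bounded_powr s(1) b(1))
       auto
  then obtain K where F: "F holomorphic_on UNIV"
    "\<And>w. 0 \<le> Re w \<Longrightarrow> Re w \<le> 1 \<Longrightarrow> cmod (F w) \<le> K"
    unfolding strip_bounded_def by blast
  have left: "cmod (F w) \<le> 1" if w: "Re w = 0" for w
    unfolding F_def
  proof (rule form_le_Hilbert_Schmidt)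
    show "cmod (M w l k) \<le> 1" for l k
      by (simp add: norm_M w)
    have "(\<Sum>i\<in>I. (cmod (B w i))\<^sup>2) = (\<Sum>i\<in>I. b i powr q)"
      by (intro sum.cong refl) (simp add: norm_B w power2_eq_square flip: powr_add)
    thus "(\<Sum>i\<in>I. (cmod (B w i))\<^sup>2) \<le> 1"
      using b(2) by (simp add: q_def)
    have "(\<Sum>n\<in>N. (cmod (S w n))\<^sup>2) = (\<Sum>n\<in>N. s n powr a)"
      by (intro sum.cong refl) (simp add: norm_S w power2_eq_square flip: powr_add)
    thus "(\<Sum>n\<in>N. (cmod (S w n))\<^sup>2) \<le> 1"
      using s(2) by simp
  qed
  have right: "cmod (F w) \<le> 1" if w: "Re w = 1" for w
  proof -
    \<comment> \<open>Here the singular values are the summable weights, so after the exchange they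
      act as the trace class test operator.\<close>
    have "cmod (schur_pairing.form L E N x y I u z (\<lambda>l k. cnj (M w l k)) (\<lambda>n. cnj (S w n))
        (\<lambda>i. cnj (B w i))) \<le> 1"
    proof (rule schur_pairing.form_le_operator_norm[OF swapped])
      fix k assume k: "k \<in> L"
      have "(\<Sum>l\<in>L. (cmod (cnj (M w l k)))\<^sup>2) = (\<Sum>l\<in>L. cmod (\<mu> l k) powr (2 / \<theta>))"
        by (intro sum.cong refl) (simp add: norm_M w power2_eq_square flip: powr_add)
      thus "(\<Sum>l\<in>L. (cmod (cnj (M w l k)))\<^sup>2) \<le> 1"
        using \<mu>[OF k] by simp
    next
      have "(\<Sum>n\<in>N. cmod (cnj (S w n))) = (\<Sum>n\<in>N. s n powr a)"
        by (intro sum.cong refl) (simp add: norm_S w)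
      thus "(\<Sum>n\<in>N. cmod (cnj (S w n))) \<le> 1"
        using s(2) by simp
    next
      show "cmod (cnj (B w i)) \<le> 1" if "i \<in> I" for i
        using that by (simp add: norm_B w)
    qed
    thus ?thesis
      unfolding F_def form_swap[of "M w"] by simp
  qed
  have "cmod (F (complex_of_real \<theta>)) \<le> 1"
    using \<theta>1 by (intro strip_maximum_principle[OF F left right]) auto
  moreover have "F (complex_of_real \<theta>) = form \<mu> (\<lambda>i. complex_of_real (b i)) (\<lambda>n. complex_of_real (s n))"
  proof -
    have "S (complex_of_real \<theta>) n = complex_of_real (s n)" if "n \<in> N" for n
    proof -
      have "of_real (a / 2) + of_real (a / 2) * complex_of_real \<theta> = complex_of_real 1"
        unfolding of_real_mult[symmetric] of_real_add[symmetric] exps(1) ..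
      thus ?thesis
        unfolding S_def by simp
    qed
    moreover have "B (complex_of_real \<theta>) i = complex_of_real (b i)" if "i \<in> I" for i
    proof -
      have "of_real (q / 2) + of_real (- (q / 2)) * complex_of_real \<theta> = complex_of_real 1"
        unfolding of_real_mult[symmetric] of_real_add[symmetric] exps(2) ..
      thus ?thesis
        unfolding B_def by simp
    qed
    moreover have "M (complex_of_real \<theta>) l k = \<mu> l k" for l k
    proof -
      have "of_real 0 + of_real (1 / \<theta>) * complex_of_real \<theta> = complex_of_real 1"
        unfolding of_real_mult[symmetric] of_real_add[symmetric] using \<theta>1 by simp
      thus ?thesis
        unfolding M_def by (simp add: sgn_eq)
    qed
    ultimately show ?thesis
      unfolding F_def form_def by (intro sum.cong refl) simp
  qed
  ultimately show ?thesis
    by simp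
qed

text \<open>For a > 2 the exchanged form belongs to the conjugate exponent q < 2, and
  \<open>2 / q - 1 = 1 - 2 / a\<close> shows that \<theta> does not change.\<close>

lemma form_le:
  fixes \<mu> :: "'l \<Rightarrow> 'l \<Rightarrow> complex" and b :: "'i \<Rightarrow> real" and s :: "'n \<Rightarrow> real"
  assumes a: "1 < a" "a \<noteq> 2" and \<theta>: "\<theta> = \<bar>2 / a - 1\<bar>"
    and \<mu>: "\<And>k. k \<in> L \<Longrightarrow> (\<Sum>l\<in>L. cmod (\<mu> l k) powr (2 / \<theta>)) \<le> 1"
    and b: "\<And>i. i \<in> I \<Longrightarrow> 0 \<le> b i" "(\<Sum>i\<in>I. b i powr (a / (a - 1))) \<le> 1"
    and s: "\<And>n. n \<in> N \<Longrightarrow> 0 \<le> s n" "(\<Sum>n\<in>N. s n powr a) \<le> 1"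
  shows "cmod (form \<mu> (\<lambda>i. complex_of_real (b i)) (\<lambda>n. complex_of_real (s n))) \<le> 1"
proof (cases "a < 2")
  case True
  hence "\<theta> = 2 / a - 1"
    using a by (simp add: \<theta> field_simps)
  from form_le_interpolation[OF a(1) True this \<mu> b s] show ?thesis .
next
  case False
  define q where "q = a / (a - 1)"
  have q: "1 < q" "q < 2" "\<theta> = 2 / q - 1" "q / (q - 1) = a"
    using a False by (auto simp: q_def \<theta> field_simps)
  have "cmod (schur_pairing.form L E N x y I u z (\<lambda>l k. cnj (\<mu> l k))
      (\<lambda>n. complex_of_real (s n)) (\<lambda>i. complex_of_real (b i))) \<le> 1"
    by (rule schur_pairing.form_le_interpolation[OF swapped q(1-3)])
       (use \<mu> b s q(4) in \<open>auto simp: q_def[symmetric]\<close>)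
  thus ?thesis
    unfolding form_swap[of \<mu>] by simp
qed

lemma form_le_scaled:
  fixes \<mu> :: "'l \<Rightarrow> 'l \<Rightarrow> complex" and b :: "'i \<Rightarrow> real" and s :: "'n \<Rightarrow> real"
  assumes a: "1 < a" "a \<noteq> 2" and \<theta>: "\<theta> = \<bar>2 / a - 1\<bar>"
    and \<mu>: "\<And>k. k \<in> L \<Longrightarrow> (\<Sum>l\<in>L. cmod (\<mu> l k) powr (2 / \<theta>)) \<le> M powr (2 / \<theta>)" "0 \<le> M"
    and b: "\<And>i. i \<in> I \<Longrightarrow> 0 \<le> b i" "(\<Sum>i\<in>I. b i powr (a / (a - 1))) \<le> 1"
    and s: "\<And>n. n \<in> N \<Longrightarrow> 0 \<le> s n" "(\<Sum>n\<in>N. s n powr a) \<le> S powr a" "0 \<le> S"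
  shows "cmod (form \<mu> (\<lambda>i. complex_of_real (b i)) (\<lambda>n. complex_of_real (s n))) \<le> M * S"
proof -
  have "\<theta> > 0"
    using a by (auto simp: \<theta> field_simps)
  \<comment> \<open>A vanishing bound forces the symbol or the singular values to vanish; otherwise
    homogeneity reduces both bounds to 1.\<close>
  consider "M = 0" | "S = 0" | "M > 0" "S > 0"
    using \<mu>(2) s(3) by linarith
  thus ?thesis
  proof cases
    case 1
    have "\<mu> l k = 0" if "l \<in> L" "k \<in> L" for l k
    proof -
      have "(\<Sum>l\<in>L. cmod (\<mu> l k) powr (2 / \<theta>)) = 0"
        using \<mu>(1)[OF that(2)] 1 by (intro antisym sum_nonneg) auto
      thus ?thesis
        using that finite_L by (subst (asm) sum_nonneg_eq_0_iff) auto
    qed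
    thus ?thesis
      using 1 by (simp add: form_def)
  next
    case 2
    have "(\<Sum>n\<in>N. s n powr a) = 0"
      using s(2) 2 by (intro antisym sum_nonneg) auto
    hence "\<forall>n\<in>N. s n = 0"
      using N(1) by (subst (asm) sum_nonneg_eq_0_iff) auto
    thus ?thesis
      using 2 by (simp add: form_def)
  next
    case 3
    have "cmod (form (\<lambda>l k. \<mu> l k / complex_of_real M) (\<lambda>i. complex_of_real (b i))
        (\<lambda>n. complex_of_real (s n / S))) \<le> 1"
    proof (rule form_le[OF a \<theta> _ b])
      fix k assume "k \<in> L"
      have "(\<Sum>l\<in>L. cmod (\<mu> l k / complex_of_real M) powr (2 / \<theta>))
          = (\<Sum>l\<in>L. cmod (\<mu> l k) powr (2 / \<theta>)) / M powr (2 / \<theta>)"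
        using 3 by (simp add: norm_divide powr_divide sum_divide_distrib)
      also have "\<dots> \<le> 1"
        using \<mu>(1)[OF \<open>k \<in> L\<close>] 3 by simp
      finally show "(\<Sum>l\<in>L. cmod (\<mu> l k / complex_of_real M) powr (2 / \<theta>)) \<le> 1" .
    next
      have "(\<Sum>n\<in>N. (s n / S) powr a) = (\<Sum>n\<in>N. s n powr a) / S powr a"
        unfolding sum_divide_distrib using 3 s(1) by (intro sum.cong) (auto simp: powr_divide)
      thus "(\<Sum>n\<in>N. (s n / S) powr a) \<le> 1"
        using s(2) 3 by simp
    qed (use s 3 in auto)
    moreover have "form \<mu> (\<lambda>i. complex_of_real (b i)) (\<lambda>n. complex_of_real (s n))
        = complex_of_real (M * S) * form (\<lambda>l k. \<mu> l k / complex_of_real M)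
            (\<lambda>i. complex_of_real (b i)) (\<lambda>n. complex_of_real (s n / S))"
      unfolding form_def sum_distrib_left using 3 by (intro sum.cong refl) simp
    ultimately show ?thesis
      using 3 by (simp add: norm_mult mult_left_le del: of_real_mult)
  qed
qed

end

section \<open>Finite Schur multipliers\<close>

text \<open>The form estimate concerns finite singular value decompositions. Replacing
  \<open>v\<close> by one, with operator norm error at most \<delta>, changes the pairing by at most
  \<delta> times a constant \<open>C\<close> free of \<delta>, while the main term is bounded by the
  Schatten norm of \<open>v\<close> itself.\<close>

lemma (in projection_family) dual_bound_schur:
  fixes \<mu> :: "'l \<Rightarrow> 'l \<Rightarrow> complex"
  assumes a: "1 < a" "a \<noteq> 2" and \<theta>: "\<theta> = \<bar>2 / a - 1\<bar>"
    and \<mu>: "\<And>k. k \<in> L \<Longrightarrow> (\<Sum>l\<in>L. cmod (\<mu> l k) powr (2 / \<theta>)) \<le> M powr (2 / \<theta>)" "0 \<le> M"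
    and v: "v \<in> schatten_class a"
  shows "dual_bound a (\<lambda>x. \<Sum>l\<in>L. \<Sum>k\<in>L. cscale (\<mu> l k) (E l (v (E k x)))) (M * schatten_norm a v)"
proof (rule dual_boundI)
  fix I :: "'h set" and u z :: "'h \<Rightarrow> 'h" and b
  assume *: "finite I" "orthonormal_on I u" "orthonormal_on I z" "\<And>i. i \<in> I \<Longrightarrow> 0 \<le> b i"
    "(\<Sum>i\<in>I. b i powr (a / (a - 1))) \<le> 1"
  define W where "W = schatten_sum a v"
  define \<Phi> where "\<Phi> T = (\<Sum>i\<in>I. complex_of_real (b i) *
      (\<Sum>l\<in>L. \<Sum>k\<in>L. \<mu> l k * cinner (T (E k (u i))) (E l (z i))))" for T
  have sf: "singular_family v 1 {}"
    by (simp add: singular_family_def orthonormal_on_def)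
  have W: "W \<ge> 0"
    using singular_family_sum_le[OF v zero_less_one sf] by (simp add: W_def)
  define C where "C = (\<Sum>i\<in>I. b i * (\<Sum>l\<in>L. \<Sum>k\<in>L. cmod (\<mu> l k)))"
  have main: "cmod (\<Phi> v) \<le> M * schatten_norm a v + \<delta> * C" if \<delta>: "0 < \<delta>" "\<delta> < 1" for \<delta>
  proof -
    obtain N w where Nw: "finite N" "orthonormal_on N (\<lambda>b. b)" "orthonormal_on N w"
      "(\<Sum>b\<in>N. norm (v b) powr a) \<le> W"
      "\<forall>x. norm (v x - (\<Sum>b\<in>N. cscale (complex_of_real (norm (v b)) * cinner x b) (w b))) \<le> \<delta> * norm x"
      using approximate_singular_value_decomposition[OF v sf \<delta>(1) less_imp_le[OF \<delta>(2)]]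
      unfolding W_def by auto
    define A where "A x = (\<Sum>b\<in>N. cscale (complex_of_real (norm (v b)) * cinner x b) (w b))" for x
    define R where "R x = v x - A x" for x
    interpret schur_pairing L E I u z N "\<lambda>b. b" w
      by unfold_locales (fact * Nw)+
    have "\<Phi> v = \<Phi> A + \<Phi> R"
      by (simp add: \<Phi>_def R_def cinner_diff_left right_diff_distrib sum_subtractf)
    moreover have "cmod (\<Phi> A) \<le> M * schatten_norm a v"
    proof -
      have "\<Phi> A = form \<mu> (\<lambda>i. complex_of_real (b i)) (\<lambda>n. complex_of_real (norm (v n)))"
        unfolding \<Phi>_def form_def
      proof (rule sum.cong)
        fix i
        have "(\<Sum>l\<in>L. \<Sum>k\<in>L. \<mu> l k * cinner (A (E k (u i))) (E l (z i)))
            = (\<Sum>l\<in>L. \<Sum>k\<in>L. \<Sum>n\<in>N. complex_of_real (norm (v n)) *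
                (\<mu> l k * (cinner (E k (u i)) n * cinner (E l (w n)) (z i))))"
          by (intro sum.cong refl) (simp add: A_def cinner_simps selfadjoint sum_distrib_left mult_ac)
        also have "\<dots> = (\<Sum>n\<in>N. \<Sum>l\<in>L. \<Sum>k\<in>L. complex_of_real (norm (v n)) *
                (\<mu> l k * (cinner (E k (u i)) n * cinner (E l (w n)) (z i))))"
          by (subst (2) sum.swap, subst sum.swap) (rule refl)
        finally show "complex_of_real (b i) * (\<Sum>l\<in>L. \<Sum>k\<in>L. \<mu> l k * cinner (A (E k (u i))) (E l (z i)))
            = (\<Sum>n\<in>N. complex_of_real (b i) * complex_of_real (norm (v n)) *
                (\<Sum>l\<in>L. \<Sum>k\<in>L. \<mu> l k * (cinner (E k (u i)) n * cinner (E l (w n)) (z i))))"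
          by (simp add: sum_distrib_left mult.assoc)
      qed simp
      thus ?thesis
        using form_le_scaled[OF a \<theta> \<mu> *(4,5), where s = "\<lambda>n. norm (v n)" and S = "schatten_norm a v"]
          Nw(4) W a
        by (simp add: schatten_norm_eq powr_powr flip: W_def)
    qed
    moreover have "cmod (\<Phi> R) \<le> \<delta> * C"
    proof -
      have R: "cmod (cinner (R (E k (u i))) (E l (z i))) \<le> \<delta>" if "i \<in> I" "l \<in> L" "k \<in> L" for i l k
      proof -
        have le: "norm (E k x) \<le> norm x" if "k \<in> L" for k x
        proof (rule power2_le_imp_le)
          have "(norm (E k x))\<^sup>2 \<le> (\<Sum>l\<in>L. (norm (E l x))\<^sup>2)"
            using that finite_L by (intro member_le_sum) auto
          thus "(norm (E k x))\<^sup>2 \<le> (norm x)\<^sup>2"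
            using norm_components_le by (rule order_trans)
        qed simp
        have "cmod (cinner (R (E k (u i))) (E l (z i))) \<le> norm (R (E k (u i))) * norm (E l (z i))"
          by (rule cmod_cinner_le)
        also have "\<dots> \<le> (\<delta> * norm (E k (u i))) * norm (E l (z i))"
          using Nw(5) by (intro mult_right_mono) (auto simp: R_def A_def)
        also have "\<dots> \<le> (\<delta> * 1) * 1"
          using le[OF that(2), of "z i"] le[OF that(3), of "u i"] \<delta>
            orthonormal_on_norm[OF *(2) that(1)] orthonormal_on_norm[OF *(3) that(1)]
          by (intro mult_mono) auto
        finally show ?thesis
          by simp
      qed
      have "cmod (\<Phi> R) \<le> (\<Sum>i\<in>I. b i * (\<Sum>l\<in>L. \<Sum>k\<in>L. cmod (\<mu> l k) * \<delta>))"
        unfolding \<Phi>_def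
      proof (rule order_trans[OF norm_sum], rule sum_mono)
        fix i assume i: "i \<in> I"
        have "cmod (\<Sum>l\<in>L. \<Sum>k\<in>L. \<mu> l k * cinner (R (E k (u i))) (E l (z i)))
            \<le> (\<Sum>l\<in>L. \<Sum>k\<in>L. cmod (\<mu> l k) * \<delta>)"
          by (rule order_trans[OF norm_sum], rule sum_mono, rule order_trans[OF norm_sum], rule sum_mono,
              subst norm_mult) (intro mult_left_mono R i norm_ge_zero)
        thus "cmod (complex_of_real (b i) * (\<Sum>l\<in>L. \<Sum>k\<in>L. \<mu> l k * cinner (R (E k (u i))) (E l (z i))))
            \<le> b i * (\<Sum>l\<in>L. \<Sum>k\<in>L. cmod (\<mu> l k) * \<delta>)"
          using *(4)[OF i] by (simp add: norm_mult mult_left_mono)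
      qed
      thus ?thesis
        by (simp add: C_def sum_distrib_left mult_ac)
    qed
    ultimately show ?thesis
      by (metis norm_triangle_mono)
  qed
  have "((\<lambda>\<delta>. M * schatten_norm a v + \<delta> * C) \<longlongrightarrow> M * schatten_norm a v + 0 * C) (at_right 0)"
    by (intro tendsto_intros)
  moreover have "eventually (\<lambda>\<delta>. cmod (\<Phi> v) \<le> M * schatten_norm a v + \<delta> * C) (at_right 0)"
    using eventually_at_right_real[OF zero_less_one] by eventually_elim (rule main; simp)
  ultimately have "cmod (\<Phi> v) \<le> M * schatten_norm a v + 0 * C"
    by (rule tendsto_lowerbound) simp
  moreover have "(\<Sum>i\<in>I. complex_of_real (b i) *
      cinner (\<Sum>l\<in>L. \<Sum>k\<in>L. cscale (\<mu> l k) (E l (v (E k (u i))))) (z i)) = \<Phi> v"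
    unfolding \<Phi>_def
    by (intro sum.cong refl arg_cong2[where f = "(*)"]) (simp add: cinner_simps selfadjoint)
  ultimately show "cmod (\<Sum>i\<in>I. complex_of_real (b i) *
      cinner (\<Sum>l\<in>L. \<Sum>k\<in>L. cscale (\<mu> l k) (E l (v (E k (u i))))) (z i)) \<le> M * schatten_norm a v"
    by simp
qed

text \<open>Merging the projections \<open>e j\<close> with equal \<open>f j\<close> makes the symbol a function of \<open>l - k\<close> alone, with
  every difference occurring at most once in each column.\<close>

lemma (in projection_family) projection_family_merge:
  fixes f :: "'l \<Rightarrow> 'k"
  shows "projection_family (f ` L) (\<lambda>l x. \<Sum>j\<in>{j \<in> L. f j = l}. E j x)"
proof
  show "finite (f ` L)"
    using finite_L by simp
next
  fix l :: 'k
  interpret sub: projection_family "{j \<in> L. f j = l}" E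
    by unfold_locales (use finite_L proj disjoint in auto)
  show "orthogonal_projection (\<lambda>x. \<Sum>j\<in>{j \<in> L. f j = l}. E j x)"
    by (rule sub.orthogonal_projection_sum)
next
  fix l k :: 'k and x assume "l \<noteq> k"
  have "E j (\<Sum>i\<in>{i \<in> L. f i = k}. E i x) = 0" if "j \<in> L" "f j = l" for j
    using that \<open>l \<noteq> k\<close> unfolding bounded_clinearD(5)[OF lin[OF that(1)]]
    by (intro sum.neutral) (auto intro: disjoint)
  thus "(\<Sum>j\<in>{j \<in> L. f j = l}. E j (\<Sum>i\<in>{i \<in> L. f i = k}. E i x)) = 0"
    by (intro sum.neutral) auto
qed

lemma (in projection_family) schur_sum_merge:
  assumes v: "bounded_clinear v"
  shows "(\<Sum>j\<in>L. \<Sum>k\<in>L. cscale (\<mu> (f j) (f k)) (E j (v (E k x))))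
    = (\<Sum>l\<in>f ` L. \<Sum>k\<in>f ` L. cscale (\<mu> l k)
        (\<Sum>j\<in>{j \<in> L. f j = l}. E j (v (\<Sum>i\<in>{i \<in> L. f i = k}. E i x))))"
proof -
  have "(\<Sum>j\<in>L. \<Sum>k\<in>L. cscale (\<mu> (f j) (f k)) (E j (v (E k x))))
      = (\<Sum>l\<in>f ` L. \<Sum>j\<in>{j \<in> L. f j = l}. \<Sum>k\<in>f ` L. \<Sum>i\<in>{i \<in> L. f i = k}.
          cscale (\<mu> (f j) (f i)) (E j (v (E i x))))"
    unfolding sum.image_gen[OF finite_L, of _ f] ..
  also have "\<dots> = (\<Sum>l\<in>f ` L. \<Sum>k\<in>f ` L. \<Sum>j\<in>{j \<in> L. f j = l}. \<Sum>i\<in>{i \<in> L. f i = k}.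
          cscale (\<mu> (f j) (f i)) (E j (v (E i x))))"
    by (intro sum.cong refl sum.swap)
  also have "\<dots> = (\<Sum>l\<in>f ` L. \<Sum>k\<in>f ` L. cscale (\<mu> l k)
        (\<Sum>j\<in>{j \<in> L. f j = l}. E j (v (\<Sum>i\<in>{i \<in> L. f i = k}. E i x))))"
  proof (intro sum.cong refl)
    fix l k
    show "(\<Sum>j\<in>{j \<in> L. f j = l}. \<Sum>i\<in>{i \<in> L. f i = k}. cscale (\<mu> (f j) (f i)) (E j (v (E i x))))
        = cscale (\<mu> l k) (\<Sum>j\<in>{j \<in> L. f j = l}. E j (v (\<Sum>i\<in>{i \<in> L. f i = k}. E i x)))"
      unfolding complex_vs.scale_sum_right
      by (intro sum.cong refl)
         (auto simp: bounded_clinearD(5)[OF v] bounded_clinearD(5)[OF lin] complex_vs.scale_sum_right)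
  qed
  finally show ?thesis .
qed

section \<open>Summability of the weights over the integers\<close>

lemma summable_weight_powr:
  fixes p r :: real
  assumes "p > 0" "r > 0" "p / r > 1"
  shows "summable (\<lambda>n. (1 / (1 + real n powr (1 / r))) powr p)"
proof (rule summable_comparison_test_ev)
  show "summable (\<lambda>n. real n powr (- (p / r)))"
    using assms by (subst summable_real_powr_iff) simp
  show "eventually (\<lambda>n. norm ((1 / (1 + real n powr (1 / r))) powr p) \<le> real n powr (- (p / r))) sequentially"
    using eventually_gt_at_top[of 0]
  proof eventually_elim
    case (elim n)
    have "(1 / (1 + real n powr (1 / r))) powr p \<le> (1 / real n powr (1 / r)) powr p"
      using elim assms by (intro powr_mono2 divide_left_mono mult_pos_pos add_pos_pos) auto
    also have "\<dots> = real n powr (- (p / r))"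
      using elim by (simp add: powr_divide powr_powr powr_minus_divide)
    finally show ?case
      by simp
  qed
qed

lemma int_weight_sum_bounded:
  fixes p r :: real
  assumes "p > 0" "r > 0" "p / r > 1"
  obtains W where "W \<ge> 0"
    "\<And>F :: int set. finite F \<Longrightarrow> (\<Sum>j\<in>F. (1 / (1 + real_of_int \<bar>j\<bar> powr (1 / r))) powr p) \<le> W"
proof -
  define h where "h n = (1 / (1 + real n powr (1 / r))) powr p" for n :: nat
  define g where "g j = (1 / (1 + real_of_int \<bar>j\<bar> powr (1 / r))) powr p" for j :: int
  have sm: "summable h"
    unfolding h_def by (rule summable_weight_powr[OF assms])
  have gh: "g j = h (nat \<bar>j\<bar>)" for j
    by (simp add: g_def h_def)
  have h0: "h n \<ge> 0" for n
    by (simp add: h_def)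
  have part: "sum g F \<le> suminf h" if "finite F" "inj_on (\<lambda>j. nat \<bar>j\<bar>) F" for F
  proof -
    have "sum g F = sum h ((\<lambda>j. nat \<bar>j\<bar>) ` F)"
      using that(2) by (simp add: sum.reindex gh)
    also have "\<dots> \<le> suminf h"
      using that(1) sm h0 by (intro sum_le_suminf) auto
    finally show ?thesis .
  qed
  have "sum g F \<le> 2 * suminf h" if F: "finite F" for F
  proof -
    \<comment> \<open>The absolute value is injective on each half, so each half sums to at most the
      series over the natural numbers; hence the factor 2.\<close>
    have "F = {j \<in> F. 0 \<le> j} \<union> {j \<in> F. j < 0}"
      by auto
    hence "sum g F = sum g ({j \<in> F. 0 \<le> j} \<union> {j \<in> F. j < 0})"
      by simp
    also have "\<dots> = sum g {j \<in> F. 0 \<le> j} + sum g {j \<in> F. j < 0}"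
      using F by (intro sum.union_disjoint) auto
    also have "\<dots> \<le> suminf h + suminf h"
      using F by (intro add_mono part) (auto simp: inj_on_def)
    finally show ?thesis
      by simp
  qed
  moreover have "2 * suminf h \<ge> 0"
    using suminf_nonneg[OF sm h0] by simp
  ultimately show ?thesis
    using that unfolding g_def by blast
qed

section \<open>Passage to infinitely many projections\<close>

lemma schur_partial_sum_diff:
  assumes "\<And>j. bounded_clinear (e j)"
  shows "schur_partial_sum e \<mu> (\<lambda>x. u x - v x)
    = (\<lambda>n x. schur_partial_sum e \<mu> u n x - schur_partial_sum e \<mu> v n x)"
  unfolding schur_partial_sum_def[abs_def]
  by (simp add: bounded_clinearD[OF assms] complex_vs.scale_right_diff_distrib sum_subtractf)

lemma schur_partial_sum_add:
  assumes "\<And>j. bounded_clinear (e j)"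
  shows "schur_partial_sum e \<mu> (\<lambda>x. u x + v x)
    = (\<lambda>n x. schur_partial_sum e \<mu> u n x + schur_partial_sum e \<mu> v n x)"
  unfolding schur_partial_sum_def[abs_def]
  by (simp add: bounded_clinearD[OF assms] cscale_add_right sum.distrib)

lemma schur_partial_sum_cscale:
  assumes "\<And>j. bounded_clinear (e j)"
  shows "schur_partial_sum e \<mu> (\<lambda>x. cscale c (v x)) = (\<lambda>n x. cscale c (schur_partial_sum e \<mu> v n x))"
  unfolding schur_partial_sum_def[abs_def]
  by (simp add: bounded_clinearD[OF assms] complex_vs.scale_sum_right cscale_cscale mult.commute)

lemma null_sandwich:
  fixes f g :: "nat \<Rightarrow> real"
  assumes "\<And>n. 0 \<le> f n" "\<And>n. f n \<le> g n" "g \<longlonglongrightarrow> 0"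
  shows "f \<longlonglongrightarrow> 0"
  by (rule tendsto_sandwich[OF _ _ tendsto_const assms(3)]) (simp_all add: assms)

text \<open>The Schatten norm dominates the operator norm. The pointwise limit determines
  \<open>w\<close>, which is what the description in \<open>schur_multiplier\<close>
  requires.\<close>

lemma schatten_limit_pointwise:
  assumes a: "a > 1" and lim: "schatten_limit a V w"
  shows "(\<lambda>n. V n x) \<longlonglongrightarrow> w x"
proof -
  have V: "V n \<in> schatten_class a" and w: "w \<in> schatten_class a"
    and nrm: "(\<lambda>n. schatten_norm a (\<lambda>x. V n x - w x)) \<longlonglongrightarrow> 0" for n
    using lim by (auto simp: schatten_limit_def)
  have "norm (V n x - w x) \<le> schatten_norm a (\<lambda>x. V n x - w x) * norm x" for n
    using dual_bound_norm[OF schatten_class_bounded_clinear schatten_class_imp_dual_bound[OF a],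
        OF schatten_class_diff[OF a V w] schatten_class_diff[OF a V w]] .
  moreover have "(\<lambda>n. schatten_norm a (\<lambda>x. V n x - w x) * norm x) \<longlonglongrightarrow> 0"
    using tendsto_mult_right[OF nrm, of "norm x"] by simp
  ultimately have "(\<lambda>n. norm (V n x - w x)) \<longlonglongrightarrow> 0"
    by (rule null_sandwich[OF norm_ge_zero])
  hence "(\<lambda>n. V n x - w x) \<longlonglongrightarrow> 0"
    by (simp only: tendsto_norm_zero_iff)
  thus ?thesis
    by (simp add: LIM_zero_iff)
qed

lemma schatten_limit_unique:
  assumes "a > 1" "schatten_limit a V w" "schatten_limit a V w'"
  shows "w = w'"
  using LIMSEQ_unique schatten_limit_pointwise[OF assms(1)] assms(2,3) by blast

lemma schatten_norm_nonneg: "0 \<le> schatten_norm a T"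
  by (simp add: schatten_norm_def)

lemma schatten_limit_add:
  assumes a: "a > 1" and "schatten_limit a V w" "schatten_limit a V' w'"
  shows "schatten_limit a (\<lambda>n x. V n x + V' n x) (\<lambda>x. w x + w' x)"
  unfolding schatten_limit_def
proof (intro conjI allI)
  have V: "V n \<in> schatten_class a" "V' n \<in> schatten_class a" and w: "w \<in> schatten_class a" "w' \<in> schatten_class a"
    and nrm: "(\<lambda>n. schatten_norm a (\<lambda>x. V n x - w x)) \<longlonglongrightarrow> 0"
      "(\<lambda>n. schatten_norm a (\<lambda>x. V' n x - w' x)) \<longlonglongrightarrow> 0" for n
    using assms by (auto simp: schatten_limit_def)
  show "(\<lambda>x. V n x + V' n x) \<in> schatten_class a" for n
    by (rule schatten_class_add[OF a V])
  show "(\<lambda>x. w x + w' x) \<in> schatten_class a"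
    by (rule schatten_class_add[OF a w])
  have "schatten_norm a (\<lambda>x. (V n x + V' n x) - (w x + w' x))
      \<le> schatten_norm a (\<lambda>x. V n x - w x) + schatten_norm a (\<lambda>x. V' n x - w' x)" for n
    using schatten_class_add(2)[OF a schatten_class_diff[OF a V(1) w(1)] schatten_class_diff[OF a V(2) w(2)]]
    by (simp add: algebra_simps)
  moreover have "(\<lambda>n. schatten_norm a (\<lambda>x. V n x - w x) + schatten_norm a (\<lambda>x. V' n x - w' x)) \<longlonglongrightarrow> 0"
    using tendsto_add[OF nrm] by simp
  ultimately show "(\<lambda>n. schatten_norm a (\<lambda>x. (V n x + V' n x) - (w x + w' x))) \<longlonglongrightarrow> 0"
    by (rule null_sandwich[OF schatten_norm_nonneg])
qed

lemma schatten_limit_cscale: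
  assumes a: "a > 1" and "schatten_limit a V w"
  shows "schatten_limit a (\<lambda>n x. cscale c (V n x)) (\<lambda>x. cscale c (w x))"
  unfolding schatten_limit_def
proof (intro conjI allI)
  have V: "V n \<in> schatten_class a" and w: "w \<in> schatten_class a"
    and nrm: "(\<lambda>n. schatten_norm a (\<lambda>x. V n x - w x)) \<longlonglongrightarrow> 0" for n
    using assms by (auto simp: schatten_limit_def)
  show "(\<lambda>x. cscale c (V n x)) \<in> schatten_class a" for n
    by (rule schatten_class_cscale[OF a V])
  show "(\<lambda>x. cscale c (w x)) \<in> schatten_class a"
    by (rule schatten_class_cscale[OF a w])
  have "schatten_norm a (\<lambda>x. cscale c (V n x) - cscale c (w x))
      \<le> cmod c * schatten_norm a (\<lambda>x. V n x - w x)" for n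
    using schatten_class_cscale(2)[OF a schatten_class_diff[OF a V w]]
    by (simp add: complex_vs.scale_right_diff_distrib)
  moreover have "(\<lambda>n. cmod c * schatten_norm a (\<lambda>x. V n x - w x)) \<longlonglongrightarrow> 0"
    using tendsto_mult_left[OF nrm, of "cmod c"] by simp
  ultimately show "(\<lambda>n. schatten_norm a (\<lambda>x. cscale c (V n x) - cscale c (w x))) \<longlonglongrightarrow> 0"
    by (rule null_sandwich[OF schatten_norm_nonneg])
qed

locale spectral_resolution =
  fixes e :: "int \<Rightarrow> 'h::chilbert_space \<Rightarrow> 'h"
  assumes resolution: "countable_spectral_resolution e"
begin

lemma projection_family_finite: "finite J \<Longrightarrow> projection_family J e"
  using resolution unfolding countable_spectral_resolution_def
  by unfold_locales (auto simp: fun_eq_iff)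

lemma lin: "bounded_clinear (e j)"
  using resolution by (simp add: countable_spectral_resolution_def orthogonal_projection_def)

definition P :: "nat \<Rightarrow> 'h \<Rightarrow> 'h" where
  "P n x = (\<Sum>j\<in>{- int n..int n}. e j x)"

lemma orthogonal_projection_P: "orthogonal_projection (P n)"
  using projection_family.orthogonal_projection_sum[OF projection_family_finite, of "{- int n..int n}"]
  by (simp add: P_def[abs_def])

lemma P_tendsto: "(\<lambda>n. P n x) \<longlonglongrightarrow> x"
proof -
  have "((\<lambda>j. e j x) has_sum x) UNIV"
    using resolution by (simp add: countable_spectral_resolution_def)
  hence "((\<lambda>J. \<Sum>j\<in>J. e j x) \<longlongrightarrow> x) (finite_subsets_at_top UNIV)"
    by (simp add: has_sum_def)
  \<comment> \<open>Symmetric intervals eventually contain every finite set, so the unconditional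
    sum may be evaluated along them.\<close>
  moreover have "filterlim (\<lambda>n. {- int n..int n}) (finite_subsets_at_top UNIV) sequentially"
    unfolding filterlim_finite_subsets_at_top
  proof (intro allI impI)
    fix X :: "int set" assume "finite X \<and> X \<subseteq> UNIV"
    hence "finite X"
      by simp
    define m where "m = nat (Max (insert 0 (abs ` X)))"
    have "X \<subseteq> {- int n..int n}" if "n \<ge> m" for n
    proof
      fix j assume "j \<in> X"
      hence "\<bar>j\<bar> \<le> Max (insert 0 (abs ` X))"
        using \<open>finite X\<close> by (intro Max_ge) auto
      hence "\<bar>j\<bar> \<le> int n"
        using that by (auto simp: m_def)
      thus "j \<in> {- int n..int n}"
        by auto
    qed
    thus "eventually (\<lambda>n. finite {- int n..int n} \<and> X \<subseteq> {- int n..int n} \<and> {- int n..int n} \<subseteq> UNIV) sequentially"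
      unfolding eventually_sequentially by auto
  qed
  ultimately show ?thesis
    unfolding P_def by (rule filterlim_compose)
qed

lemma e_P:
  "e j (P n x) = (if \<bar>j\<bar> \<le> int n then e j x else 0)" "P n (e j x) = (if \<bar>j\<bar> \<le> int n then e j x else 0)"
proof -
  have ee: "e j (e k x) = (if k = j then e j x else 0)" for j k x
    using resolution by (auto simp: countable_spectral_resolution_def orthogonal_projection_def fun_eq_iff)
  have mem: "\<bar>j\<bar> \<le> int n \<longleftrightarrow> j \<in> {- int n..int n}"
    by auto
  show "e j (P n x) = (if \<bar>j\<bar> \<le> int n then e j x else 0)"
    unfolding P_def bounded_clinearD(5)[OF lin] ee mem by (simp add: sum.delta del: atLeastAtMost_iff)
  have "P n (e j x) = (\<Sum>k\<in>{- int n..int n}. if k = j then e j x else 0)"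
    unfolding P_def by (intro sum.cong) (auto simp: ee)
  thus "P n (e j x) = (if \<bar>j\<bar> \<le> int n then e j x else 0)"
    unfolding mem by (simp add: sum.delta del: atLeastAtMost_iff)
qed

lemma schur_partial_sum_compress:
  assumes v: "bounded_clinear v" and k: "k \<le> n"
  shows "schur_partial_sum e \<mu> (\<lambda>x. P k (v (P k x))) n = schur_partial_sum e \<mu> v k"
proof
  fix x
  have "schur_partial_sum e \<mu> v k x = (\<Sum>j\<in>{- int k..int k}. \<Sum>i\<in>{- int k..int k}.
      cscale (\<mu> j i) (e j (P k (v (P k (e i x))))))"
    unfolding schur_partial_sum_def by (intro sum.cong refl) (auto simp: e_P)
  also have "\<dots> = (\<Sum>j\<in>{- int k..int k}. \<Sum>i\<in>{- int n..int n}.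
      cscale (\<mu> j i) (e j (P k (v (P k (e i x))))))"
    using k by (intro sum.cong refl sum.mono_neutral_left)
      (auto simp: e_P bounded_clinearD[OF v] bounded_clinearD[OF lin])
  also have "\<dots> = (\<Sum>j\<in>{- int n..int n}. \<Sum>i\<in>{- int n..int n}.
      cscale (\<mu> j i) (e j (P k (v (P k (e i x))))))"
    using k by (intro sum.mono_neutral_left) (auto simp: e_P)
  finally show "schur_partial_sum e \<mu> (\<lambda>x. P k (v (P k x))) n x = schur_partial_sum e \<mu> v k x"
    by (simp add: schur_partial_sum_def)
qed

text \<open>Strong convergence of \<open>P n\<close> acts directly on finite rank operators. The
  remainder after splitting off a finite rank part has dual bound \<eta>, which compression
  preserves, so it contributes at most 2 \<eta>.\<close>

lemma compress_tendsto:
  assumes a: "a > 1" and v: "v \<in> schatten_class a"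
  shows "(\<lambda>n. schatten_norm a (\<lambda>x. v x - P n (v (P n x)))) \<longlonglongrightarrow> 0"
    and "(\<lambda>x. v x - P n (v (P n x))) \<in> schatten_class a"
proof -
  have lin_v: "bounded_clinear v" and cpt_v: "compact_operator v"
    using v schatten_class_bounded_clinear schatten_class_compact by auto
  have lin_P: "bounded_clinear (P n)" and sa: "cinner (P n x) y = cinner x (P n y)" for n x y
    using orthogonal_projection_P by (auto simp: orthogonal_projection_def)
  have cpt: "compact_operator (\<lambda>x. v x - P n (v (P n x)))" for n
    by (intro compact_operator_diff cpt_v compact_operator_compose_left[OF lin_P]
        compact_operator_compose_right[OF cpt_v lin_P])
  show "(\<lambda>x. v x - P n (v (P n x))) \<in> schatten_class a"
    using dual_bound_diff[OF schatten_class_imp_dual_bound[OF a v]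
        dual_bound_compress[OF orthogonal_projection_P lin_v schatten_class_imp_dual_bound[OF a v]]]
    by (rule dual_bound_imp_schatten_class[OF a cpt])
  show "(\<lambda>n. schatten_norm a (\<lambda>x. v x - P n (v (P n x)))) \<longlonglongrightarrow> 0"
  proof (rule metric_LIMSEQ_I)
    fix \<epsilon> :: real assume \<epsilon>: "\<epsilon> > 0"
    define \<eta> where "\<eta> = \<epsilon> / 4"
    have \<eta>: "\<eta> > 0"
      using \<epsilon> by (simp add: \<eta>_def)
    obtain B where B: "finite B" "dual_bound a (\<lambda>x. v x - (\<Sum>b\<in>B. cscale (cinner x b) (v b))) \<eta>"
      using finite_rank_approximation[OF a v \<eta>] by blast
    define A where "A x = (\<Sum>b\<in>B. cscale (cinner x b) (v b))" for x
    define R where "R x = v x - A x" for x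
    have lin_A: "bounded_clinear A"
      unfolding A_def by (intro bounded_clinear_sum bounded_clinear_rank_one)
    have lin_R: "bounded_clinear R"
      unfolding R_def by (intro bounded_clinear_diff lin_v lin_A)
    have R: "dual_bound a R \<eta>"
      using B(2) by (simp add: R_def[abs_def] A_def)
    \<comment> \<open>Inserting \<open>cscale (cinner x (P n b)) (v b)\<close> between each term of
      \<open>A\<close> and its compression leaves two rank one operators, whose norms are summed
      here.\<close>
    define \<rho> where "\<rho> n = (\<Sum>b\<in>B. norm (b - P n b) * norm (v b) + norm (P n b) * norm (v b - P n (v b)))" for n
    have bound: "schatten_norm a (\<lambda>x. v x - P n (v (P n x))) \<le> (\<eta> + \<eta>) + \<rho> n" for n
    proof (rule dual_bound_imp_schatten_class(2)[OF a cpt])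
      have "A x - P n (A (P n x)) = (\<Sum>b\<in>B. cscale (cinner x (b - P n b)) (v b)
          + cscale (cinner x (P n b)) (v b - P n (v b)))" for x
        unfolding A_def bounded_clinearD[OF lin_P] sum_subtractf[symmetric]
        by (intro sum.cong refl)
           (simp add: cinner_simps sa complex_vs.scale_left_diff_distrib complex_vs.scale_right_diff_distrib)
      hence "(\<lambda>x. v x - P n (v (P n x))) = (\<lambda>x. (R x - P n (R (P n x))) +
          (\<Sum>b\<in>B. cscale (cinner x (b - P n b)) (v b) + cscale (cinner x (P n b)) (v b - P n (v b))))"
        by (simp add: fun_eq_iff R_def bounded_clinearD[OF lin_P] flip: \<open>\<And>x. A x - P n (A (P n x)) = _\<close>)
      moreover have "dual_bound a (\<lambda>x. (R x - P n (R (P n x))) +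
          (\<Sum>b\<in>B. cscale (cinner x (b - P n b)) (v b) + cscale (cinner x (P n b)) (v b - P n (v b))))
          ((\<eta> + \<eta>) + \<rho> n)"
        unfolding \<rho>_def
        by (intro dual_bound_add dual_bound_diff R dual_bound_compress[OF orthogonal_projection_P lin_R R]
            dual_bound_sum dual_bound_rank_one a)
      ultimately show "dual_bound a (\<lambda>x. v x - P n (v (P n x))) ((\<eta> + \<eta>) + \<rho> n)"
        by (simp only:)
    qed
    have "\<rho> \<longlonglongrightarrow> (\<Sum>b\<in>B. norm (b - b) * norm (v b) + norm b * norm (v b - v b))"
      unfolding \<rho>_def by (intro tendsto_intros P_tendsto)
    hence "\<rho> \<longlonglongrightarrow> 0"
      by simp
    hence "eventually (\<lambda>n. \<rho> n < \<eta>) sequentially"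
      using \<eta> by (rule order_tendstoD(2))
    then obtain n0 where n0: "\<And>n. n \<ge> n0 \<Longrightarrow> \<rho> n < \<eta>"
      unfolding eventually_sequentially by blast
    have "dist (schatten_norm a (\<lambda>x. v x - P n (v (P n x)))) 0 < \<epsilon>" if "n \<ge> n0" for n
      using bound[of n] n0[OF that] \<eta> schatten_norm_nonneg[of a "\<lambda>x. v x - P n (v (P n x))"]
      by (simp add: \<eta>_def)
    thus "\<exists>n0. \<forall>n\<ge>n0. dist (schatten_norm a (\<lambda>x. v x - P n (v (P n x)))) 0 < \<epsilon>"
      by blast
  qed
qed

end

text \<open>The limit argument depends on the symbol only through a bound uniform in
  \<open>n\<close>, which is isolated here.\<close>

locale bounded_partial_sums = spectral_resolution e
  for e :: "int \<Rightarrow> 'h::chilbert_space \<Rightarrow> 'h" +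
  fixes a :: real and \<mu> :: "int \<Rightarrow> int \<Rightarrow> complex" and K :: real
  assumes a: "a > 1" and K: "K \<ge> 0"
    and bound: "v \<in> schatten_class a \<Longrightarrow> dual_bound a (schur_partial_sum e \<mu> v n) (K * schatten_norm a v)"
begin

lemma compact_partial_sum:
  assumes "v \<in> schatten_class a"
  shows "compact_operator (schur_partial_sum e \<mu> v n)"
  unfolding schur_partial_sum_def
  by (intro compact_operator_sum compact_operator_cscale compact_operator_compose_left[OF lin]
      compact_operator_compose_right[OF schatten_class_compact[OF assms] lin])

lemma partial_sum_schatten_class:
  "v \<in> schatten_class a \<Longrightarrow> schur_partial_sum e \<mu> v n \<in> schatten_class a"
  using dual_bound_imp_schatten_class(1)[OF a compact_partial_sum bound] by blast

text \<open>For \<open>k \<le> n\<close> the \<open>k\<close>-th partial sum of \<open>v\<close> is the \<open>n\<close>-th partial sum of \<open>P k v P k\<close>, so the uniform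
  bound, applied to \<open>v - P k v P k\<close>, makes the partial sums Cauchy.\<close>

lemma schatten_limit_exists:
  assumes v: "v \<in> schatten_class a"
  obtains w where "schatten_limit a (schur_partial_sum e \<mu> v) w" "schatten_norm a w \<le> K * schatten_norm a v"
proof -
  let ?V = "schur_partial_sum e \<mu> v"
  define \<eta> where "\<eta> k = K * schatten_norm a (\<lambda>x. v x - P k (v (P k x)))" for k
  have lin_v: "bounded_clinear v"
    using v by (rule schatten_class_bounded_clinear)
  have \<eta>0: "\<eta> \<longlonglongrightarrow> 0"
    unfolding \<eta>_def using tendsto_mult_left[OF compress_tendsto(1)[OF a v], of K] by simp
  have Cauchy_bound: "dual_bound a (\<lambda>x. ?V n x - ?V k x) (\<eta> k)" if "k \<le> n" for n k
  proof -
    have "schur_partial_sum e \<mu> (\<lambda>x. v x - P k (v (P k x))) n = (\<lambda>x. ?V n x - ?V k x)"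
      by (simp add: fun_eq_iff schur_partial_sum_diff[OF lin] schur_partial_sum_compress[OF lin_v that])
    thus ?thesis
      using bound[OF compress_tendsto(2)[OF a v, of k], where n = n] by (simp add: \<eta>_def)
  qed
  have lin_V: "bounded_clinear (?V n)" for n
    by (rule compact_operator_bounded_clinear[OF compact_partial_sum[OF v]])
  have diff: "norm (?V n x - ?V k x) \<le> \<eta> k * norm x" if "k \<le> n" for n k x
    using dual_bound_norm[OF bounded_clinear_diff[OF lin_V lin_V] Cauchy_bound[OF that]] .
  have "Cauchy (\<lambda>n. ?V n x)" for x
  proof (rule metric_CauchyI)
    fix \<epsilon> :: real assume \<epsilon>: "\<epsilon> > 0"
    have "(\<lambda>k. \<eta> k * norm x) \<longlonglongrightarrow> 0"
      using tendsto_mult_right[OF \<eta>0, of "norm x"] by simp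
    hence "eventually (\<lambda>k. \<eta> k * norm x < \<epsilon> / 2) sequentially"
      using \<epsilon> by (intro order_tendstoD(2)) auto
    then obtain k where k: "\<eta> k * norm x < \<epsilon> / 2"
      by (meson eventually_sequentially order_refl)
    have "dist (?V m x) (?V n x) < \<epsilon>" if "m \<ge> k" "n \<ge> k" for m n
      using diff[OF that(1), of x] diff[OF that(2), of x] k dist_triangle2[of "?V m x" "?V n x" "?V k x"]
      by (simp add: dist_norm)
    thus "\<exists>M. \<forall>m\<ge>M. \<forall>n\<ge>M. dist (?V m x) (?V n x) < \<epsilon>"
      by blast
  qed
  hence "\<exists>y. (\<lambda>n. ?V n x) \<longlonglongrightarrow> y" for x
    using Cauchy_convergent convergent_def by blast
  \<comment> \<open>In place of completeness of the Schatten class the limit is built pointwise;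
    linearity, compactness and the Schatten bounds of \<open>w\<close> are then recovered from the
    partial sums.\<close>
  then obtain w where w: "\<And>x. (\<lambda>n. ?V n x) \<longlonglongrightarrow> w x"
    by metis
  have lin_w: "bounded_clinear w"
  proof (rule bounded_clinear_intro[where K = "K * schatten_norm a v"])
    fix x y c
    have "(\<lambda>n. ?V n x + ?V n y) \<longlonglongrightarrow> w (x + y)"
      using w[of "x + y"] by (simp add: bounded_clinearD(1)[OF lin_V])
    thus "w (x + y) = w x + w y"
      by (rule LIMSEQ_unique[OF _ tendsto_add[OF w w]])
    have "bounded_linear (cscale c :: 'h \<Rightarrow> 'h)"
      using bounded_clinear_cscale[OF bounded_clinear_id, of c] by (simp add: bounded_clinear_def)
    hence "(\<lambda>n. cscale c (?V n x)) \<longlonglongrightarrow> cscale c (w x)"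
      by (rule bounded_linear.tendsto[OF _ w])
    moreover have "(\<lambda>n. cscale c (?V n x)) \<longlonglongrightarrow> w (cscale c x)"
      using w[of "cscale c x"] by (simp add: bounded_clinearD(4)[OF lin_V])
    ultimately show "w (cscale c x) = cscale c (w x)"
      using LIMSEQ_unique by blast
    show "norm (w x) \<le> K * schatten_norm a v * norm x"
      by (rule LIMSEQ_le_const2[OF tendsto_norm[OF w]]) (use dual_bound_norm[OF lin_V bound[OF v]] in auto)
  qed
  \<comment> \<open>Keeping \<open>k\<close> fixed and letting \<open>n\<close> grow turns the
    Cauchy estimate into a rate of convergence.\<close>
  have w_bound: "dual_bound a (\<lambda>x. ?V k x - w x) (\<eta> k)" for k
  proof (rule dual_bound_limit)
    show "(\<lambda>n. ?V k x - ?V n x) \<longlonglongrightarrow> ?V k x - w x" for x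
      by (intro tendsto_intros w)
    have "dual_bound a (\<lambda>x. ?V k x - ?V n x) (\<eta> k)" if "k \<le> n" for n
      using dual_bound_cscale[OF Cauchy_bound[OF that], of "-1"] by (simp add: cscale_minus_one)
    thus "eventually (\<lambda>n. dual_bound a (\<lambda>x. ?V k x - ?V n x) (\<eta> k)) sequentially"
      unfolding eventually_sequentially by blast
  qed
  have cpt: "compact_operator w"
  proof (rule compact_operator_limit[OF lin_w])
    fix \<epsilon> :: real assume "\<epsilon> > 0"
    with \<eta>0 have "eventually (\<lambda>k. \<eta> k < \<epsilon>) sequentially"
      by (rule order_tendstoD(2))
    then obtain k where k: "\<eta> k < \<epsilon>"
      by (meson eventually_sequentially order_refl)
    have "norm (?V k x - w x) \<le> \<epsilon> * norm x" for x
      using dual_bound_norm[OF bounded_clinear_diff[OF lin_V lin_w] w_bound, of k x] k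
      by (meson less_imp_le mult_right_mono norm_ge_zero order_trans)
    thus "\<exists>S. compact_operator S \<and> (\<forall>x. norm (S x - w x) \<le> \<epsilon> * norm x)"
      using compact_partial_sum[OF v] by blast
  qed
  have "dual_bound a w (K * schatten_norm a v)"
    by (rule dual_bound_limit[OF w]) (simp add: bound[OF v])
  note w_class = dual_bound_imp_schatten_class[OF a cpt this]
  have "schatten_norm a (\<lambda>x. ?V k x - w x) \<le> \<eta> k" for k
    using dual_bound_imp_schatten_class(2)[OF a compact_operator_diff[OF compact_partial_sum[OF v] cpt] w_bound] .
  hence "(\<lambda>k. schatten_norm a (\<lambda>x. ?V k x - w x)) \<longlonglongrightarrow> 0"
    by (rule null_sandwich[OF schatten_norm_nonneg _ \<eta>0])
  hence "schatten_limit a ?V w"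
    using partial_sum_schatten_class[OF v] w_class(1) by (simp add: schatten_limit_def)
  thus ?thesis
    using that w_class(2) by blast
qed

lemma schatten_limit_ex1:
  "v \<in> schatten_class a \<Longrightarrow> \<exists>!w. schatten_limit a (schur_partial_sum e \<mu> v) w"
  using schatten_limit_exists schatten_limit_unique[OF a] by metis

lemma schur_multiplier_limit:
  "v \<in> schatten_class a \<Longrightarrow> schatten_limit a (schur_partial_sum e \<mu> v) (schur_multiplier a e \<mu> v)"
  unfolding schur_multiplier_def by (rule theI'[OF schatten_limit_ex1])

lemma schur_multiplier_eqI:
  "v \<in> schatten_class a \<Longrightarrow> schatten_limit a (schur_partial_sum e \<mu> v) w \<Longrightarrow> schur_multiplier a e \<mu> v = w"
  using schatten_limit_unique[OF a] schur_multiplier_limit by blast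

lemma schur_multiplier_norm:
  assumes "v \<in> schatten_class a"
  shows "schatten_norm a (schur_multiplier a e \<mu> v) \<le> K * schatten_norm a v"
  using schatten_limit_exists[OF assms] schur_multiplier_eqI[OF assms] by metis

lemma bounded_schur_multiplier: "bounded_schatten_operator a (schur_multiplier a e \<mu>)"
  unfolding bounded_schatten_operator_def
proof (intro conjI ballI allI)
  fix u v :: "'h \<Rightarrow> 'h" and c :: complex
  assume v: "v \<in> schatten_class a"
  show "schur_multiplier a e \<mu> v \<in> schatten_class a"
    using schur_multiplier_limit[OF v] by (simp add: schatten_limit_def)
  have "schatten_limit a (schur_partial_sum e \<mu> (\<lambda>x. cscale c (v x))) (\<lambda>x. cscale c (schur_multiplier a e \<mu> v x))"
    using schatten_limit_cscale[OF a schur_multiplier_limit[OF v], of c]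
    by (simp add: schur_partial_sum_cscale[OF lin])
  thus "schur_multiplier a e \<mu> (\<lambda>x. cscale c (v x)) = (\<lambda>x. cscale c (schur_multiplier a e \<mu> v x))"
    by (rule schur_multiplier_eqI[OF schatten_class_cscale(1)[OF a v]])
  assume u: "u \<in> schatten_class a"
  have "schatten_limit a (schur_partial_sum e \<mu> (\<lambda>x. u x + v x))
      (\<lambda>x. schur_multiplier a e \<mu> u x + schur_multiplier a e \<mu> v x)"
    using schatten_limit_add[OF a schur_multiplier_limit[OF u] schur_multiplier_limit[OF v]]
    by (simp add: schur_partial_sum_add[OF lin])
  thus "schur_multiplier a e \<mu> (\<lambda>x. u x + v x) = (\<lambda>x. schur_multiplier a e \<mu> u x + schur_multiplier a e \<mu> v x)"
    by (rule schur_multiplier_eqI[OF schatten_class_add(1)[OF a u v]])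
next
  show "\<exists>K. \<forall>v\<in>schatten_class a. schatten_norm a (schur_multiplier a e \<mu> v) \<le> K * schatten_norm a v"
    using schur_multiplier_norm by blast
qed

lemma schur_multiplier_operator_norm: "schatten_operator_norm a (schur_multiplier a e \<mu>) \<le> K"
  unfolding schatten_operator_norm_def
proof (rule cSUP_least)
  have "schatten_norm a (\<lambda>_ :: 'h. 0 :: 'h) \<le> 0"
    by (rule dual_bound_imp_schatten_class(2)[OF a compact_operator_zero dual_bound_zero])
  thus "{v :: 'h \<Rightarrow> 'h. v \<in> schatten_class a \<and> schatten_norm a v \<le> 1} \<noteq> {}"
    using schatten_class_zero[OF a] by (auto intro: exI[of _ "\<lambda>_. 0"])
next
  fix v :: "'h \<Rightarrow> 'h"
  assume "v \<in> {v \<in> schatten_class a. schatten_norm a v \<le> 1}"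
  hence "schatten_norm a (schur_multiplier a e \<mu> v) \<le> K * schatten_norm a v" "schatten_norm a v \<le> 1"
    using schur_multiplier_norm by auto
  thus "schatten_norm a (schur_multiplier a e \<mu> v) \<le> K"
    using K mult_left_mono[of "schatten_norm a v" 1 K] by simp
qed

end

section \<open>Uniform estimate for the symbols \<open>m (f j - f k)\<close>\<close>

theorem corollary3p7:
  fixes a r :: real
  assumes "1 < a" and "a \<noteq> 2" and "1 \<le> r" and "1 / r > \<bar>1 / a - 1 / 2\<bar>"
  shows "\<exists>C\<ge>0. \<forall>(e :: int \<Rightarrow> 'h::chilbert_space \<Rightarrow> 'h) (m :: int \<Rightarrow> complex) (f :: int \<Rightarrow> int).
    countable_spectral_resolution e \<longrightarrow>
    bdd_above (range (\<lambda>j. (1 + real_of_int \<bar>j\<bar> powr (1 / r)) * cmod (m j))) \<longrightarrow>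
    (let mf = (\<lambda>j k. m (f j - f k));
         Cm = (SUP j. (1 + real_of_int \<bar>j\<bar> powr (1 / r)) * cmod (m j))
     in (\<forall>v\<in>schatten_class a. \<exists>!w. schatten_limit a (schur_partial_sum e mf v) w) \<and>
        bounded_schatten_operator a (schur_multiplier a e mf) \<and>
        schatten_operator_norm a (schur_multiplier a e mf) \<le> C * Cm)"
proof -
  define \<theta> where "\<theta> = \<bar>2 / a - 1\<bar>"
  define p where "p = 2 / \<theta>"
  have \<theta>: "\<theta> > 0"
    using assms(1,2) by (auto simp: \<theta>_def field_simps)
  \<comment> \<open>So \<open>p\<close> is the reciprocal of
    \<open>\<bar>1 / a - 1 / 2\<bar>\<close>, and the strict inequality assumed for \<open>r\<close>
    says exactly p > r.\<close>
  have "\<theta> = 2 * \<bar>1 / a - 1 / 2\<bar>"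
    by (simp add: \<theta>_def abs_if)
  hence "\<theta> / 2 < 1 / r"
    using assms(4) by simp
  hence p: "p > 0" "p / r > 1"
    using \<theta> assms(3) by (auto simp: p_def field_simps)
  have r: "r > 0"
    using assms(3) by simp
  obtain W where W: "W \<ge> 0"
    "\<And>F :: int set. finite F \<Longrightarrow> (\<Sum>j\<in>F. (1 / (1 + real_of_int \<bar>j\<bar> powr (1 / r))) powr p) \<le> W"
    using int_weight_sum_bounded[OF p(1) r p(2)] by metis
  show ?thesis
  \<comment> \<open>The constant is the bound for the \<open>\<ell>\<^sup>p\<close> norm of the
    weights; it is fixed before \<open>e\<close>, \<open>m\<close> and \<open>f\<close> and depends
    on \<open>a\<close> and \<open>r\<close> only.\<close>
  proof (intro exI[of _ "W powr (1 / p)"] conjI allI impI)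
    fix e :: "int \<Rightarrow> 'h \<Rightarrow> 'h" and m :: "int \<Rightarrow> complex" and f :: "int \<Rightarrow> int"
    assume e: "countable_spectral_resolution e"
      and bdd: "bdd_above (range (\<lambda>j. (1 + real_of_int \<bar>j\<bar> powr (1 / r)) * cmod (m j)))"
    interpret spectral_resolution e
      by unfold_locales (rule e)
    define Cm where "Cm = (SUP j. (1 + real_of_int \<bar>j\<bar> powr (1 / r)) * cmod (m j))"
    have m: "(1 + real_of_int \<bar>j\<bar> powr (1 / r)) * cmod (m j) \<le> Cm" for j
      unfolding Cm_def using bdd by (intro cSUP_upper) auto
    have Cm: "Cm \<ge> 0"
      using m[of 0] by (rule order_trans[rotated]) simp
    have column: "(\<Sum>j\<in>F. cmod (m j) powr p) \<le> (W powr (1 / p) * Cm) powr p" if F: "finite F" for F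
    proof -
      have "(\<Sum>j\<in>F. cmod (m j) powr p) \<le> (\<Sum>j\<in>F. Cm powr p * (1 / (1 + real_of_int \<bar>j\<bar> powr (1 / r))) powr p)"
      proof (rule sum_mono)
        fix j
        have "cmod (m j) \<le> Cm * (1 / (1 + real_of_int \<bar>j\<bar> powr (1 / r)))"
          using m[of j] by (simp add: pos_le_divide_eq add_pos_nonneg mult.commute)
        hence "cmod (m j) powr p \<le> (Cm * (1 / (1 + real_of_int \<bar>j\<bar> powr (1 / r)))) powr p"
          using p by (intro powr_mono2) auto
        also have "\<dots> = Cm powr p * (1 / (1 + real_of_int \<bar>j\<bar> powr (1 / r))) powr p"
          using Cm by (subst powr_mult) auto
        finally show "cmod (m j) powr p \<le> Cm powr p * (1 / (1 + real_of_int \<bar>j\<bar> powr (1 / r))) powr p" .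
      qed
      also have "\<dots> \<le> Cm powr p * W"
        unfolding sum_distrib_left[symmetric] using W(2)[OF F] by (intro mult_left_mono) auto
      also have "\<dots> = (W powr (1 / p) * Cm) powr p"
        using W(1) Cm p(1) by (simp add: powr_mult powr_powr)
      finally show ?thesis .
    qed
    have dual: "dual_bound a (schur_partial_sum e (\<lambda>j k. m (f j - f k)) v n)
        ((W powr (1 / p) * Cm) * schatten_norm a v)" if v: "v \<in> schatten_class a" for v n
    proof -
      define J where "J = {- int n..int n}"
      interpret J: projection_family J e
        by (rule projection_family_finite) (simp add: J_def)
      define E where "E l x = (\<Sum>j\<in>{j \<in> J. f j = l}. e j x)" for l x
      interpret E: projection_family "f ` J" E
        using J.projection_family_merge[of f] by (simp add: E_def[abs_def])
      have "(\<Sum>l\<in>f ` J. cmod (m (l - k)) powr (2 / \<theta>)) \<le> (W powr (1 / p) * Cm) powr (2 / \<theta>)" for k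
      proof -
        \<comment> \<open>For fixed \<open>k\<close> the difference \<open>l - k\<close> is
          injective in \<open>l\<close>, so a column of the merged symbol is a sum of values of
          \<open>m\<close> at distinct integers.\<close>
        have "(\<Sum>l\<in>f ` J. cmod (m (l - k)) powr p) = (\<Sum>j\<in>(\<lambda>l. l - k) ` f ` J. cmod (m j) powr p)"
          by (subst sum.reindex) (auto simp: inj_on_def)
        also have "\<dots> \<le> (W powr (1 / p) * Cm) powr p"
          by (rule column) (simp add: J_def)
        finally show ?thesis
          by (simp add: p_def)
      qed
      hence "dual_bound a (\<lambda>x. \<Sum>l\<in>f ` J. \<Sum>k\<in>f ` J. cscale (m (l - k)) (E l (v (E k x))))
          ((W powr (1 / p) * Cm) * schatten_norm a v)"
        using Cm by (intro E.dual_bound_schur[OF assms(1,2) \<theta>_def _ _ v]) auto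
      moreover have "schur_partial_sum e (\<lambda>j k. m (f j - f k)) v n
          = (\<lambda>x. \<Sum>l\<in>f ` J. \<Sum>k\<in>f ` J. cscale (m (l - k)) (E l (v (E k x))))"
        using J.schur_sum_merge[OF schatten_class_bounded_clinear[OF v], of "\<lambda>l k. m (l - k)" f]
        by (simp add: schur_partial_sum_def fun_eq_iff E_def J_def)
      ultimately show ?thesis
        by simp
    qed
    interpret bounded_partial_sums e a "\<lambda>j k. m (f j - f k)" "W powr (1 / p) * Cm"
      by unfold_locales (use assms(1) Cm dual in auto)
    show "let mf = (\<lambda>j k. m (f j - f k));
         Cm = (SUP j. (1 + real_of_int \<bar>j\<bar> powr (1 / r)) * cmod (m j))
     in (\<forall>v\<in>schatten_class a. \<exists>!w. schatten_limit a (schur_partial_sum e mf v) w) \<and>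
        bounded_schatten_operator a (schur_multiplier a e mf) \<and>
        schatten_operator_norm a (schur_multiplier a e mf) \<le> W powr (1 / p) * Cm"
      unfolding Let_def Cm_def[symmetric]
      using schatten_limit_ex1 bounded_schur_multiplier schur_multiplier_operator_norm by blast
  qed simp
qed

end
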